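(* Let $\widetilde x$ be a $T$-periodic cycle of the planar system $\dot x=f(x)$, $x\in\mathbb{R}^2$, and let $U\subset\mathbb{R}^2$ be the interior of $\widetilde x$. Assume that $\Phi^s(\xi)\neq0$ for every $\xi\in\partial U$ and every $s\in[0,T]$, and that ($A_1$) $\widetilde x$ is the only $T$-periodic cycle of $\dot x=f(x)$ in some neighbourhood of $\partial U$. If $d_{\mathbb{R}^2}(-\Phi^T,U)\neq1$, then there exists $\varepsilon_0>0$ such that for all $\varepsilon\in(0,\varepsilon_0]$ the system $\dot x=f(x)+\varepsilon g(t,x,\varepsilon)$ has at least two $T$-periodic solutions $x_{\varepsilon,1}$ and $x_{\varepsilon,2}$ such that $$\rho(x_{\varepsilon,1}(t),\partial U)+\rho(x_{\varepsilon,2}(t),\partial U)\to0\quad\text{as }\varepsilon\to0 .$$ Moreover, $x_{\varepsilon,1}(t)\in U$ and $x_{\varepsilon,2}(t)\notin U$ for all $t\in[0,T]$, and every other $T$-periodic solution $x$ of $\dot x=f(x)+\varepsilon g(t,x,\varepsilon)$ satisfies $x(t)\notin\partial U$ for all $t\in[0,T]$.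
   Context: $T>0$; $f:\mathbb{R}^2\to\mathbb{R}^2$ is continuously differentiable; $g:\mathbb{R}\times\mathbb{R}^2\times[0,1]\to\mathbb{R}^2$ is continuous and $T$-periodic in the first variable. $\Omega(\cdot,t_0,\xi)$ is the solution of $\dot x=f(x)$ with value $\xi$ at time $t_0$; it is assumed that these solutions extend to $[0,T]$ for all $t_0\in[0,T]$, $\xi\in\mathbb{R}^2$. A cycle is a nonconstant periodic solution; its interior is the bounded component of the complement of the Jordan curve it traces. Uniqueness in ($A_1$) is up to time shift: $\partial U$ has a neighbourhood in which no $T$-periodic cycle other than time shifts of $\widetilde x$ lies (cycles of periods other than $T$ are allowed). $\Phi^s(\xi)=\eta(T,s,\xi)-\eta(0,s,\xi)$, $s\in[0,T]$, where $\eta(\cdot,s,\xi)$ is the solution of $\dot y=f'(\Omega(t,0,\xi))y+g(t,\Omega(t,0,\xi),0)$ with $\eta(s,s,\xi)=0$. $d_{\mathbb{R}^2}$ is the Brouwer degree with respect to $0$; $\rho(\xi,K)=\min_{\zeta\in K}\|\xi-\zeta\|$. *)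

theory Defs
  imports "HOL-Analysis.Analysis"
begin

definition ode_solution ::
  "(real \<Rightarrow> 'a \<Rightarrow> 'a) \<Rightarrow> real set \<Rightarrow> (real \<Rightarrow> 'a::real_normed_vector) \<Rightarrow> bool" where
  "ode_solution F S x \<longleftrightarrow> (\<forall>t\<in>S. (x has_vector_derivative F t (x t)) (at t within S))"

definition periodic_solution ::
  "real \<Rightarrow> (real \<Rightarrow> 'a \<Rightarrow> 'a) \<Rightarrow> (real \<Rightarrow> 'a::real_normed_vector) \<Rightarrow> bool" where
  "periodic_solution T F x \<longleftrightarrow> ode_solution F UNIV x \<and> (\<forall>t. x (t + T) = x t)"

(* T is some period of the cycle, not necessarily the least one. *)
definition periodic_cycle ::
  "real \<Rightarrow> ('a \<Rightarrow> 'a) \<Rightarrow> (real \<Rightarrow> 'a::real_normed_vector) \<Rightarrow> bool" where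
  "periodic_cycle T f x \<longleftrightarrow> periodic_solution T (\<lambda>_. f) x \<and> (\<exists>s t. x s \<noteq> x t)"

(* In Omega and eta below, the chosen function is meaningful for t in [0,T] only; there it
   is the unique solution, provided f is C^1 and a solution on [0,T] exists. *)
definition Omega :: "('a \<Rightarrow> 'a) \<Rightarrow> real \<Rightarrow> real \<Rightarrow> real \<Rightarrow> 'a \<Rightarrow> 'a::real_normed_vector" where
  "Omega f T t t0 \<xi> = (SOME x. ode_solution (\<lambda>_. f) {0..T} x \<and> x t0 = \<xi>) t"

definition eta ::
  "('a \<Rightarrow> 'a) \<Rightarrow> ('a \<Rightarrow> 'a \<Rightarrow>\<^sub>L 'a) \<Rightarrow> (real \<Rightarrow> 'a \<Rightarrow> real \<Rightarrow> 'a) \<Rightarrow>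
    real \<Rightarrow> real \<Rightarrow> real \<Rightarrow> 'a \<Rightarrow> 'a::real_normed_vector" where
  "eta f f' g T t s \<xi> =
    (SOME y. ode_solution
        (\<lambda>t v. blinfun_apply (f' (Omega f T t 0 \<xi>)) v + g t (Omega f T t 0 \<xi>) 0) {0..T} y
      \<and> y s = 0) t"

definition Phi ::
  "('a \<Rightarrow> 'a) \<Rightarrow> ('a \<Rightarrow> 'a \<Rightarrow>\<^sub>L 'a) \<Rightarrow> (real \<Rightarrow> 'a \<Rightarrow> real \<Rightarrow> 'a) \<Rightarrow>
    real \<Rightarrow> real \<Rightarrow> 'a \<Rightarrow> 'a::real_normed_vector" where
  "Phi f f' g T s \<xi> = eta f f' g T T s \<xi> - eta f f' g T 0 s \<xi>"

(* Analytic definition of the Brouwer degree of F on U with respect to 0, for U bounded and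
   open, F continuous on the closure of U and zero-free on its frontier: the signed count of
   zeros of any map G that is continuous on the closure, C^1 in U, uniformly closer to F than
   the distance from 0 to F(frontier U), and has 0 as a regular value. The last bound makes G
   zero-free on the frontier, so its (isolated) zeros in U are finitely many. *)
definition regular_approximation ::
  "(real^'n \<Rightarrow> real^'n) \<Rightarrow> (real^'n) set \<Rightarrow>
    (real^'n \<Rightarrow> real^'n) \<Rightarrow> (real^'n \<Rightarrow> (real^'n) \<Rightarrow>\<^sub>L (real^'n)) \<Rightarrow> bool" where
  "regular_approximation F U G G' \<longleftrightarrow>
    continuous_on (closure U) G \<and>
    (\<forall>x\<in>U. (G has_derivative blinfun_apply (G' x)) (at x)) \<and>
    continuous_on U G' \<and>
    (\<forall>x\<in>closure U. \<forall>y\<in>frontier U. norm (G x - F x) < norm (F y)) \<and>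
    (\<forall>x\<in>U. G x = 0 \<longrightarrow> det (matrix (blinfun_apply (G' x))) \<noteq> 0)"

definition brouwer_degree :: "(real^'n \<Rightarrow> real^'n) \<Rightarrow> (real^'n) set \<Rightarrow> int" where
  "brouwer_degree F U = (THE d. \<exists>G G'. regular_approximation F U G G' \<and>
    real_of_int d = (\<Sum>x\<in>{x\<in>U. G x = 0}. sgn (det (matrix (blinfun_apply (G' x))))))"

end

theory Submission
  imports Defs "HOL-Complex_Analysis.Complex_Analysis"
begin

text \<open>
  Follow solutions backwards from their value \<open>v\<close> at time \<open>T\<close>: a \<open>T\<close>-periodic solution of the perturbed
  system is a zero of the displacement \<open>M\<^sub>\<epsilon> v = x(0) - v\<close>. On the cycle, \<open>M\<^sub>\<epsilon> = - \<epsilon> \<Phi>\<^sup>T + o(\<epsilon>)\<close>, so the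
  winding number of \<open>M\<^sub>\<epsilon> / f\<close> along the cycle is, up to orientation, \<open>d(-\<Phi>\<^sup>T, U) - 1 \<noteq> 0\<close>; here one
  uses that \<open>f\<close>, being tangent to \<open>\<partial>U\<close>, has winding number 1.

  On either side of the cycle there is a nearby loop, homotopic to the cycle within that side, along
  which \<open>M\<^sub>0 / f\<close> is zero-free with winding number 0. If some parallel curve meets no closed orbit with
  period in \<open>[T, T + \<delta>]\<close>, it is such a loop: prolong the flow time from \<open>T\<close> to \<open>T + \<delta>\<close>, after which the
  displacement points against \<open>f\<close>. Otherwise there is a closed orbit of period \<open>S \<in> (T, T + \<delta>]\<close> arbitrarily
  close to the cycle, and along it \<open>M\<^sub>0\<close> is the displacement by the short time \<open>S - T\<close>, which points
  along \<open>f\<close>. For small \<open>\<epsilon>\<close> the two winding numbers persist, and \<open>M\<^sub>\<epsilon>\<close> must vanish between the loop and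
  the cycle. As \<open>g\<close> is only continuous, \<open>M\<^sub>\<epsilon>\<close> is defined for Lipschitz approximations of \<open>g\<close>, and
  periodic solutions are obtained as limits. The condition \<open>\<Phi>\<^sup>s \<noteq> 0\<close> for all \<open>s\<close> keeps \<open>T\<close>-periodic
  solutions away from the cycle itself, so the two solutions lie strictly inside and outside.
\<close>

section \<open>Ordinary differential equations with a Lipschitz right-hand side\<close>

text \<open>The displacement runs backwards because \<Phi> with base time \<open>T\<close> is built
  from the \<eta> that vanishes at time \<open>T\<close>: prescribing the value there gives
  \<open>x 0 - v = \<epsilon> * eta(0) + o(\<epsilon>)\<close>, and \<open>- eta(0)\<close> is that
  \<Phi>. The obstacle that shapes the proof: cycles of other periods may accumulate at the given
  one, so a first return map need not move points to one side. The uniqueness hypothesis says only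
  that the unperturbed displacement has no zeros near the cycle apart from the cycle itself, which
  gives no immediate control of its winding relative to \<open>f\<close>; the alternative between a
  parallel curve and a closed orbit of slightly larger period supplies that control. Windings are
  counted over \<open>T\<close> and not over the least period, since a nearby closed orbit is only
  known to close after a time close to \<open>T\<close>. The region between loop and cycle is taken
  compact, up to and including the cycle, so that zeros of approximate displacements have limits in
  it; that such a limit does not touch the cycle is shown separately.\<close>

lemma gronwall_right:
  fixes e :: "real \<Rightarrow> 'a::banach"
  assumes ab: "a \<le> b"
    and der: "\<And>t. t \<in> {a..b} \<Longrightarrow> (e has_vector_derivative e' t) (at t within {a..b})"
    and bnd: "\<And>t. t \<in> {a..b} \<Longrightarrow> norm (e' t) \<le> L * norm (e t) + k"
    and L: "0 \<le> L" and k: "0 \<le> k"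
  shows "norm (e b) \<le> (norm (e a) + k * (b - a)) * exp (L * (b - a))"
proof -
  have conte: "continuous_on {a..b} e"
    by (rule continuous_on_vector_derivative[OF der])
  obtain N where N: "\<And>t. t \<in> {a..b} \<Longrightarrow> (N has_vector_derivative norm (e t)) (at t within {a..b})"
    using antiderivative_continuous[of a b "\<lambda>t. norm (e t)"] continuous_on_norm[OF conte] by blast
  \<comment> \<open>\<open>norm (e t)\<close> may fail to be differentiable at zeros of
    \<open>e\<close>; the integral majorant \<open>v\<close> is differentiable with derivative
    \<open>k + L * norm (e t)\<close>.\<close>
  define v where "v t = norm (e a) + k * (t - a) + L * (N t - N a)" for t
  have dv: "(v has_vector_derivative k + L * norm (e t)) (at t within {a..b})" if "t \<in> {a..b}" for t
    unfolding v_def by (rule derivative_eq_intros N[OF that] refl | simp)+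
  have ev: "norm (e t) \<le> v t" if t: "t \<in> {a..b}" for t
  proof -
    have "norm (e t - e a) \<le> v t - v a"
    proof (cases "a = t")
      case False
      show ?thesis
      proof (rule differentiable_bound_general)
        show "a < t" using False t by simp
        show "continuous_on {a..t} e" using conte t by (auto intro: continuous_on_subset)
        show "continuous_on {a..t} v"
          using continuous_on_vector_derivative[of "{a..b}" v, OF dv] t by (auto intro: continuous_on_subset)
        fix x assume x: "a < x" "x < t"
        then have i: "x \<in> interior {a..b}" "x \<in> {a..b}" using t by (auto simp: interior_atLeastAtMost_real)
        show "(e has_vector_derivative e' x) (at x)" using der[OF i(2)] at_within_interior[OF i(1)] by simp
        show "(v has_vector_derivative k + L * norm (e x)) (at x)" using dv[OF i(2)] at_within_interior[OF i(1)] by simp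
        show "norm (e' x) \<le> k + L * norm (e x)" using bnd[OF i(2)] by simp
      qed
    qed simp
    moreover have "norm (e t) \<le> norm (e t - e a) + norm (e a)" by norm
    ultimately show ?thesis by (simp add: v_def)
  qed
  \<comment> \<open>Integrating factor for \<open>v\<close>. The term \<open>k * (t - a)\<close>
    stays outside the exponential: the exponential is at most 1, so \<open>w\<close> still
    decreases, and no division by \<open>L\<close> occurs.\<close>
  define w where "w t = v t * exp (- L * (t - a)) - k * (t - a)" for t
  have dw: "(w has_vector_derivative (k + L * norm (e t)) * exp (- L * (t - a)) - L * v t * exp (- L * (t - a)) - k)
       (at t within {a..b})" if "t \<in> {a..b}" for t
    unfolding w_def has_real_derivative_iff_has_vector_derivative[symmetric]
    by (rule derivative_eq_intros dv[OF that, unfolded has_real_derivative_iff_has_vector_derivative[symmetric]] refl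
        | simp add: algebra_simps)+
  have neg: "(k + L * norm (e t)) * exp (- L * (t - a)) - L * v t * exp (- L * (t - a)) - k \<le> 0"
    if t: "t \<in> {a..b}" for t
  proof -
    have "exp (- L * (t - a)) \<le> 1" using L t by (simp add: mult_nonneg_nonneg)
    then have "k * exp (- L * (t - a)) \<le> k" using k by (simp add: mult_left_le)
    moreover have "L * norm (e t) * exp (- L * (t - a)) \<le> L * v t * exp (- L * (t - a))"
      using ev[OF t] L by (intro mult_right_mono mult_left_mono) auto
    ultimately show ?thesis by (simp add: algebra_simps)
  qed
  define D where "D t = (k + L * norm (e t)) * exp (- L * (t - a)) - L * v t * exp (- L * (t - a)) - k" for t
  have "w b \<le> w a"
  proof -
    have "\<exists>x\<in>{a..b}. w b - w a = (b - a) *\<^sub>R D x"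
      by (rule mvt_very_simple[OF ab]) (use dw in \<open>auto simp: has_vector_derivative_def D_def\<close>)
    then obtain x where x: "x \<in> {a..b}" "w b - w a = (b - a) * D x" by auto
    have "(b - a) * D x \<le> 0" using neg[OF x(1)] ab by (intro mult_nonneg_nonpos) (auto simp: D_def)
    then show ?thesis using x(2) by linarith
  qed
  then have "v b * exp (- L * (b - a)) \<le> norm (e a) + k * (b - a)"
    by (simp add: w_def v_def)
  then have "v b * exp (- L * (b - a)) * exp (L * (b - a)) \<le> (norm (e a) + k * (b - a)) * exp (L * (b - a))"
    by (intro mult_right_mono) auto
  moreover have "v b * exp (- L * (b - a)) * exp (L * (b - a)) = v b" by (simp add: mult.assoc flip: exp_add)
  moreover have "norm (e b) \<le> v b" using ev[of b] ab by simp
  ultimately show ?thesis by linarith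
qed

lemma has_vector_derivative_reflect:
  fixes e :: "real \<Rightarrow> 'a::real_normed_vector"
  assumes "\<And>t. t \<in> S \<Longrightarrow> (e has_vector_derivative e' t) (at t within S)" "- t \<in> S"
  shows "((\<lambda>t. e (- t)) has_vector_derivative - e' (- t)) (at t within uminus ` S)"
proof -
  have "((e \<circ> uminus) has_vector_derivative (- 1) *\<^sub>R e' (- t)) (at t within uminus ` S)"
  proof (rule vector_diff_chain_within)
    show "(uminus has_vector_derivative - 1) (at t within uminus ` S)"
      by (auto intro!: derivative_eq_intros)
    show "(e has_vector_derivative e' (- t)) (at (- t) within uminus ` uminus ` S)"
      using assms by (simp add: image_image)
  qed
  then show ?thesis by (simp add: o_def)
qed

text \<open>Time reversal reduces the backward estimate to the forward one. Both directions are
  needed, since values are prescribed at time \<open>T\<close> or at an intermediate time.\<close>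

lemma gronwall:
  fixes e :: "real \<Rightarrow> 'a::banach"
  assumes der: "\<And>t. t \<in> {a..b} \<Longrightarrow> (e has_vector_derivative e' t) (at t within {a..b})"
    and bnd: "\<And>t. t \<in> {a..b} \<Longrightarrow> norm (e' t) \<le> L * norm (e t) + k"
    and L: "0 \<le> L" and k: "0 \<le> k" and st: "s \<in> {a..b}" "t \<in> {a..b}"
  shows "norm (e t) \<le> (norm (e s) + k * \<bar>t - s\<bar>) * exp (L * \<bar>t - s\<bar>)"
proof (cases "s \<le> t")
  case True
  have "norm (e t) \<le> (norm (e s) + k * (t - s)) * exp (L * (t - s))"
    by (rule gronwall_right[where e'=e']) (use True st bnd L k in \<open>auto intro!: has_vector_derivative_within_subset[OF der, where T="{s..t}"]\<close>)
  then show ?thesis using True by simp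
next
  case False
  have sub: "{t..s} \<subseteq> {a..b}" using st by auto
  have "norm (e (- (- t))) \<le> (norm (e (- (- s))) + k * ((- t) - (- s))) * exp (L * ((- t) - (- s)))"
  proof (rule gronwall_right[where e="\<lambda>t. e (- t)" and e'="\<lambda>t. - e' (- t)"])
    fix x assume x: "x \<in> {-s..-t}"
    have "((\<lambda>t. e (- t)) has_vector_derivative - e' (- x)) (at x within uminus ` {a..b})"
      by (rule has_vector_derivative_reflect) (use der x sub in auto)
    then show "((\<lambda>t. e (- t)) has_vector_derivative - e' (- x)) (at x within {-s..-t})"
      by (rule has_vector_derivative_within_subset) (use st in auto)
    show "norm (- e' (- x)) \<le> L * norm (e (- x)) + k" using bnd[of "-x"] x sub by auto
  qed (use False L k in auto)
  then show ?thesis using False by simp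
qed

text \<open>One Picard step in a weighted norm: integrating \<open>L\<close> times the weight
  \<open>exp (2 * L * \<bar>t - s\<bar>)\<close> gains a factor 1/2, whatever the length of the
  interval.\<close>

lemma exp_weight_bound:
  fixes y :: "real \<Rightarrow> 'a::banach"
  assumes der: "\<And>t. t \<in> {a..b} \<Longrightarrow> (y has_vector_derivative y' t) (at t within {a..b})"
    and bnd: "\<And>t. t \<in> {a..b} \<Longrightarrow> norm (y' t) \<le> L * (c * exp (2 * L * \<bar>t - s\<bar>))"
    and L: "0 < L" and c: "0 \<le> c" and st: "s \<in> {a..b}" "t \<in> {a..b}" and y0: "y s = 0"
  shows "norm (y t) \<le> c / 2 * exp (2 * L * \<bar>t - s\<bar>)"
proof -
  have right: "norm (y t) \<le> c / 2 * exp (2 * L * (t - s))"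
    if der: "\<And>r. r \<in> {s..t} \<Longrightarrow> (y has_vector_derivative y' r) (at r within {s..t})"
      and bnd: "\<And>r. r \<in> {s..t} \<Longrightarrow> norm (y' r) \<le> L * (c * exp (2 * L * (r - s)))"
      and y0: "y s = 0" and st: "s < t" for y y' :: "real \<Rightarrow> 'a" and s t
  proof -
    have "norm (y t - y s) \<le> c / 2 * exp (2 * L * (t - s)) - c / 2 * exp (2 * L * (s - s))"
    proof (rule differentiable_bound_general[where \<phi> = "\<lambda>t. c / 2 * exp (2 * L * (t - s))"])
      show "continuous_on {s..t} y" by (rule continuous_on_vector_derivative[OF der])
      fix x assume x: "s < x" "x < t"
      then have i: "x \<in> interior {s..t}" "x \<in> {s..t}" by (auto simp: interior_atLeastAtMost_real)
      show "(y has_vector_derivative y' x) (at x)" using der[OF i(2)] at_within_interior[OF i(1)] by simp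
      show "((\<lambda>t. c / 2 * exp (2 * L * (t - s))) has_vector_derivative L * (c * exp (2 * L * (x - s)))) (at x)"
        unfolding has_real_derivative_iff_has_vector_derivative[symmetric]
        by (rule derivative_eq_intros refl | simp)+
      show "norm (y' x) \<le> L * (c * exp (2 * L * (x - s)))" using bnd i by simp
    qed (use st in \<open>auto intro!: continuous_intros\<close>)
    then show ?thesis using y0 c by simp
  qed
  consider "s = t" | "s < t" | "t < s" by linarith
  then show ?thesis
  proof cases
    case 1 then show ?thesis using y0 c by simp
  next
    case 2
    have sub: "{s..t} \<subseteq> {a..b}" using st by auto
    have "norm (y t) \<le> c / 2 * exp (2 * L * (t - s))"
    proof (rule right[where y'=y'])
      fix r assume r: "r \<in> {s..t}"
      then have r': "r \<in> {a..b}" using sub by blast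
      show "(y has_vector_derivative y' r) (at r within {s..t})"
        by (rule has_vector_derivative_within_subset[OF der[OF r'] sub])
      show "norm (y' r) \<le> L * (c * exp (2 * L * (r - s)))" using bnd[OF r'] r by simp
    qed (use 2 y0 in auto)
    then show ?thesis using 2 by simp
  next
    case 3
    have sub: "{t..s} \<subseteq> {a..b}" using st by auto
    have "norm (y (- (- t))) \<le> c / 2 * exp (2 * L * (- t - (- s)))"
    proof (rule right[where y="\<lambda>t. y (- t)" and y'="\<lambda>t. - y' (- t)"])
      fix x assume x: "x \<in> {-s..-t}"
      have "((\<lambda>t. y (- t)) has_vector_derivative - y' (- x)) (at x within uminus ` {a..b})"
        by (rule has_vector_derivative_reflect) (use der x sub in auto)
      then show "((\<lambda>t. y (- t)) has_vector_derivative - y' (- x)) (at x within {-s..-t})"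
        by (rule has_vector_derivative_within_subset) (use st in auto)
      show "norm (- y' (- x)) \<le> L * (c * exp (2 * L * (x - - s)))"
        using bnd[of "-x"] x sub by (auto simp: add.commute)
    qed (use 3 y0 in auto)
    then show ?thesis using 3 by simp
  qed
qed

text \<open>Weighted differences of iterates halve, so the iterates converge uniformly on all of
  \<open>{a..b}\<close> at once and no short intervals have to be patched. The base point may be the
  right end of the interval.\<close>

lemma picard:
  fixes F :: "real \<Rightarrow> 'a::banach \<Rightarrow> 'a"
  assumes t0: "t0 \<in> {a..b}"
    and contF: "continuous_on ({a..b} \<times> UNIV) (\<lambda>(t, x). F t x)"
    and lip: "\<And>t x y. t \<in> {a..b} \<Longrightarrow> norm (F t x - F t y) \<le> L * norm (x - y)"
    and L: "0 < L"
  obtains x where "x t0 = x0" "\<And>t. t \<in> {a..b} \<Longrightarrow> (x has_vector_derivative F t (x t)) (at t within {a..b})"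
proof -
  define good where "good u w \<longleftrightarrow> w t0 = x0 \<and> (\<forall>t\<in>{a..b}. (w has_vector_derivative F t (u t)) (at t within {a..b}))" for u w
  have ex: "\<exists>w. good u w" if u: "continuous_on {a..b} u" for u
  proof -
    have "continuous_on {a..b} (\<lambda>t. F t (u t))"
      by (rule continuous_on_compose2[OF contF, where f="\<lambda>t. (t, u t)", simplified]) (auto intro!: continuous_intros u)
    then obtain g where g: "\<And>t. t \<in> {a..b} \<Longrightarrow> (g has_vector_derivative F t (u t)) (at t within {a..b})"
      using antiderivative_continuous by blast
    show ?thesis
      by (rule exI[of _ "\<lambda>t. g t + (x0 - g t0)"]) (auto simp: good_def intro!: derivative_eq_intros g)
  qed
  define X where "X n = ((\<lambda>u. SOME w. good u w) ^^ n) (\<lambda>_. x0)" for n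
  have cg: "continuous_on {a..b} w" if "good u w" for u w
    using that unfolding good_def by (intro continuous_on_vector_derivative) auto
  have contX: "continuous_on {a..b} (X n)" for n
    by (induction n) (auto simp: X_def intro: cg someI_ex[OF ex])
  have goodX: "good (X n) (X (Suc n))" for n
    using someI_ex[OF ex[OF contX[of n]]] by (simp add: X_def)
  have X0: "X n t0 = x0" for n
    using goodX by (cases n) (auto simp: X_def good_def)
  have Xd: "(X (Suc n) has_vector_derivative F t (X n t)) (at t within {a..b})" if "t \<in> {a..b}" for n t
    using goodX[of n] that unfolding good_def by blast
  define D where "D n t = X (Suc n) t - X n t" for n t
  have contD: "continuous_on {a..b} (D n)" for n
    unfolding D_def by (intro continuous_intros contX)
  obtain C where C: "\<And>t. t \<in> {a..b} \<Longrightarrow> norm (D 0 t) \<le> C" "0 \<le> C"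
  proof -
    have "bounded (D 0 ` {a..b})"
      by (intro compact_imp_bounded compact_continuous_image contD) auto
    then obtain C where "\<And>t. t \<in> {a..b} \<Longrightarrow> norm (D 0 t) \<le> C" unfolding bounded_iff by blast
    then show ?thesis using that[of "max C 0"] by (meson le_max_iff_disj max.cobounded2)
  qed
  have E: "norm (D n t) \<le> C * (1/2)^n * exp (2 * L * \<bar>t - t0\<bar>)" if "t \<in> {a..b}" for n t
    using that
  proof (induction n arbitrary: t)
    case 0
    have "norm (D 0 t) \<le> C * 1" using C 0 by simp
    also have "\<dots> \<le> C * exp (2 * L * \<bar>t - t0\<bar>)"
      using C L by (intro mult_left_mono) auto
    finally show ?case by simp
  next
    case (Suc n)
    have "norm (D (Suc n) t) \<le> (C * (1/2)^n) / 2 * exp (2 * L * \<bar>t - t0\<bar>)"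
    proof (rule exp_weight_bound[where a=a and b=b and y'="\<lambda>t. F t (X (Suc n) t) - F t (X n t)"])
      fix s assume s: "s \<in> {a..b}"
      show "(D (Suc n) has_vector_derivative F s (X (Suc n) s) - F s (X n s)) (at s within {a..b})"
        unfolding D_def by (intro derivative_intros Xd s)
      have "norm (F s (X (Suc n) s) - F s (X n s)) \<le> L * norm (D n s)"
        using lip[OF s] by (simp add: D_def)
      also have "\<dots> \<le> L * (C * (1/2)^n * exp (2 * L * \<bar>s - t0\<bar>))"
        using Suc.IH[OF s] L by (intro mult_left_mono) auto
      finally show "norm (F s (X (Suc n) s) - F s (X n s)) \<le> L * (C * (1/2)^n * exp (2 * L * \<bar>s - t0\<bar>))" .
    qed (use L C t0 Suc.prems in \<open>auto simp: D_def X0\<close>)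
    then show ?case by simp
  qed
  define x where "x t = x0 + (\<Sum>i. D i t)" for t
  have ul: "uniform_limit {a..b} X x sequentially"
  proof -
    have "uniform_limit {a..b} (\<lambda>n t. \<Sum>i<n. D i t) (\<lambda>t. \<Sum>i. D i t) sequentially"
    proof (rule Weierstrass_m_test)
      fix n t assume t: "t \<in> {a..b}"
      have "norm (D n t) \<le> C * (1/2)^n * exp (2 * L * \<bar>t - t0\<bar>)" by (rule E[OF t])
      also have "\<dots> \<le> C * (1/2)^n * exp (2 * L * (b - a))"
        using C L t t0 by (intro mult_left_mono) auto
      finally show "norm (D n t) \<le> C * exp (2 * L * (b - a)) * (1/2)^n" by (simp add: mult_ac)
    qed (auto intro: summable_mult summable_geometric)
    then have "uniform_limit {a..b} (\<lambda>n t. x0 + (\<Sum>i<n. D i t)) x sequentially"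
      unfolding x_def by (intro uniform_limit_intros)
    moreover have "(\<lambda>n t. x0 + (\<Sum>i<n. D i t)) = X"
    proof (intro ext)
      fix n t
      have "X 0 t = x0" by (simp add: X_def)
      then show "x0 + (\<Sum>i<n. D i t) = X n t"
        unfolding D_def by (simp add: sum_lessThan_telescope[of "\<lambda>i. X i t" n])
    qed
    ultimately show ?thesis by simp
  qed
  \<comment> \<open>The limit is taken in the derivatives instead of an integral equation; the
    Lipschitz bound turns uniform convergence of the iterates into that of their
    derivatives.\<close>
  have "\<exists>g. \<forall>t\<in>{a..b}. (\<lambda>n. X (Suc n) t) \<longlonglongrightarrow> g t \<and> (g has_derivative (\<lambda>h. h *\<^sub>R F t (x t))) (at t within {a..b})"
  proof (rule has_derivative_sequence[where f'="\<lambda>n t h. h *\<^sub>R F t (X n t)" and ?x0.0=t0 and l=x0])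
    fix e :: real assume e: "0 < e"
    have "\<forall>\<^sub>F n in sequentially. \<forall>t\<in>{a..b}. dist (X n t) (x t) < e / L"
      using ul e L unfolding uniform_limit_iff by auto
    then show "\<forall>\<^sub>F n in sequentially. \<forall>t\<in>{a..b}. \<forall>h. norm (h *\<^sub>R F t (X n t) - h *\<^sub>R F t (x t)) \<le> e * norm h"
    proof (rule eventually_mono, intro ballI allI)
      fix n t and h :: real assume n: "\<forall>t\<in>{a..b}. dist (X n t) (x t) < e / L" and t: "t \<in> {a..b}"
      have "norm (F t (X n t) - F t (x t)) \<le> L * norm (X n t - x t)" by (rule lip[OF t])
      also have "\<dots> \<le> L * (e / L)" using n t L by (intro mult_left_mono) (auto simp: dist_norm less_imp_le)
      finally have "norm (F t (X n t) - F t (x t)) \<le> e" using L by simp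
      then show "norm (h *\<^sub>R F t (X n t) - h *\<^sub>R F t (x t)) \<le> e * norm h"
        by (simp add: scaleR_diff_right[symmetric] mult.commute[of e] mult_left_mono)
    qed
  qed (use t0 X0 Xd in \<open>auto simp: has_vector_derivative_def\<close>)
  then obtain g where g: "\<And>t. t \<in> {a..b} \<Longrightarrow> (\<lambda>n. X (Suc n) t) \<longlonglongrightarrow> g t"
     "\<And>t. t \<in> {a..b} \<Longrightarrow> (g has_vector_derivative F t (x t)) (at t within {a..b})"
    unfolding has_vector_derivative_def by blast
  have gx: "g t = x t" if t: "t \<in> {a..b}" for t
  proof -
    have "(\<lambda>n. X n t) \<longlonglongrightarrow> x t" using tendsto_uniform_limitI[OF ul t] .
    then show ?thesis using g(1)[OF t] LIMSEQ_unique LIMSEQ_Suc by blast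
  qed
  show ?thesis
  proof
    have "(\<lambda>n. X (Suc n) t0) \<longlonglongrightarrow> x0" by (simp add: X0)
    then show "g t0 = x0" using g(1)[OF t0] LIMSEQ_unique by blast
    show "(g has_vector_derivative F t (g t)) (at t within {a..b})" if "t \<in> {a..b}" for t
      using g(2)[OF that] gx[OF that] by simp
  qed
qed

section \<open>The flow of a globally Lipschitz autonomous field\<close>

locale lipschitz_field =
  fixes F :: "'a::banach \<Rightarrow> 'a" and L :: real
  assumes lip: "norm (F x - F y) \<le> L * norm (x - y)" and L_pos: "0 < L"
begin

lemma continuous_F: "continuous_on S F"
proof -
  have "L-lipschitz_on S F" using lip L_pos by (auto intro!: lipschitz_onI simp: dist_norm)
  then show ?thesis by (rule lipschitz_on_continuous_on)
qed

lemma solution_dist: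
  assumes "\<And>t. t \<in> {a..b} \<Longrightarrow> (x has_vector_derivative F (x t)) (at t within {a..b})"
    and "\<And>t. t \<in> {a..b} \<Longrightarrow> (y has_vector_derivative F (y t)) (at t within {a..b})"
    and "s \<in> {a..b}" "t \<in> {a..b}"
  shows "norm (x t - y t) \<le> norm (x s - y s) * exp (L * \<bar>t - s\<bar>)"
proof -
  have "norm (x t - y t) \<le> (norm (x s - y s) + 0 * \<bar>t - s\<bar>) * exp (L * \<bar>t - s\<bar>)"
  proof (rule gronwall[where e'="\<lambda>t. F (x t) - F (y t)"])
    show "((\<lambda>t. x t - y t) has_vector_derivative F (x r) - F (y r)) (at r within {a..b})" if "r \<in> {a..b}" for r
      by (intro derivative_intros assms that)
    show "norm (F (x r) - F (y r)) \<le> L * norm (x r - y r) + 0" for r using lip by simp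
  qed (use assms L_pos in simp_all)
  then show ?thesis by simp
qed

text \<open>Solutions on \<open>{- n..n}\<close> agree on overlaps by uniqueness, so they glue to
  one on the whole line.\<close>

lemma global_solution_exists:
  "\<exists>x. x 0 = v \<and> (\<forall>t. (x has_vector_derivative F (x t)) (at t))"
proof -
  have "\<exists>x. x 0 = v \<and> (\<forall>t\<in>{- real n..real n}. (x has_vector_derivative F (x t)) (at t within {- real n..real n}))" for n
  proof -
    have c: "continuous_on ({- real n..real n} \<times> UNIV) (\<lambda>(t, x). F x)"
      by (simp add: split_def) (rule continuous_on_compose2[OF continuous_F[of UNIV] continuous_on_snd[OF continuous_on_id]], simp)
    show ?thesis
      by (rule picard[OF _ c, where L=L and ?t0.0=0 and ?x0.0=v]) (use lip L_pos in auto)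
  qed
  then obtain X where X: "\<And>n. X n 0 = v"
    "\<And>n t. t \<in> {- real n..real n} \<Longrightarrow> (X n has_vector_derivative F (X n t)) (at t within {- real n..real n})"
    by metis
  have agree: "X n t = X m t" if "n \<le> m" "t \<in> {- real n..real n}" for n m t
  proof -
    have "norm (X n t - X m t) \<le> norm (X n 0 - X m 0) * exp (L * \<bar>t - 0\<bar>)"
      by (rule solution_dist[where a="-real n" and b="real n"])
        (use that in \<open>auto intro!: X(2) has_vector_derivative_within_subset[OF X(2)[of _ m]]\<close>)
    then show ?thesis by (simp add: X)
  qed
  \<comment> \<open>The extra 1 puts \<open>t\<close> in the interior of the interval with index
    \<open>N t\<close>, where the derivative within the interval is the full derivative.\<close>
  define N where "N t = nat \<lceil>\<bar>t\<bar>\<rceil> + 1" for t :: real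
  have N: "\<bar>t\<bar> < real (N t)" for t unfolding N_def by linarith
  define x where "x t = X (N t) t" for t
  have xX: "x t = X m t" if "\<bar>t\<bar> < real m" for m t
  proof (cases "N t \<le> m")
    case True then show ?thesis using agree[of "N t" m t] N[of t] by (simp add: x_def abs_less_iff)
  next
    case False then show ?thesis using agree[of m "N t" t] that by (simp add: x_def abs_less_iff)
  qed
  have "(x has_vector_derivative F (x t)) (at t)" for t
  proof -
    let ?m = "N t"
    have i: "t \<in> interior {- real ?m..real ?m}" using N[of t] by (simp add: interior_atLeastAtMost_real abs_less_iff)
    have "(X ?m has_vector_derivative F (X ?m t)) (at t within {- real ?m..real ?m})"
      using i interior_subset by (intro X) blast
    then have "(X ?m has_vector_derivative F (X ?m t)) (at t)" using at_within_interior[OF i] by simp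
    then have "(x has_vector_derivative F (X ?m t)) (at t)"
    proof (rule has_vector_derivative_transform_within_open[where S="{- real ?m<..<real ?m}"])
      show "X ?m r = x r" if "r \<in> {- real ?m<..<real ?m}" for r
        using xX[of r ?m] that by (simp add: abs_less_iff)
    qed (use N[of t] in \<open>auto simp: abs_less_iff\<close>)
    then show ?thesis by (simp add: x_def)
  qed
  then show ?thesis using X xX[of 0 1] by auto
qed

definition flow :: "real \<Rightarrow> 'a \<Rightarrow> 'a" where
  "flow t v = (SOME x. x 0 = v \<and> (\<forall>t. (x has_vector_derivative F (x t)) (at t))) t"

lemma flow_0 [simp]: "flow 0 v = v"
  and flow_deriv: "((\<lambda>t. flow t v) has_vector_derivative F (flow t v)) (at t within S)"
  using someI_ex[OF global_solution_exists[of v]]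
  unfolding flow_def by (auto intro: has_vector_derivative_at_within)

lemma flow_shift_deriv: "((\<lambda>t. flow (t - c) v) has_vector_derivative F (flow (t - c) v)) (at t within S)"
proof -
  have "(((\<lambda>t. flow t v) \<circ> (\<lambda>t. t - c)) has_vector_derivative 1 *\<^sub>R F (flow (t - c) v)) (at t within S)"
    by (rule vector_diff_chain_within) (auto intro!: derivative_eq_intros flow_deriv)
  then show ?thesis by (simp add: o_def)
qed

lemma solution_eq_flow:
  assumes "\<And>t. t \<in> {a..b} \<Longrightarrow> (x has_vector_derivative F (x t)) (at t within {a..b})"
    and "s \<in> {a..b}" "t \<in> {a..b}"
  shows "x t = flow (t - s) (x s)"
proof -
  have "norm (x t - flow (t - s) (x s)) \<le> norm (x s - flow (s - s) (x s)) * exp (L * \<bar>t - s\<bar>)"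
    by (rule solution_dist[where y="\<lambda>t. flow (t - s) (x s)"]) (use assms flow_shift_deriv in auto)
  then show ?thesis by simp
qed

lemma global_solution_eq_flow:
  assumes "\<And>t. (x has_vector_derivative F (x t)) (at t)"
  shows "x t = flow (t - s) (x s)"
  by (rule solution_eq_flow[where a="min s t" and b="max s t"])
    (simp_all add: assms has_vector_derivative_at_within)

lemma flow_add: "flow (t + s) v = flow t (flow s v)"
  using global_solution_eq_flow[of "\<lambda>t. flow t v" "t + s" s] flow_deriv by simp

lemma flow_dist: "norm (flow t v - flow t w) \<le> norm (v - w) * exp (L * \<bar>t\<bar>)"
proof -
  have "norm (flow t v - flow t w) \<le> norm (flow 0 v - flow 0 w) * exp (L * \<bar>t - 0\<bar>)"
    by (rule solution_dist[where a="min 0 t" and b="max 0 t"]) (auto intro: flow_deriv)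
  then show ?thesis by simp
qed

text \<open>Lipschitz dependence on \<open>v\<close>, with a constant locally bounded in
  \<open>t\<close>, is combined with continuity in \<open>t\<close> for the single point
  \<open>v0\<close>.\<close>

lemma isCont_flow: "isCont (\<lambda>(t, v). flow t v) z"
proof -
  obtain t0 v0 where z: "z = (t0, v0)" by (cases z)
  have ct: "isCont (\<lambda>t. flow t v0) t0"
    using flow_deriv[of v0 t0 UNIV] has_vector_derivative_continuous by blast
  have fs: "(fst \<longlongrightarrow> t0) (at (t0, v0))" and sn: "(snd \<longlongrightarrow> v0) (at (t0, v0))"
    using tendsto_fst[OF tendsto_ident_at[of "(t0, v0)" UNIV]] tendsto_snd[OF tendsto_ident_at[of "(t0, v0)" UNIV]] by simp_all
  have "((\<lambda>p. norm (snd p - v0) * exp (L * \<bar>fst p\<bar>) + norm (flow (fst p) v0 - flow t0 v0)) \<longlongrightarrow>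
      norm (v0 - v0) * exp (L * \<bar>t0\<bar>) + norm (flow t0 v0 - flow t0 v0)) (at (t0, v0))"
    by (intro tendsto_intros isCont_tendsto_compose[OF ct] fs sn)
  then have lim: "((\<lambda>p. norm (snd p - v0) * exp (L * \<bar>fst p\<bar>) + norm (flow (fst p) v0 - flow t0 v0)) \<longlongrightarrow> 0) (at (t0, v0))"
    by simp
  have "((\<lambda>p. (\<lambda>(t, v). flow t v) p - flow t0 v0) \<longlongrightarrow> 0) (at (t0, v0))"
  proof (rule Lim_null_comparison[OF _ lim], rule always_eventually, rule allI)
    fix p :: "real \<times> 'a"
    have "norm (flow (fst p) (snd p) - flow t0 v0)
       \<le> norm (flow (fst p) (snd p) - flow (fst p) v0) + norm (flow (fst p) v0 - flow t0 v0)" by norm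
    then show "norm ((\<lambda>(t, v). flow t v) p - flow t0 v0)
       \<le> norm (snd p - v0) * exp (L * \<bar>fst p\<bar>) + norm (flow (fst p) v0 - flow t0 v0)"
      using flow_dist[of "fst p" "snd p" v0] by (simp add: split_def)
  qed
  then show ?thesis unfolding z isCont_def by (simp add: LIM_zero_iff)
qed

lemma continuous_on_flow [continuous_intros]:
  assumes "continuous_on S a" "continuous_on S b"
  shows "continuous_on S (\<lambda>x. flow (a x) (b x))"
proof -
  have "continuous_on UNIV (\<lambda>(t, v). flow t v)"
    using isCont_flow by (simp add: continuous_on_eq_continuous_within)
  from continuous_on_compose2[OF this continuous_on_Pair[OF assms]] show ?thesis by simp
qed

end

section \<open>Winding numbers of periodic functions\<close>

lemma shift_into_period:
  assumes "0 < (p::real)"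
  obtains k :: int where "t + of_int k * p \<in> {0..<p}"
proof
  define k where "k = \<lfloor>t / p\<rfloor>"
  have "of_int k \<le> t / p" "t / p < of_int k + 1" unfolding k_def by linarith+
  then show "t + of_int (- k) * p \<in> {0..<p}" using assms by (auto simp: field_simps)
qed

lemma periodic_shift_int:
  fixes q :: "real \<Rightarrow> 'a"
  assumes per: "\<And>t. q (t + p) = q t"
  shows "q (t + of_int k * p) = q t"
proof -
  have nat: "q (t + real n * p) = q t" for n t
  proof (induction n)
    case (Suc n)
    then show ?case using per[of "t + real n * p"] by (simp add: algebra_simps)
  qed simp
  show ?thesis
  proof (cases "0 \<le> k")
    case True then show ?thesis using nat[of t "nat k"] by simp
  next
    case False then show ?thesis using nat[of "t + of_int k * p" "nat (- k)"] by simp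
  qed
qed

text \<open>Winding numbers about 0 are read off a continuous logarithm on the whole real line. As a relation, this is
  empty for functions that have a zero or are not \<open>p\<close>-periodic.\<close>

definition loop_winding :: "real \<Rightarrow> (real \<Rightarrow> complex) \<Rightarrow> int \<Rightarrow> bool" where
  "loop_winding p q n \<longleftrightarrow> (\<exists>l. continuous_on UNIV l \<and> (\<forall>t. q t = exp (l t)) \<and>
     (\<forall>t. l (t + p) = l t + 2 * of_int n * of_real pi * \<i>))"

lemma loop_windingI:
  assumes "continuous_on UNIV l" "\<And>t. q t = exp (l t)"
    "\<And>t. l (t + p) = l t + 2 * of_int n * of_real pi * \<i>"
  shows "loop_winding p q n"
  using assms unfolding loop_winding_def by blast

text \<open>The values of \<open>h\<close> lie in a lattice whose points are at least
  \<open>2 * pi\<close> apart, so a continuous \<open>h\<close> cannot jump on a connected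
  set.\<close>

lemma exp_diff_constant:
  fixes h :: "'a::topological_space \<Rightarrow> complex"
  assumes "connected S" "continuous_on S h" "\<And>x. x \<in> S \<Longrightarrow> exp (h x) = 1"
  obtains n :: int where "\<And>x. x \<in> S \<Longrightarrow> h x = 2 * of_int n * of_real pi * \<i>"
proof -
  have ex: "\<exists>n::int. h x = 2 * of_int n * of_real pi * \<i>" if x: "x \<in> S" for x
  proof -
    obtain n :: int where "Re (h x) = 0" "Im (h x) = of_int (2 * n) * pi"
      using assms(3)[OF x] unfolding exp_eq_1 by auto
    then show ?thesis by (intro exI[of _ n]) (simp add: complex_eq_iff)
  qed
  have "h constant_on S"
  proof (rule continuous_discrete_range_constant[OF assms(1,2)])
    fix x assume x: "x \<in> S"
    obtain n :: int where n: "h x = 2 * of_int n * of_real pi * \<i>" using ex[OF x] by blast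
    have "2 * pi \<le> norm (h y - h x)" if y: "y \<in> S" "h y \<noteq> h x" for y
    proof -
      obtain m :: int where m: "h y = 2 * of_int m * of_real pi * \<i>" using ex[OF y(1)] by blast
      have "h y - h x = of_real (2 * pi * of_int (m - n)) * \<i>" by (simp add: n m algebra_simps)
      then have "norm (h y - h x) = 2 * pi * \<bar>of_int (m - n)\<bar>"
        by (simp only: norm_mult norm_of_real norm_ii) (simp add: abs_mult)
      moreover have "m \<noteq> n" using y n m by auto
      then have "(1::real) \<le> \<bar>of_int (m - n)\<bar>" by linarith
      ultimately show ?thesis using pi_gt_zero mult_left_mono[of 1 "\<bar>of_int (m - n)\<bar>" "2 * pi"] by simp
    qed
    then show "\<exists>e>0. \<forall>y. y \<in> S \<and> h y \<noteq> h x \<longrightarrow> e \<le> norm (h y - h x)"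
      by (intro exI[of _ "2 * pi"]) auto
  qed
  then obtain c where c: "\<And>x. x \<in> S \<Longrightarrow> h x = c" unfolding constant_on_def by blast
  show ?thesis
  proof (cases "S = {}")
    case False
    then show ?thesis using ex c that by (metis ex_in_conv)
  qed (use that in auto)
qed

lemma loop_winding_unique:
  assumes "loop_winding p q m" "loop_winding p q n"
  shows "m = n"
proof -
  obtain k where k: "continuous_on UNIV k" "\<And>t. q t = exp (k t)"
    "\<And>t. k (t + p) = k t + 2 * of_int m * of_real pi * \<i>" using assms(1) unfolding loop_winding_def by blast
  obtain l where l: "continuous_on UNIV l" "\<And>t. q t = exp (l t)"
    "\<And>t. l (t + p) = l t + 2 * of_int n * of_real pi * \<i>" using assms(2) unfolding loop_winding_def by blast
  obtain i :: int where i: "\<And>t. k t - l t = 2 * of_int i * of_real pi * \<i>"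
    by (rule exp_diff_constant[of UNIV "\<lambda>t. k t - l t"])
      (use k l in \<open>auto intro!: continuous_intros simp: exp_diff\<close>)
  have "k (0 + p) - l (0 + p) = k 0 - l 0" using i by simp
  then have "of_int m * of_real pi = (of_int n * of_real pi :: complex)" using k(3)[of 0] l(3)[of 0] by (simp add: algebra_simps)
  then show ?thesis by simp
qed

text \<open>The strip is contractible, so \<open>K\<close> has a logarithm on all of it; its
  increment over one period is a lattice value, constant on the connected strip, and the same
  \<open>n\<close> serves every \<open>s\<close>.\<close>

lemma loop_winding_homotopy_exists:
  assumes "continuous_on ({0..1} \<times> UNIV) K" "\<And>s t. s \<in> {0..1} \<Longrightarrow> K (s, t) \<noteq> 0"
    and "\<And>s t. s \<in> {0..1} \<Longrightarrow> K (s, t + p) = K (s, t)"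
  shows "\<exists>n. \<forall>s\<in>{0..1::real}. loop_winding p (\<lambda>t. K (s, t)) n"
proof -
  have "contractible ({0..1::real} \<times> (UNIV :: real set))"
    by (intro convex_imp_contractible convex_Times) auto
  then obtain l where l: "continuous_on ({0..1} \<times> UNIV) l" "\<And>z. z \<in> {0..1} \<times> UNIV \<Longrightarrow> K z = exp (l z)"
    using continuous_logarithm_on_contractible[OF assms(1)] assms(2) by (metis mem_Sigma_iff prod.collapse)
  define h where "h z = l (fst z, snd z + p) - l z" for z
  obtain n :: int where n: "\<And>z. z \<in> {0..1} \<times> UNIV \<Longrightarrow> h z = 2 * of_int n * of_real pi * \<i>"
  proof (rule exp_diff_constant[of "{0..1} \<times> UNIV" h])
    show "connected ({0..1::real} \<times> (UNIV :: real set))" by (intro connected_Times) auto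
    show "continuous_on ({0..1} \<times> UNIV) h" unfolding h_def
      by (intro continuous_intros l(1) continuous_on_compose2[OF l(1)]) auto
    show "exp (h z) = 1" if "z \<in> {0..1} \<times> UNIV" for z
      using assms(2,3)[of "fst z" "snd z"] l(2)[OF that] l(2)[of "(fst z, snd z + p)"] that
      by (auto simp: h_def exp_diff mem_Times_iff)
  qed blast
  show ?thesis
  proof (intro exI[of _ n] ballI)
    fix s :: real assume s: "s \<in> {0..1}"
    show "loop_winding p (\<lambda>t. K (s, t)) n"
    proof (rule loop_windingI[of "\<lambda>t. l (s, t)"])
      show "continuous_on UNIV (\<lambda>t. l (s, t))"
        by (rule continuous_on_compose2[OF l(1)]) (use s in \<open>auto intro!: continuous_intros\<close>)
      show "l (s, t + p) = l (s, t) + 2 * of_int n * of_real pi * \<i>" for t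
        using n[of "(s, t)"] s by (simp add: h_def algebra_simps)
    qed (use l(2) s in auto)
  qed
qed

lemma loop_winding_homotopy:
  assumes "continuous_on ({0..1} \<times> UNIV) K" "\<And>s t. s \<in> {0..1} \<Longrightarrow> K (s, t) \<noteq> 0"
    and "\<And>s t. s \<in> {0..1} \<Longrightarrow> K (s, t + p) = K (s, t)"
  shows "loop_winding p (\<lambda>t. K (0, t)) n \<longleftrightarrow> loop_winding p (\<lambda>t. K (1::real, t)) n"
  using loop_winding_homotopy_exists[OF assms] loop_winding_unique
  by (metis atLeastAtMost_iff order_refl zero_le_one)

lemma loop_winding_exists:
  assumes "continuous_on UNIV q" "\<And>t. q t \<noteq> 0" "\<And>t. q (t + p) = q t"
  shows "\<exists>n. loop_winding p q n"
proof -
  have "\<exists>n. \<forall>s\<in>{0..1::real}. loop_winding p (\<lambda>t. (\<lambda>z. q (snd z)) (s, t)) n"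
    by (rule loop_winding_homotopy_exists) (use assms in \<open>auto intro!: continuous_intros continuous_on_compose2[OF assms(1)]\<close>)
  then show ?thesis by force
qed

lemma loop_winding_mult:
  assumes "loop_winding p q m" "loop_winding p r n"
  shows "loop_winding p (\<lambda>t. q t * r t) (m + n)"
proof -
  obtain k where k: "continuous_on UNIV k" "\<And>t. q t = exp (k t)"
    "\<And>t. k (t + p) = k t + 2 * of_int m * of_real pi * \<i>" using assms(1) unfolding loop_winding_def by blast
  obtain l where l: "continuous_on UNIV l" "\<And>t. r t = exp (l t)"
    "\<And>t. l (t + p) = l t + 2 * of_int n * of_real pi * \<i>" using assms(2) unfolding loop_winding_def by blast
  show ?thesis
    by (rule loop_windingI[of "\<lambda>t. k t + l t"])
      (use k l in \<open>auto intro!: continuous_intros simp: exp_add algebra_simps\<close>)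
qed

lemma loop_winding_inverse:
  assumes "loop_winding p q m"
  shows "loop_winding p (\<lambda>t. inverse (q t)) (- m)"
proof -
  obtain k where k: "continuous_on UNIV k" "\<And>t. q t = exp (k t)"
    "\<And>t. k (t + p) = k t + 2 * of_int m * of_real pi * \<i>" using assms(1) unfolding loop_winding_def by blast
  show ?thesis
    by (rule loop_windingI[of "\<lambda>t. - k t"])
      (use k in \<open>auto intro!: continuous_intros simp: exp_minus algebra_simps\<close>)
qed

lemma loop_winding_cnj:
  assumes "loop_winding p q m"
  shows "loop_winding p (\<lambda>t. cnj (q t)) (- m)"
proof -
  obtain k where k: "continuous_on UNIV k" "\<And>t. q t = exp (k t)"
    "\<And>t. k (t + p) = k t + 2 * of_int m * of_real pi * \<i>" using assms(1) unfolding loop_winding_def by blast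
  show ?thesis
    by (rule loop_windingI[of "\<lambda>t. cnj (k t)"])
      (use k in \<open>auto intro!: continuous_intros simp: exp_cnj algebra_simps\<close>)
qed

lemma loop_winding_iterate:
  assumes "loop_winding p q m"
  shows "loop_winding (real k * p) q (int k * m)"
proof -
  obtain l where l: "continuous_on UNIV l" "\<And>t. q t = exp (l t)"
    "\<And>t. l (t + p) = l t + 2 * of_int m * of_real pi * \<i>" using assms(1) unfolding loop_winding_def by blast
  have "l (t + real k * p) = l t + 2 * of_int (int k * m) * of_real pi * \<i>" for t
  proof (induction k)
    case (Suc k)
    have "l (t + real (Suc k) * p) = l ((t + real k * p) + p)" by (simp add: algebra_simps)
    then show ?case using Suc l(3)[of "t + real k * p"] by (simp add: algebra_simps)
  qed simp
  then show ?thesis using l by (intro loop_windingI[of l]) auto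
qed

lemma loop_winding_log:
  assumes "continuous_on S l" "range q \<subseteq> S" "continuous_on UNIV q" "\<And>t. q (t + p) = q t"
  shows "loop_winding p (\<lambda>t. exp (l (q t))) 0"
  by (rule loop_windingI[of "\<lambda>t. l (q t)"]) (use assms in \<open>auto intro!: continuous_on_compose2[OF assms(1)]\<close>)

lemma loop_winding_Re_pos:
  assumes "continuous_on UNIV q" "\<And>t. Re (q t) > 0" "\<And>t. q (t + p) = q t"
  shows "loop_winding p q 0"
proof -
  have nz: "q t \<notin> \<real>\<^sub>\<le>\<^sub>0" for t using assms(2)[of t] by (auto simp: complex_nonpos_Reals_iff)
  have "loop_winding p (\<lambda>t. exp (Ln (q t))) 0"
    by (rule loop_winding_log[where S="- \<real>\<^sub>\<le>\<^sub>0"]) (use assms nz in \<open>auto intro!: continuous_on_Ln continuous_intros\<close>)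
  moreover have "exp (Ln (q t)) = q t" for t using nz[of t] by (intro exp_Ln) auto
  ultimately show ?thesis by simp
qed

lemma loop_winding_const:
  assumes "c \<noteq> 0" shows "loop_winding p (\<lambda>_. c) 0"
  by (rule loop_windingI[of "\<lambda>_. Ln c"]) (use assms in auto)

lemma loop_winding_Re_neg:
  assumes "continuous_on UNIV q" "\<And>t. Re (q t) < 0" "\<And>t. q (t + p) = q t"
  shows "loop_winding p q 0"
proof -
  have "loop_winding p (\<lambda>t. (- 1) * - q t) (0 + 0)"
    by (intro loop_winding_mult loop_winding_const loop_winding_Re_pos) (use assms in \<open>auto intro!: continuous_intros\<close>)
  then show ?thesis by simp
qed

text \<open>Rouche: the quotient \<open>q / r\<close> stays within distance 1 of 1, hence in the
  right half-plane, where it cannot wind.\<close>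

lemma loop_winding_close:
  assumes r: "loop_winding p r n" and q: "continuous_on UNIV q" "\<And>t. q (t + p) = q t"
    and r': "continuous_on UNIV r" "\<And>t. r (t + p) = r t"
    and close: "\<And>t. norm (q t - r t) < norm (r t)"
  shows "loop_winding p q n"
proof -
  have nz: "r t \<noteq> 0" for t using close[of t] by auto
  have "loop_winding p (\<lambda>t. r t * (q t / r t)) (n + 0)"
  proof (intro loop_winding_mult r loop_winding_Re_pos)
    fix t
    have "norm (q t / r t - 1) < 1"
      using close[of t] nz[of t] by (simp add: diff_divide_distrib[symmetric] norm_divide field_simps)
    moreover have "\<bar>Re (q t / r t - 1)\<bar> \<le> norm (q t / r t - 1)" by (rule abs_Re_le_cmod)
    ultimately show "0 < Re (q t / r t)" by auto
  qed (use assms nz in \<open>auto intro!: continuous_intros\<close>)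
  then show ?thesis using nz by simp
qed

section \<open>Counting zeros inside a Jordan curve\<close>

locale jordan_loop =
  fixes \<gamma> :: "real \<Rightarrow> complex" and p :: real
  assumes p_pos: "0 < p" and cont_\<gamma>: "continuous_on UNIV \<gamma>" and per_\<gamma>: "\<And>t. \<gamma> (t + p) = \<gamma> t"
    and inj_\<gamma>: "inj_on \<gamma> {0..<p}"
begin

lemma per_int: "\<gamma> (t + of_int k * p) = \<gamma> t"
  by (rule periodic_shift_int) (rule per_\<gamma>)

lemma reduce_time: obtains s where "s \<in> {0..<p}" "\<gamma> s = \<gamma> t"
  using shift_into_period[OF p_pos, of t] per_int by metis

definition unit_loop :: "real \<Rightarrow> complex" where "unit_loop t = \<gamma> (p * t)"

lemma path_image_unit_loop: "path_image unit_loop = range \<gamma>"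
proof
  show "range \<gamma> \<subseteq> path_image unit_loop"
  proof
    fix z assume "z \<in> range \<gamma>"
    then obtain t where "z = \<gamma> t" by blast
    then obtain s where s: "s \<in> {0..<p}" "\<gamma> s = z" using reduce_time by metis
    have "unit_loop (s / p) = z" "s / p \<in> {0..1}" using s p_pos by (auto simp: unit_loop_def)
    then show "z \<in> path_image unit_loop" unfolding path_image_def by blast
  qed
qed (auto simp: path_image_def unit_loop_def)

lemma loop_unit_loop: "pathfinish unit_loop = pathstart unit_loop"
  using per_\<gamma>[of 0] by (simp add: pathfinish_def pathstart_def unit_loop_def)

lemma simple_unit_loop: "simple_path unit_loop"
proof -
  have "path unit_loop" unfolding path_def unit_loop_def
    by (intro continuous_on_compose2[OF cont_\<gamma>] continuous_intros) auto
  moreover have "loop_free unit_loop" unfolding loop_free_def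
  proof (intro ballI impI)
    fix x y :: real assume xy: "x \<in> {0..1}" "y \<in> {0..1}" "unit_loop x = unit_loop y"
    \<comment> \<open>Moves the end point 1 to 0, so that injectivity on the half-open period
      applies to all parameters.\<close>
    define r where "r x = (if x = 1 then 0 else x)" for x :: real
    have "p * r x \<in> {0..<p}" "\<gamma> (p * r x) = unit_loop x" if "x \<in> {0..1}" for x
      using that p_pos per_\<gamma>[of 0] by (auto simp: r_def unit_loop_def)
    then have "p * r x = p * r y" using xy inj_onD[OF inj_\<gamma>] by metis
    then have "r x = r y" using p_pos by simp
    then show "x = y \<or> x = 0 \<and> y = 1 \<or> x = 1 \<and> y = 0" by (auto simp: r_def split: if_splits)
  qed
  ultimately show ?thesis by (simp add: simple_path_def)
qed

abbreviation "ins \<equiv> inside (range \<gamma>)"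
abbreviation "out \<equiv> outside (range \<gamma>)"

lemmas jordan = Jordan_inside_outside[OF simple_unit_loop loop_unit_loop, unfolded path_image_unit_loop]

lemma closure_ins: "closure ins = ins \<union> range \<gamma>"
  using jordan by (simp add: closure_Un_frontier)

lemma compl_closure_ins: "- closure ins = out"
  by (simp add: closure_ins outside_inside Un_commute)

lemma compact_closure_ins: "compact (closure ins)"
  using jordan by (simp add: compact_closure)

text \<open>A compact plane set with connected complement is Borsukian, and the complement of the
  closed interior is the outer component.\<close>

lemma log_on_closure_ins:
  fixes h :: "complex \<Rightarrow> complex"
  assumes "continuous_on (closure ins) h" "\<And>z. z \<in> closure ins \<Longrightarrow> h z \<noteq> 0"
  obtains l where "continuous_on (closure ins) l" "\<And>z. z \<in> closure ins \<Longrightarrow> h z = exp (l z)"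
proof -
  have "Borsukian (closure ins)"
    using Borsukian_separation_compact[OF compact_closure_ins] jordan compl_closure_ins by simp
  from this[unfolded Borsukian_continuous_logarithm, rule_format, of h] assms
  have "\<exists>l. continuous_on (closure ins) l \<and> (\<forall>z\<in>closure ins. h z = exp (l z))" by auto
  then show ?thesis using that by auto
qed

lemma winding_zero_of_nonvanishing:
  assumes "continuous_on (closure ins) h" "\<And>z. z \<in> closure ins \<Longrightarrow> h z \<noteq> 0"
    and "continuous_on UNIV q" "\<And>t. q (t + p) = q t" "range q \<subseteq> closure ins"
  shows "loop_winding p (\<lambda>t. h (q t)) 0"
proof -
  obtain l where l: "continuous_on (closure ins) l" "\<And>z. z \<in> closure ins \<Longrightarrow> h z = exp (l z)"
    using log_on_closure_ins assms(1,2) by blast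
  have "loop_winding p (\<lambda>t. exp (l (q t))) 0"
    by (rule loop_winding_log[OF l(1)]) (use assms in auto)
  moreover have "(\<lambda>t. exp (l (q t))) = (\<lambda>t. h (q t))" using l(2) assms(5) by (intro ext) (metis rangeI subsetD)
  ultimately show ?thesis by simp
qed

text \<open>The winding number of the path on \<open>{0..1}\<close> is matched with the logarithm on
  the line by comparing two logarithms along one period. The orientation is left open: it is enough
  that the number is nonzero and the same for all inner points.\<close>

lemma winding_inside:
  "\<exists>w. w \<noteq> 0 \<and> (\<forall>a\<in>ins. loop_winding p (\<lambda>t. \<gamma> t - a) w)"
proof -
  have "\<exists>w::int. w \<noteq> 0 \<and> (\<forall>a\<in>ins. winding_number unit_loop a = of_int w)"
  proof (rule simple_closed_path_winding_number_inside[OF simple_unit_loop, unfolded path_image_unit_loop])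
    assume "\<And>z. z \<in> ins \<Longrightarrow> winding_number unit_loop z = 1"
    then show ?thesis by (intro exI[of _ 1]) simp
  next
    assume "\<And>z. z \<in> ins \<Longrightarrow> winding_number unit_loop z = -1"
    then show ?thesis by (intro exI[of _ "-1"]) simp
  qed
  then obtain w :: int where w: "w \<noteq> 0" "\<And>a. a \<in> ins \<Longrightarrow> winding_number unit_loop a = of_int w" by blast
  have "loop_winding p (\<lambda>t. \<gamma> t - a) w" if a: "a \<in> ins" for a
  proof -
    have nr: "a \<notin> range \<gamma>" using a by (meson disjoint_iff inside_no_overlap)
    have "\<exists>n. loop_winding p (\<lambda>t. \<gamma> t - a) n"
    proof (rule loop_winding_exists)
      show "\<gamma> t - a \<noteq> 0" for t using nr by auto
    qed (use per_\<gamma> cont_\<gamma> in \<open>auto intro!: continuous_intros\<close>)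
    then obtain n where n: "loop_winding p (\<lambda>t. \<gamma> t - a) n" by blast
    obtain l where l: "continuous_on UNIV l" "\<And>t. \<gamma> t - a = exp (l t)"
      "\<And>t. l (t + p) = l t + 2 * of_int n * of_real pi * \<i>" using n unfolding loop_winding_def by blast
    obtain q where q: "path q" "pathfinish q - pathstart q = 2 * of_real pi * \<i> * winding_number unit_loop a"
       "\<And>t. t \<in> {0..1} \<Longrightarrow> unit_loop t = a + exp (q t)"
      using winding_number_as_continuous_log[of unit_loop a] simple_unit_loop nr path_image_unit_loop
      by (metis simple_path_imp_path)
    have el: "exp (l (p * t)) = exp (q t)" if "t \<in> {0..1}" for t
      using q(3)[OF that] l(2)[of "p * t"] by (simp add: unit_loop_def)
    obtain i :: int where i: "\<And>t. t \<in> {0..1} \<Longrightarrow> l (p * t) - q t = 2 * of_int i * of_real pi * \<i>"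
    proof (rule exp_diff_constant[of "{0..1::real}" "\<lambda>t. l (p * t) - q t"])
      show "continuous_on {0..1} (\<lambda>t. l (p * t) - q t)"
        using q(1) unfolding path_def by (auto intro!: continuous_intros continuous_on_compose2[OF l(1)])
    qed (use el in \<open>auto simp: exp_diff\<close>)
    have "l p - q 1 = l 0 - q 0" using i[of 0] i[of 1] by simp
    then have "2 * of_int n * of_real pi * \<i> = 2 * of_real pi * \<i> * (of_int w :: complex)"
      using q(2) w(2)[OF a] l(3)[of 0] by (simp add: pathfinish_def pathstart_def algebra_simps)
    then have "n = w" by simp
    then show ?thesis using n by simp
  qed
  then show ?thesis using w by blast
qed

definition w where "w = (SOME w. w \<noteq> 0 \<and> (\<forall>a\<in>ins. loop_winding p (\<lambda>t. \<gamma> t - a) w))"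

lemma w_nonzero: "w \<noteq> 0" and winding_in: "\<And>a. a \<in> ins \<Longrightarrow> loop_winding p (\<lambda>t. \<gamma> t - a) w"
  using someI_ex[OF winding_inside] unfolding w_def by auto

end

section \<open>Local index of an isolated zero\<close>

definition conj_if :: "int \<Rightarrow> complex \<Rightarrow> complex" where
  "conj_if s z = (if s = 1 then z else cnj z)"

lemma conj_if_eq_0 [simp]: "conj_if s z = 0 \<longleftrightarrow> z = 0"
  by (simp add: conj_if_def)

lemma continuous_on_conj_if [continuous_intros]:
  "continuous_on S h \<Longrightarrow> continuous_on S (\<lambda>x. conj_if s (h x))"
  by (cases "s = 1") (auto simp: conj_if_def intro!: continuous_intros)

text \<open>\<open>conj_if s (z - a)\<close> is the model of a zero of index \<open>s\<close>. The
  logarithm lives on the punctured ball, as it need not extend continuously to \<open>a\<close>.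
  Differentiability is not asked for, so the notion survives the division and gluing by which zeros
  are removed.\<close>

definition simple_zero :: "(complex \<Rightarrow> complex) \<Rightarrow> complex \<Rightarrow> int \<Rightarrow> bool" where
  "simple_zero G a s \<longleftrightarrow> (\<exists>r>0. \<exists>l. continuous_on (cball a r - {a}) l \<and>
     (\<forall>z\<in>cball a r - {a}. G z = conj_if s (z - a) * exp (l z)))"

context jordan_loop
begin

lemma winding_conj_if:
  assumes "a \<in> ins" "s \<in> {1, -1}"
  shows "loop_winding p (\<lambda>t. conj_if s (\<gamma> t - a)) (w * s)"
proof (cases "s = 1")
  case True
  then show ?thesis using winding_in[OF assms(1)] by (simp add: conj_if_def)
next
  case False
  then have "s = -1" using assms(2) by simp
  then show ?thesis using loop_winding_cnj[OF winding_in[OF assms(1)]]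
    by (simp add: conj_if_def del: complex_cnj_diff)
qed

text \<open>Zeros are removed one at a time: divide by \<open>z - a\<close> or its conjugate, and replace the quotient near \<open>a\<close> by
  the exponential of a Tietze extension of its logarithm. Without zeros, a logarithm exists on the whole
  closed interior, because its complement is connected.\<close>

lemma winding_eq_zero_count:
  assumes "finite A" "A \<subseteq> ins" "continuous_on (closure ins) G"
    and "\<And>z. z \<in> closure ins \<Longrightarrow> G z = 0 \<longleftrightarrow> z \<in> A"
    and "\<And>a. a \<in> A \<Longrightarrow> \<sigma> a \<in> {1, -1} \<and> simple_zero G a (\<sigma> a)"
  shows "loop_winding p (\<lambda>t. G (\<gamma> t)) (w * (\<Sum>a\<in>A. \<sigma> a))"
  using assms
proof (induction A arbitrary: G rule: finite_induct)
  case empty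
  have "loop_winding p (\<lambda>t. G (\<gamma> t)) 0"
    by (rule winding_zero_of_nonvanishing) (use empty cont_\<gamma> per_\<gamma> closure_ins in auto)
  then show ?case by simp
next
  case (insert a A)
  have sa: "\<sigma> a \<in> {1, -1}" "simple_zero G a (\<sigma> a)" and aU: "a \<in> ins" using insert.prems by auto
  obtain r0 l where r0: "0 < r0" "continuous_on (cball a r0 - {a}) l"
    "\<And>z. z \<in> cball a r0 - {a} \<Longrightarrow> G z = conj_if (\<sigma> a) (z - a) * exp (l z)"
    using sa(2) unfolding simple_zero_def by blast
  have "open (ins - A)" using jordan insert.hyps(1) by (intro open_Diff finite_imp_closed) auto
  then obtain r1 where r1: "0 < r1" "cball a r1 \<subseteq> ins - A"
    using aU insert.hyps(2) open_contains_cball by (metis Diff_iff)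
  define r where "r = min r0 r1"
  have r: "0 < r" "cball a r \<subseteq> ins - A" "cball a r \<subseteq> cball a r0" using r0 r1 by (auto simp: r_def)
  \<comment> \<open>The annulus stays away from \<open>a\<close>, where \<open>l\<close> may have no
    limit; agreement there covers the circle of radius \<open>r\<close> on which the two formulas
    are glued.\<close>
  let ?S = "cball a r - ball a (r/2)"
  obtain g where g: "continuous_on UNIV g" "\<And>z. z \<in> ?S \<Longrightarrow> g z = l z"
  proof (rule Tietze_unbounded[of ?S l UNIV])
    show "continuous_on ?S l" using r by (intro continuous_on_subset[OF r0(2)]) auto
    show "closedin (top_of_set UNIV) ?S" by (auto intro!: closed_Diff)
  qed blast
  \<comment> \<open>On the ball it is an exponential, hence zero-free; outside, only a nonvanishing
    factor is divided out.\<close>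
  define G1 where "G1 z = (if dist a z \<le> r then exp (g z) else G z / conj_if (\<sigma> a) (z - a))" for z
  have agree: "exp (g z) = G z / conj_if (\<sigma> a) (z - a)" if "r/2 \<le> dist a z" "dist a z \<le> r" for z
  proof -
    have "z \<noteq> a" using that r by auto
    moreover have "z \<in> cball a r0 - {a}" using r(3) that calculation by auto
    ultimately show ?thesis using g(2)[of z] that r0(3)[of z] by auto
  qed
  have "continuous_on ((closure ins \<inter> cball a r) \<union> (closure ins - ball a r)) G1"
    unfolding G1_def
  proof (rule continuous_on_cases)
    show "continuous_on (closure ins - ball a r) (\<lambda>z. G z / conj_if (\<sigma> a) (z - a))"
      using r by (intro continuous_intros continuous_on_subset[OF insert.prems(2)]) auto
    show "continuous_on (closure ins \<inter> cball a r) (\<lambda>z. exp (g z))"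
      by (intro continuous_intros continuous_on_subset[OF g(1)]) auto
  qed (use agree r in \<open>auto intro!: closed_Diff\<close>)
  moreover have "(closure ins \<inter> cball a r) \<union> (closure ins - ball a r) = closure ins" by auto
  ultimately have contG1: "continuous_on (closure ins) G1" by simp
  have zeros: "G1 z = 0 \<longleftrightarrow> z \<in> A" if "z \<in> closure ins" for z
  proof (cases "dist a z \<le> r")
    case True
    then have "z \<notin> A" using r(2) by auto
    then show ?thesis using True by (simp add: G1_def)
  next
    case False
    then have "z \<noteq> a" using r by auto
    then show ?thesis using False insert.prems(3)[OF that] by (auto simp: G1_def)
  qed
  have simple: "\<sigma> b \<in> {1, -1} \<and> simple_zero G1 b (\<sigma> b)" if b: "b \<in> A" for b
  proof -
    have sb: "\<sigma> b \<in> {1, -1}" "simple_zero G b (\<sigma> b)" using insert.prems(4) b by auto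
    obtain r2 k where r2: "0 < r2" "continuous_on (cball b r2 - {b}) k"
      "\<And>z. z \<in> cball b r2 - {b} \<Longrightarrow> G z = conj_if (\<sigma> b) (z - b) * exp (k z)"
      using sb(2) unfolding simple_zero_def by blast
    have "b \<in> - cball a r" using b r by auto
    then obtain r3 where r3: "0 < r3" "cball b r3 \<subseteq> - cball a r"
      using open_contains_cball[of "- cball a r"] by (meson closed_cball open_Compl)
    define r4 where "r4 = min r2 r3"
    have r4: "0 < r4" "cball b r4 \<subseteq> - cball a r" "cball b r4 \<subseteq> cball b r2" using r2 r3 by (auto simp: r4_def)
    have na: "z \<noteq> a" if "z \<in> cball b r4" for z using that r4 r by auto
    \<comment> \<open>Near another zero \<open>b\<close> the factor that was divided out is
      zero-free on a ball, so it merely adds \<open>m\<close> to the logarithm.\<close>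
    obtain m where m: "continuous_on (cball b r4) m" "\<And>z. z \<in> cball b r4 \<Longrightarrow> inverse (conj_if (\<sigma> a) (z - a)) = exp (m z)"
      by (rule continuous_logarithm_on_contractible[of "cball b r4" "\<lambda>z. inverse (conj_if (\<sigma> a) (z - a))"])
        (use na in \<open>auto intro!: continuous_intros convex_imp_contractible\<close>)
    have "simple_zero G1 b (\<sigma> b)" unfolding simple_zero_def
    proof (intro exI[of _ r4] exI[of _ "\<lambda>z. k z + m z"] conjI ballI r4(1))
      show "continuous_on (cball b r4 - {b}) (\<lambda>z. k z + m z)"
        using r4(3) by (intro continuous_intros continuous_on_subset[OF m(1)] continuous_on_subset[OF r2(2)]) auto
      fix z assume z: "z \<in> cball b r4 - {b}"
      have "G1 z = G z * inverse (conj_if (\<sigma> a) (z - a))" using z r4(2) by (auto simp: G1_def divide_inverse)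
      also have "\<dots> = conj_if (\<sigma> b) (z - b) * exp (k z) * exp (m z)" using m(2) r2(3) z r4(3) by auto
      finally show "G1 z = conj_if (\<sigma> b) (z - b) * exp (k z + m z)" by (simp add: exp_add)
    qed
    then show ?thesis using sb by simp
  qed
  have "loop_winding p (\<lambda>t. G1 (\<gamma> t)) (w * (\<Sum>a\<in>A. \<sigma> a))"
    by (rule insert.IH) (use insert.prems contG1 zeros simple in auto)
  then have "loop_winding p (\<lambda>t. conj_if (\<sigma> a) (\<gamma> t - a) * G1 (\<gamma> t)) (w * \<sigma> a + w * (\<Sum>a\<in>A. \<sigma> a))"
    by (intro loop_winding_mult winding_conj_if aU sa)
  moreover have "conj_if (\<sigma> a) (\<gamma> t - a) * G1 (\<gamma> t) = G (\<gamma> t)" for t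
  proof -
    have "\<gamma> t \<notin> ins" by (metis disjoint_iff inside_no_overlap rangeI)
    then have "\<not> dist a (\<gamma> t) \<le> r" "\<gamma> t \<noteq> a" using r(2) aU by auto
    then show ?thesis by (simp add: G1_def)
  qed
  ultimately show ?case using insert.hyps by (simp add: algebra_simps)
qed

end

text \<open>The derivative is split into its complex-linear and conjugate-linear part; the larger
  coefficient \<open>A\<close> decides the index. Relative to \<open>conj_if s (z - a) * A\<close>
  the rest has size below 1 near \<open>a\<close>, so the quotient avoids the cut of
  \<open>Ln\<close>.\<close>

lemma simple_zero_of_derivative:
  assumes der: "(G has_derivative (\<lambda>h. \<alpha> * h + \<beta> * cnj h)) (at a)" and Ga: "G a = 0"
    and S: "open S" "a \<in> S" "continuous_on S G" and ne: "norm \<alpha> \<noteq> norm \<beta>"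
  shows "simple_zero G a (if norm \<beta> < norm \<alpha> then 1 else -1)"
proof -
  define s :: int where "s = (if norm \<beta> < norm \<alpha> then 1 else -1)"
  define A where "A = (if norm \<beta> < norm \<alpha> then \<alpha> else \<beta>)"
  define B where "B = (if norm \<beta> < norm \<alpha> then \<beta> else \<alpha>)"
  have AB: "norm B < norm A" using ne by (auto simp: A_def B_def)
  have lin: "\<alpha> * h + \<beta> * cnj h = A * conj_if s h + B * cnj (conj_if s h)" for h
    by (auto simp: A_def B_def s_def conj_if_def)
  \<comment> \<open>Half of the gap between the coefficients is given to the remainder, since
    \<open>e + norm B = (norm A + norm B) / 2 < norm A\<close>.\<close>
  define e where "e = (norm A - norm B) / 2"
  have e: "0 < e" using AB by (simp add: e_def)
  obtain d where d: "0 < d" "\<And>z. norm (z - a) < d \<Longrightarrow> norm (G z - G a - (\<alpha> * (z - a) + \<beta> * cnj (z - a))) \<le> e * norm (z - a)"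
    using der e unfolding has_derivative_at_alt by blast
  obtain r1 where r1: "0 < r1" "cball a r1 \<subseteq> S" using S open_contains_cball by blast
  define r where "r = min (d/2) r1"
  have r: "0 < r" "cball a r \<subseteq> S" "\<And>z. z \<in> cball a r \<Longrightarrow> norm (z - a) < d"
    using d r1 by (auto simp: r_def dist_norm norm_minus_commute)
  define q where "q z = G z / (conj_if s (z - a) * A)" for z
  have A0: "A \<noteq> 0" using AB by auto
  have q: "q z \<notin> \<real>\<^sub>\<le>\<^sub>0" if z: "z \<in> cball a r - {a}" for z
  proof -
    have nz: "norm (conj_if s (z - a)) = norm (z - a)" "z \<noteq> a"
      using z by (auto simp: conj_if_def simp del: complex_cnj_diff)
    have "norm (G z - conj_if s (z - a) * A) \<le> norm (G z - G a - (\<alpha> * (z - a) + \<beta> * cnj (z - a))) + norm (B * cnj (conj_if s (z - a)))"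
      unfolding lin Ga by (rule order_trans[OF _ norm_triangle_ineq]) (simp add: algebra_simps)
    also have "\<dots> \<le> e * norm (z - a) + norm B * norm (z - a)"
      using d(2)[OF r(3)] z nz by (simp add: norm_mult)
    also have "\<dots> = (norm A + norm B) / 2 * norm (z - a)" by (simp add: e_def field_simps)
    also have "\<dots> < norm A * norm (z - a)" using AB nz by (intro mult_strict_right_mono) auto
    finally have "norm (G z - conj_if s (z - a) * A) < norm (conj_if s (z - a) * A)" using nz by (simp add: norm_mult mult.commute)
    then have "norm (q z - 1) < 1"
      using A0 nz by (simp add: q_def diff_divide_distrib[symmetric] norm_divide field_simps divide_less_eq)
    then have "0 < Re (q z)" using abs_Re_le_cmod[of "q z - 1"] by auto
    then show ?thesis by (auto simp: complex_nonpos_Reals_iff)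
  qed
  have "simple_zero G a s" unfolding simple_zero_def
  proof (intro exI[of _ r] exI[of _ "\<lambda>z. Ln (q z) + Ln A"] conjI ballI r(1))
    have cq: "continuous_on (cball a r - {a}) q" unfolding q_def
      using A0 r(2) by (intro continuous_intros continuous_on_subset[OF S(3)]) auto
    show "continuous_on (cball a r - {a}) (\<lambda>z. Ln (q z) + Ln A)"
      by (rule continuous_on_add[OF continuous_on_Ln'[OF cq] continuous_on_const]) (rule q)
    fix z assume z: "z \<in> cball a r - {a}"
    have "q z \<noteq> 0" using q[OF z] by auto
    then show "G z = conj_if s (z - a) * exp (Ln (q z) + Ln A)"
      using A0 z by (simp add: exp_add q_def)
  qed
  then show ?thesis by (simp add: s_def)
qed

section \<open>The Brouwer degree in the plane\<close>

definition to_complex :: "real^2 \<Rightarrow> complex" where "to_complex v = Complex (v $ 1) (v $ 2)"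
definition of_complex :: "complex \<Rightarrow> real^2" where "of_complex z = vector [Re z, Im z]"

lemma of_to_complex [simp]: "of_complex (to_complex v) = v"
  and to_of_complex [simp]: "to_complex (of_complex z) = z"
  by (auto simp: of_complex_def to_complex_def vec_eq_iff forall_2 complex_eq_iff)

lemma linear_to_complex: "linear to_complex"
  by (rule linearI) (auto simp: to_complex_def complex_eq_iff)

lemma linear_of_complex: "linear of_complex"
  by (rule linearI) (auto simp: of_complex_def vec_eq_iff forall_2)

lemmas bounded_linear_to_complex = linear_conv_bounded_linear[THEN iffD1, OF linear_to_complex]
lemmas bounded_linear_of_complex = linear_conv_bounded_linear[THEN iffD1, OF linear_of_complex]

lemmas continuous_on_to_complex [continuous_intros] = bounded_linear.continuous_on[OF bounded_linear_to_complex]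
lemmas continuous_on_of_complex [continuous_intros] = bounded_linear.continuous_on[OF bounded_linear_of_complex]

lemma norm_to_complex [simp]: "norm (to_complex v) = norm v"
  by (simp add: to_complex_def norm_vec_def L2_set_def sum_2 cmod_def)

lemma norm_of_complex [simp]: "norm (of_complex z) = norm z"
  using norm_to_complex[of "of_complex z"] by simp

lemma to_complex_eq_0 [simp]: "to_complex v = 0 \<longleftrightarrow> v = 0"
  using norm_to_complex[of v] by (metis norm_eq_zero)

lemma of_complex_eq_0 [simp]: "of_complex z = 0 \<longleftrightarrow> z = 0"
  using norm_of_complex[of z] by (metis norm_eq_zero)

lemma to_complex_eq_iff: "to_complex u = to_complex v \<longleftrightarrow> u = v"
  by (metis of_to_complex)

lemma of_complex_eq_iff: "of_complex u = of_complex v \<longleftrightarrow> u = v"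
  by (metis to_of_complex)

lemmas to_complex_linear_simps = linear_add[OF linear_to_complex] linear_diff[OF linear_to_complex]
  linear_neg[OF linear_to_complex] linear_scale[OF linear_to_complex] linear_0[OF linear_to_complex]

lemma inj_of_complex: "inj_on of_complex S" by (metis inj_onI to_of_complex)

lemma bij_of_complex: "bij of_complex"
  by (rule bij_betw_byWitness[where f'=to_complex]) auto

lemma of_complex_image_iff: "v \<in> of_complex ` S \<longleftrightarrow> to_complex v \<in> S"
  by (metis image_iff of_to_complex to_of_complex)

lemma closure_of_complex: "closure (of_complex ` S) = of_complex ` closure S"
  using closure_injective_linear_image[OF linear_of_complex inj_of_complex] by simp

lemma interior_of_complex: "interior (of_complex ` S) = of_complex ` interior S"
  using interior_bijective_linear_image[OF linear_of_complex bij_of_complex] by simp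

lemma frontier_of_complex: "frontier (of_complex ` S) = of_complex ` frontier S"
  unfolding frontier_def closure_of_complex interior_of_complex by (simp add: image_set_diff inj_of_complex)

text \<open>A linear homeomorphism maps components of the complement onto components, and
  \<open>of_complex\<close> preserves norms, hence boundedness. This transports the Jordan curve
  theorem to \<open>real^2\<close>.\<close>

lemma inside_of_complex: "inside (of_complex ` S) = of_complex ` inside S"
proof -
  have hom: "connected_component_set (- of_complex ` S) (of_complex z) = of_complex ` connected_component_set (- S) z" for z
  proof
    have sub: "of_complex ` connected_component_set (- S) z \<subseteq> connected_component_set (- of_complex ` S) (of_complex z)"
      if "z \<notin> S"
      using that connected_component_subset[of "- S" z]
      by (intro connected_component_maximal connected_continuous_image continuous_on_of_complex continuous_on_id)
        (auto simp: of_complex_image_iff of_complex_eq_iff)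
    then show "of_complex ` connected_component_set (- S) z \<subseteq> connected_component_set (- of_complex ` S) (of_complex z)"
      by (cases "z \<in> S") (auto simp: connected_component_eq_empty[THEN iffD2])
    have "to_complex ` connected_component_set (- of_complex ` S) (of_complex z) \<subseteq> connected_component_set (- S) z"
      if "z \<notin> S"
    proof (rule connected_component_maximal)
      show "z \<in> to_complex ` connected_component_set (- of_complex ` S) (of_complex z)"
        by (rule image_eqI[where x="of_complex z"]) (use that in \<open>auto simp: of_complex_image_iff\<close>)
      show "connected (to_complex ` connected_component_set (- of_complex ` S) (of_complex z))"
        by (intro connected_continuous_image continuous_on_to_complex continuous_on_id connected_connected_component)
      show "to_complex ` connected_component_set (- of_complex ` S) (of_complex z) \<subseteq> - S"
        using connected_component_subset[of "- of_complex ` S" "of_complex z"] by (force simp: of_complex_image_iff)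
    qed
    then show "connected_component_set (- of_complex ` S) (of_complex z) \<subseteq> of_complex ` connected_component_set (- S) z"
      by (cases "z \<in> S") (auto simp: of_complex_image_iff connected_component_eq_empty[THEN iffD2])
  qed
  have bnd: "bounded (of_complex ` X) \<longleftrightarrow> bounded X" for X
    by (simp add: bounded_iff)
  show ?thesis
    unfolding inside_def by (auto simp: of_complex_image_iff hom[of "to_complex _", simplified] bnd)
qed

section \<open>Polynomial maps and regular values\<close>

lemma real_polynomial_function_C1:
  fixes q :: "'a::real_normed_vector \<Rightarrow> real"
  assumes "real_polynomial_function q"
  shows "\<exists>q'. continuous_on UNIV q' \<and> (\<forall>x. (q has_derivative blinfun_apply (q' x)) (at x))"
  using assms
proof induction
  case (linear f)
  then show ?case
    by (intro exI[of _ "\<lambda>_. Blinfun f"])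
      (auto simp: bounded_linear_Blinfun_apply bounded_linear_imp_has_derivative)
next
  case (const c)
  show ?case by (intro exI[of _ "\<lambda>_. 0"]) auto
next
  case (add f g)
  then obtain f' g' where "continuous_on UNIV f'" "\<forall>x. (f has_derivative blinfun_apply (f' x)) (at x)"
    "continuous_on UNIV g'" "\<forall>x. (g has_derivative blinfun_apply (g' x)) (at x)" by blast
  then show ?case
    by (intro exI[of _ "\<lambda>x. f' x + g' x"])
      (auto intro!: continuous_intros derivative_eq_intros simp: blinfun.add_left)
next
  case (mult f g)
  then obtain f' g' where *: "continuous_on UNIV f'" "\<And>x. (f has_derivative blinfun_apply (f' x)) (at x)"
    "continuous_on UNIV g'" "\<And>x. (g has_derivative blinfun_apply (g' x)) (at x)" by blast
  have "continuous_on UNIV f" by (rule has_derivative_continuous_on, rule *)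
  moreover have "continuous_on UNIV g" by (rule has_derivative_continuous_on, rule *)
  ultimately have "continuous_on UNIV (\<lambda>x. f x *\<^sub>R g' x + g x *\<^sub>R f' x)" by (intro continuous_intros *)
  moreover have "((\<lambda>x. f x * g x) has_derivative blinfun_apply (f x *\<^sub>R g' x + g x *\<^sub>R f' x)) (at x)" for x
    by (rule has_derivative_eq_rhs[OF has_derivative_mult[OF *(2) *(4)]])
      (simp add: fun_eq_iff blinfun.add_left blinfun.scaleR_left mult.commute)
  ultimately show ?case by blast
qed

text \<open>The derivative is delivered as a continuous map into bounded linear functions, the form
  needed both for \<open>regular_approximation\<close> and for Lipschitz bounds on compact convex
  sets.\<close>

lemma polynomial_function_C1:
  fixes q :: "'a::real_normed_vector \<Rightarrow> 'b::euclidean_space"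
  assumes "polynomial_function q"
  obtains q' where "continuous_on UNIV q'" "\<And>x. (q has_derivative blinfun_apply (q' x)) (at x)"
proof -
  have "\<forall>b\<in>Basis. \<exists>q'. continuous_on UNIV q' \<and> (\<forall>x. ((\<lambda>x. q x \<bullet> b) has_derivative blinfun_apply (q' x)) (at x))"
    using assms real_polynomial_function_C1 unfolding polynomial_function_iff_Basis_inner by blast
  then obtain q' where q': "\<And>b. b \<in> Basis \<Longrightarrow> continuous_on UNIV (q' b)"
    "\<And>b x. b \<in> Basis \<Longrightarrow> ((\<lambda>x. q x \<bullet> b) has_derivative blinfun_apply (q' b x)) (at x)" by metis
  define D where "D x = (\<Sum>b\<in>Basis. blinfun_scaleR_left b o\<^sub>L q' b x)" for x
  show ?thesis
  proof
    show "continuous_on UNIV D" unfolding D_def by (intro continuous_intros q')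
    have "((\<lambda>x. \<Sum>b\<in>Basis. (q x \<bullet> b) *\<^sub>R b) has_derivative (\<lambda>h. \<Sum>b\<in>Basis. blinfun_apply (q' b x) h *\<^sub>R b)) (at x)" for x
      by (intro has_derivative_sum has_derivative_scaleR_left q')
    moreover have "blinfun_apply (D x) = (\<lambda>h. \<Sum>b\<in>Basis. blinfun_apply (q' b x) h *\<^sub>R b)" for x
      by (auto simp: D_def blinfun.sum_left)
    ultimately show "(q has_derivative blinfun_apply (D x)) (at x)" for x by (simp add: euclidean_representation)
  qed
qed

text \<open>With \<open>m\<close> the least norm of \<open>F\<close> on the frontier, Weierstrass
  gives a polynomial map \<open>P\<close> within \<open>m / 2\<close> of \<open>F\<close>, and Sard
  a noncritical value \<open>c\<close> of norm below \<open>m / 2\<close>; then \<open>P - c\<close>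
  is regular and within \<open>m\<close> of \<open>F\<close>.\<close>

lemma regular_approximation_exists:
  fixes F :: "real^2 \<Rightarrow> real^2"
  assumes "bounded U" "continuous_on (closure U) F" "\<And>x. x \<in> frontier U \<Longrightarrow> F x \<noteq> 0" "frontier U \<noteq> {}"
  shows "\<exists>G G'. regular_approximation F U G G'"
proof -
  have cpt: "compact (frontier U)" "compact (closure U)" using assms(1) by (auto simp: compact_frontier_bounded compact_closure)
  have sub: "frontier U \<subseteq> closure U" by (simp add: frontier_def)
  obtain y0 where y0: "y0 \<in> frontier U" "\<And>y. y \<in> frontier U \<Longrightarrow> norm (F y0) \<le> norm (F y)"
    using continuous_attains_inf[OF cpt(1) assms(4) continuous_on_norm[OF continuous_on_subset[OF assms(2) sub]]] by blast
  define m where "m = norm (F y0)"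
  have m: "0 < m" using assms(3)[OF y0(1)] by (simp add: m_def)
  obtain P where P: "polynomial_function P" "\<And>x. x \<in> closure U \<Longrightarrow> norm (F x - P x) < m / 2"
    using Stone_Weierstrass_polynomial_function[OF cpt(2) assms(2), of "m/2"] m by auto
  obtain P' :: "real^2 \<Rightarrow> (real^2) \<Rightarrow>\<^sub>L (real^2)"
    where P': "continuous_on UNIV P'" "\<And>x. (P has_derivative blinfun_apply (P' x)) (at x)"
    using polynomial_function_C1[OF P(1)] by blast
  define C where "C = {x. det (matrix (blinfun_apply (P' x))) = 0}"
  have "negligible (P ` C)"
  proof (rule baby_Sard)
    show "(P has_derivative blinfun_apply (P' x)) (at x within C)" for x using P'(2) by (rule has_derivative_at_withinI)
    show "rank (matrix (blinfun_apply (P' x))) < CARD(2)" if "x \<in> C" for x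
      using that det_eq_0_rank unfolding C_def by blast
  qed simp
  moreover have "\<not> negligible (ball (0::real^2) (m/2))" using m by (intro open_not_negligible) auto
  ultimately have "\<not> ball 0 (m/2) \<subseteq> P ` C" using negligible_subset by blast
  then obtain c where c: "norm c < m / 2" "c \<notin> P ` C" by (auto simp: subset_iff)
  have "regular_approximation F U (\<lambda>x. P x - c) P'" unfolding regular_approximation_def
  proof (intro conjI ballI impI)
    show "continuous_on (closure U) (\<lambda>x. P x - c)"
      by (intro continuous_intros continuous_on_polymonial_function P)
    show "((\<lambda>x. P x - c) has_derivative blinfun_apply (P' x)) (at x)" for x
      using has_derivative_diff[OF P'(2)[of x] has_derivative_const[of c]] by simp
    show "continuous_on U P'" using P'(1) continuous_on_subset by blast
    fix x y assume x: "x \<in> closure U" and y: "y \<in> frontier U"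
    have "norm (P x - c - F x) \<le> norm (F x - P x) + norm c" by norm
    also have "\<dots> < m" using P(2)[OF x] c by simp
    finally show "norm (P x - c - F x) < norm (F y)" using y0(2)[OF y] by (simp add: m_def)
  next
    fix x assume "P x - c = 0"
    then show "det (matrix (blinfun_apply (P' x))) \<noteq> 0" using c(2) unfolding C_def by force
  qed
  then show ?thesis by blast
qed

section \<open>Signed zero counts as winding numbers\<close>

lemma real_jacobian_complex:
  fixes A :: "(real^2) \<Rightarrow>\<^sub>L (real^2)"
  obtains \<alpha> \<beta> where "\<And>h. to_complex (blinfun_apply A (of_complex h)) = \<alpha> * h + \<beta> * cnj h"
    "det (matrix (blinfun_apply A)) = (norm \<alpha>)\<^sup>2 - (norm \<beta>)\<^sup>2"
proof -
  define a c b d where "a = A (axis 1 1) $ 1" and "c = A (axis 1 1) $ 2" and "b = A (axis 2 1) $ 1" and "d = A (axis 2 1) $ 2"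
  \<comment> \<open>The Wirtinger coefficients of the matrix with rows \<open>a b\<close> and
    \<open>c d\<close>.\<close>
  define \<alpha> where "\<alpha> = Complex ((a + d) / 2) ((c - b) / 2)"
  define \<beta> where "\<beta> = Complex ((a - d) / 2) ((c + b) / 2)"
  show ?thesis
  proof
    fix h
    have "of_complex h = Re h *\<^sub>R axis 1 1 + Im h *\<^sub>R axis 2 1"
      by (auto simp: of_complex_def vec_eq_iff forall_2 axis_def)
    then have "A (of_complex h) = Re h *\<^sub>R A (axis 1 1) + Im h *\<^sub>R A (axis 2 1)"
      by (simp add: blinfun.add_right blinfun.scaleR_right)
    then show "to_complex (A (of_complex h)) = \<alpha> * h + \<beta> * cnj h"
      by (simp add: to_complex_def complex_eq_iff a_def b_def c_def d_def \<alpha>_def \<beta>_def field_simps)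
  next
    show "det (matrix (blinfun_apply A)) = (norm \<alpha>)\<^sup>2 - (norm \<beta>)\<^sup>2"
      unfolding cmod_power2
      by (simp add: det_2 matrix_def a_def b_def c_def d_def \<alpha>_def \<beta>_def field_simps power2_eq_square)
  qed
qed

text \<open>An accumulation point of zeros is itself a zero and, by zero-freeness on the frontier,
  lies in \<open>V\<close>. There the injective derivative is bounded below, which contradicts
  differentiability along nearby zeros.\<close>

lemma finite_regular_zeros:
  fixes G :: "'a::euclidean_space \<Rightarrow> 'a"
  assumes "bounded V" "open V" "continuous_on (closure V) G" "\<And>x. x \<in> frontier V \<Longrightarrow> G x \<noteq> 0"
    and der: "\<And>x. x \<in> V \<Longrightarrow> (G has_derivative blinfun_apply (G' x)) (at x)"
    and inj: "\<And>x. x \<in> V \<Longrightarrow> G x = 0 \<Longrightarrow> inj (blinfun_apply (G' x))"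
  shows "finite {x\<in>V. G x = 0}"
proof (rule ccontr)
  assume inf: "infinite {x\<in>V. G x = 0}"
  have "compact (closure V)" using assms(1) by (simp add: compact_closure)
  then obtain x where x: "x \<in> closure V" "x islimpt {x\<in>V. G x = 0}"
    using inf closure_subset[of V] unfolding compact_eq_Bolzano_Weierstrass
    by (metis (no_types, lifting) mem_Collect_eq subset_iff compact_eq_Bolzano_Weierstrass Heine_Borel_imp_Bolzano_Weierstrass \<open>compact (closure V)\<close>)
  have cl: "closed {x\<in>closure V. G x = 0}"
    using continuous_closed_preimage_constant[OF assms(3) closed_closure] by simp
  have "x islimpt {x\<in>closure V. G x = 0}" using x(2) closure_subset[of V] by (elim islimpt_subset) auto
  then have "x \<in> {x\<in>closure V. G x = 0}" using cl closed_limpt by blast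
  then have xV: "x \<in> V" "G x = 0" using assms(2,4) by (auto simp: frontier_def interior_open)
  obtain B where B: "B > 0" "\<And>h. norm (blinfun_apply (G' x) h) \<ge> B * norm h"
    using linear_inj_bounded_below_pos[OF _ inj[OF xV]] blinfun.bounded_linear_right bounded_linear.linear by metis
  obtain d where d: "0 < d" "\<And>y. norm (y - x) < d \<Longrightarrow> norm (G y - G x - G' x (y - x)) \<le> B / 2 * norm (y - x)"
    using der[OF xV(1)] B(1) unfolding has_derivative_at_alt by (metis half_gt_zero)
  obtain y where y: "y \<in> {x\<in>V. G x = 0}" "y \<noteq> x" "dist y x < d"
    using x(2) d(1) unfolding islimpt_approachable by blast
  have "B * norm (y - x) \<le> norm (G' x (y - x))" by (rule B)
  also have "\<dots> \<le> B / 2 * norm (y - x)" using d(2)[of y] y xV by (simp add: dist_norm)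
  finally show False using y B(1) by simp
qed

context jordan_loop
begin

abbreviation "U \<equiv> of_complex ` ins"

lemma U_facts: "open U" "bounded U" "frontier U = of_complex ` range \<gamma>" "closure U = of_complex ` closure ins"
proof -
  have "interior U = U" using jordan by (simp add: interior_of_complex interior_open)
  then show "open U" by (metis open_interior)
  show "bounded U" using jordan by (simp add: bounded_iff)
qed (use jordan in \<open>simp_all add: frontier_of_complex closure_of_complex\<close>)

lemma frontier_U_iff: "v \<in> frontier U \<longleftrightarrow> to_complex v \<in> range \<gamma>"
  using U_facts(3) by (simp add: of_complex_image_iff)

text \<open>Using one frontier point for both variables of the approximation bound gives Rouche's
  condition, so \<open>G\<close> winds like \<open>F\<close>, and the winding of \<open>G\<close> is
  \<open>w\<close> times the signed count. As \<open>w\<close> is nonzero, the count does not depend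
  on \<open>G\<close>.\<close>

lemma zero_count_regular_approximation:
  assumes "regular_approximation F U G G'" and Fnz: "\<And>x. x \<in> frontier U \<Longrightarrow> F x \<noteq> 0"
    and contF: "continuous_on (closure U) F"
    and wind: "loop_winding p (\<lambda>t. to_complex (F (of_complex (\<gamma> t)))) m"
  shows "\<exists>d. real_of_int d = (\<Sum>x\<in>{x\<in>U. G x = 0}. sgn (det (matrix (blinfun_apply (G' x)))))  \<and> w * d = m"
proof -
  have reg: "continuous_on (closure U) G" "\<And>x. x \<in> U \<Longrightarrow> (G has_derivative blinfun_apply (G' x)) (at x)"
    "\<And>x y. x \<in> closure U \<Longrightarrow> y \<in> frontier U \<Longrightarrow> norm (G x - F x) < norm (F y)"
    "\<And>x. x \<in> U \<Longrightarrow> G x = 0 \<Longrightarrow> det (matrix (blinfun_apply (G' x))) \<noteq> 0"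
    using assms(1) unfolding regular_approximation_def by auto
  have clU: "closure U = U \<union> frontier U" by (simp add: closure_Un_frontier)
  have Gnz: "G x \<noteq> 0" if "x \<in> frontier U" for x
    using reg(3)[of x x] that clU by auto
  define Z where "Z = {x\<in>U. G x = 0}"
  have lin: "linear (blinfun_apply (G' x))" for x using blinfun.bounded_linear_right bounded_linear.linear by blast
  have fin: "finite Z" unfolding Z_def
  proof (rule finite_regular_zeros[OF U_facts(2,1) reg(1) Gnz reg(2)])
    fix x assume "x \<in> U" "G x = 0"
    then show "inj (blinfun_apply (G' x))" using reg(4) lin det_nz_iff_inj by blast
  qed
  define H where "H z = to_complex (G (of_complex z))" for z
  define \<sigma> :: "complex \<Rightarrow> int" where "\<sigma> z = (if 0 < det (matrix (blinfun_apply (G' (of_complex z)))) then 1 else -1)" for z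
  have contH: "continuous_on (closure ins) H" unfolding H_def
    by (intro continuous_intros continuous_on_compose2[OF reg(1)]) (auto simp: U_facts)
  have "loop_winding p (\<lambda>t. H (\<gamma> t)) (w * (\<Sum>a\<in>to_complex ` Z. \<sigma> a))"
  proof (rule winding_eq_zero_count)
    show "finite (to_complex ` Z)" using fin by simp
    show "to_complex ` Z \<subseteq> ins" by (auto simp: Z_def)
    show "H z = 0 \<longleftrightarrow> z \<in> to_complex ` Z" if "z \<in> closure ins" for z
    proof
      assume "H z = 0"
      then have "G (of_complex z) = 0" by (simp add: H_def)
      moreover have "of_complex z \<in> closure U" using that U_facts(4) by blast
      ultimately have "of_complex z \<in> Z" using Gnz clU by (auto simp: Z_def)
      then show "z \<in> to_complex ` Z" by (metis image_eqI to_of_complex)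
    qed (auto simp: H_def Z_def)
    fix a assume "a \<in> to_complex ` Z"
    then have a: "of_complex a \<in> U" "G (of_complex a) = 0" by (auto simp: Z_def)
    then have aU: "a \<in> ins" by (simp add: of_complex_image_iff)
    obtain \<alpha> \<beta> where ab: "\<And>h. to_complex (blinfun_apply (G' (of_complex a)) (of_complex h)) = \<alpha> * h + \<beta> * cnj h"
      "det (matrix (blinfun_apply (G' (of_complex a)))) = (norm \<alpha>)\<^sup>2 - (norm \<beta>)\<^sup>2"
      using real_jacobian_complex[of "G' (of_complex a)"] by blast
    have "((\<lambda>z. to_complex (G (of_complex z))) has_derivative (\<lambda>h. to_complex (blinfun_apply (G' (of_complex a)) (of_complex h)))) (at a)"
    proof (rule bounded_linear.has_derivative[OF bounded_linear_to_complex])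
      have "(G \<circ> of_complex has_derivative blinfun_apply (G' (of_complex a)) \<circ> of_complex) (at a)"
        by (rule diff_chain_at[OF bounded_linear_imp_has_derivative[OF bounded_linear_of_complex] reg(2)[OF a(1)]])
      then show "((\<lambda>z. G (of_complex z)) has_derivative (\<lambda>h. blinfun_apply (G' (of_complex a)) (of_complex h))) (at a)"
        by (simp add: o_def)
    qed
    then have dH: "(H has_derivative (\<lambda>h. \<alpha> * h + \<beta> * cnj h)) (at a)"
      by (simp add: H_def[abs_def] ab)
    have ne: "norm \<alpha> \<noteq> norm \<beta>" using reg(4)[OF a] ab(2) by auto
    have "simple_zero H a (if norm \<beta> < norm \<alpha> then 1 else -1)"
      by (rule simple_zero_of_derivative[OF dH _ _ aU continuous_on_subset[OF contH] ne])
        (use a jordan closure_subset in \<open>auto simp: H_def\<close>)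
    moreover have "0 < det (matrix (blinfun_apply (G' (of_complex a)))) \<longleftrightarrow> norm \<beta> < norm \<alpha>"
    proof -
      have "(norm \<alpha>)\<^sup>2 \<le> (norm \<beta>)\<^sup>2 \<longleftrightarrow> norm \<alpha> \<le> norm \<beta>" by simp
      then show ?thesis unfolding ab(2) by linarith
    qed
    ultimately show "\<sigma> a \<in> {1, - 1} \<and> simple_zero H a (\<sigma> a)" by (simp add: \<sigma>_def)
  qed (rule contH)
  moreover have "loop_winding p (\<lambda>t. H (\<gamma> t)) m"
  proof (rule loop_winding_close[OF wind])
    have onF: "of_complex (\<gamma> t) \<in> frontier U" for t by (simp add: frontier_U_iff)
    have "continuous_on (closure U) (\<lambda>x. to_complex (F x))" by (intro continuous_intros contF)
    then show "continuous_on UNIV (\<lambda>t. to_complex (F (of_complex (\<gamma> t))))"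
      by (rule continuous_on_compose2) (use onF clU cont_\<gamma> in \<open>auto intro!: continuous_intros\<close>)
    show "continuous_on UNIV (\<lambda>t. H (\<gamma> t))"
      by (rule continuous_on_compose2[OF contH cont_\<gamma>]) (auto simp: closure_ins)
    fix t
    have "norm (G (of_complex (\<gamma> t)) - F (of_complex (\<gamma> t))) < norm (F (of_complex (\<gamma> t)))"
      using reg(3) onF clU by blast
    then show "norm (H (\<gamma> t) - to_complex (F (of_complex (\<gamma> t)))) < norm (to_complex (F (of_complex (\<gamma> t))))"
      unfolding H_def to_complex_linear_simps(2)[symmetric] norm_to_complex .
  qed (simp_all add: per_\<gamma>)
  ultimately have m: "w * (\<Sum>a\<in>to_complex ` Z. \<sigma> a) = m" by (rule loop_winding_unique)
  have "(\<Sum>a\<in>to_complex ` Z. \<sigma> a) = (\<Sum>x\<in>Z. \<sigma> (to_complex x))"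
    by (rule sum.reindex_cong[where l=to_complex]) (auto intro: inj_onI simp: to_complex_eq_iff)
  moreover have "real_of_int (\<Sum>x\<in>Z. \<sigma> (to_complex x)) = (\<Sum>x\<in>Z. sgn (det (matrix (blinfun_apply (G' x)))))"
    unfolding of_int_sum
  proof (rule sum.cong)
    fix x assume "x \<in> Z"
    then have "det (matrix (blinfun_apply (G' x))) \<noteq> 0" using reg(4) by (auto simp: Z_def)
    then show "real_of_int (\<sigma> (to_complex x)) = sgn (det (matrix (blinfun_apply (G' x))))"
      by (simp add: \<sigma>_def sgn_if)
  qed simp
  ultimately show ?thesis using m unfolding Z_def by metis
qed

text \<open>The definite description needs a unique \<open>d\<close>: a regular approximation
  provides one, and \<open>w * d = w\<close> fixes it. The value 1 is the one that the degree
  hypothesis excludes.\<close>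

theorem brouwer_degree_eq_1:
  assumes contF: "continuous_on (closure U) F" and Fnz: "\<And>x. x \<in> frontier U \<Longrightarrow> F x \<noteq> 0"
    and wind: "loop_winding p (\<lambda>t. to_complex (F (of_complex (\<gamma> t)))) w"
  shows "brouwer_degree F U = 1"
proof -
  have count: "d = 1" if "regular_approximation F U G G'"
    "real_of_int d = (\<Sum>x\<in>{x\<in>U. G x = 0}. sgn (det (matrix (blinfun_apply (G' x)))))" for d G G'
    using zero_count_regular_approximation[OF that(1) Fnz contF wind] that(2) w_nonzero by auto
  have "frontier U \<noteq> {}" using U_facts(3) by simp
  then obtain G G' where G: "regular_approximation F U G G'"
    using regular_approximation_exists[OF U_facts(2) contF Fnz] by blast
  obtain d where "real_of_int d = (\<Sum>x\<in>{x\<in>U. G x = 0}. sgn (det (matrix (blinfun_apply (G' x)))))"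
    using zero_count_regular_approximation[OF G Fnz contF wind] by blast
  then have "real_of_int 1 = (\<Sum>x\<in>{x\<in>U. G x = 0}. sgn (det (matrix (blinfun_apply (G' x)))))"
    using count[OF G] by metis
  then show ?thesis unfolding brouwer_degree_def
    by (intro the_equality) (use G count in blast)+
qed

end

section \<open>Normals and tangents of a smooth Jordan curve\<close>

lemma periodic_uniformly_continuous:
  fixes q :: "real \<Rightarrow> 'a::metric_space"
  assumes p: "0 < p" and cont: "continuous_on UNIV q" and per: "\<And>t (k::int). q (t + of_int k * p) = q t" and e: "0 < e"
  obtains d where "0 < d" "\<And>s t. \<bar>s - t\<bar> < d \<Longrightarrow> dist (q s) (q t) < e"
proof -
  have "uniformly_continuous_on {-p..2*p} q"
    by (intro compact_uniformly_continuous continuous_on_subset[OF cont]) auto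
  then obtain d where d: "0 < d" "\<And>s t. s \<in> {-p..2*p} \<Longrightarrow> t \<in> {-p..2*p} \<Longrightarrow> dist s t < d \<Longrightarrow> dist (q s) (q t) < e"
    using e unfolding uniformly_continuous_on_def by metis
  \<comment> \<open>The bound by \<open>p\<close> keeps the shifted \<open>s\<close> in
    \<open>{-p..2*p}\<close> once \<open>t\<close> has been moved into one period.\<close>
  have "dist (q s) (q t) < e" if st: "\<bar>s - t\<bar> < min d p" for s t
  proof -
    obtain k :: int where t: "t + of_int k * p \<in> {0..<p}" using shift_into_period[OF p] by blast
    have "dist (q (s + of_int k * p)) (q (t + of_int k * p)) < e"
      by (rule d(2)) (use t st in \<open>auto simp: dist_norm\<close>)
    then show ?thesis by (simp add: per)
  qed
  then show ?thesis using that[of "min d p"] d p by simp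
qed

text \<open>A logarithm on the whole plane changes by a constant under each of the two period
  shifts; a diagonal shift performs both, so the constants add.\<close>

lemma torus_diagonal_winding:
  assumes cont: "continuous_on UNIV K" and nz: "\<And>s t. K (s, t) \<noteq> 0"
    and per: "\<And>s t. K (s + p, t) = K (s, t)" "\<And>s t. K (s, t + p) = K (s, t)"
    and w1: "loop_winding p (\<lambda>t. K (0::real, t)) m" and w2: "loop_winding p (\<lambda>s. K (s, 0::real)) n"
  shows "loop_winding p (\<lambda>t. K (t, t)) (m + n)"
proof -
  obtain l where l: "continuous_on UNIV l" "\<And>z. K z = exp (l z)"
    by (rule continuous_logarithm_on_contractible[OF cont])
      (use nz in \<open>auto intro!: convex_imp_contractible\<close>)
  have l1: "continuous_on UNIV (\<lambda>z. l (fst z, snd z + p) - l z)"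
    by (intro continuous_intros l(1) continuous_on_compose2[OF l(1)]) auto
  obtain i :: int where i: "\<And>z. l (fst z, snd z + p) - l z = 2 * of_int i * of_real pi * \<i>"
  proof (rule exp_diff_constant[OF connected_UNIV l1])
    fix z
    have "exp (l (fst z, snd z + p)) = exp (l z)"
      using per(2)[of "fst z" "snd z"] l(2)[of z] l(2)[of "(fst z, snd z + p)"] by simp
    then show "exp (l (fst z, snd z + p) - l z) = 1" by (simp add: exp_diff)
  qed blast
  have l2: "continuous_on UNIV (\<lambda>z. l (fst z + p, snd z) - l z)"
    by (intro continuous_intros l(1) continuous_on_compose2[OF l(1)]) auto
  obtain j :: int where j: "\<And>z. l (fst z + p, snd z) - l z = 2 * of_int j * of_real pi * \<i>"
  proof (rule exp_diff_constant[OF connected_UNIV l2])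
    fix z
    have "exp (l (fst z + p, snd z)) = exp (l z)"
      using per(1)[of "fst z" "snd z"] l(2)[of z] l(2)[of "(fst z + p, snd z)"] by simp
    then show "exp (l (fst z + p, snd z) - l z) = 1" by (simp add: exp_diff)
  qed blast
  have i': "l (s, t + p) = l (s, t) + 2 * of_int i * of_real pi * \<i>" for s t
    using i[of "(s, t)"] by (simp add: algebra_simps)
  have j': "l (s + p, t) = l (s, t) + 2 * of_int j * of_real pi * \<i>" for s t
    using j[of "(s, t)"] by (simp add: algebra_simps)
  have c: "continuous_on UNIV (\<lambda>t. l (a t, b t))" if "continuous_on UNIV a" "continuous_on UNIV b" for a b :: "real \<Rightarrow> real"
    by (intro continuous_on_compose2[OF l(1)] continuous_on_Pair that) auto
  have "loop_winding p (\<lambda>t. K (0, t)) i"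
    by (rule loop_windingI[of "\<lambda>t. l (0, t)"]) (auto intro!: c continuous_intros simp: l(2) i')
  then have "i = m" using w1 by (rule loop_winding_unique)
  have "loop_winding p (\<lambda>s. K (s, 0)) j"
    by (rule loop_windingI[of "\<lambda>t. l (t, 0)"]) (auto intro!: c continuous_intros simp: l(2) j')
  then have "j = n" using w2 by (rule loop_winding_unique)
  show ?thesis
    by (rule loop_windingI[of "\<lambda>t. l (t, t)"])
      (auto intro!: c continuous_intros simp: l(2) i' j' \<open>i = m\<close> \<open>j = n\<close> algebra_simps)
qed

section \<open>One-sided collars of a smooth Jordan curve\<close>

locale smooth_loop = jordan_loop +
  fixes \<gamma>' :: "real \<Rightarrow> complex"
  assumes der_\<gamma>: "\<And>t. (\<gamma> has_vector_derivative \<gamma>' t) (at t)" and cont_\<gamma>': "continuous_on UNIV \<gamma>'"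
    and per_\<gamma>': "\<And>t. \<gamma>' (t + p) = \<gamma>' t" and \<gamma>'_nz: "\<And>t. \<gamma>' t \<noteq> 0"
begin

lemma per_int': "\<gamma>' (t + of_int k * p) = \<gamma>' t"
  by (rule periodic_shift_int) (rule per_\<gamma>')

lemma \<gamma>_eq_near:
  assumes "\<gamma> r = \<gamma> t" "\<bar>r - t\<bar> < p"
  shows "r = t"
proof -
  obtain k l :: int where kl: "r + of_int k * p \<in> {0..<p}" "t + of_int l * p \<in> {0..<p}"
    using shift_into_period[OF p_pos] by metis
  have "r + of_int k * p = t + of_int l * p"
    using inj_onD[OF inj_\<gamma> _ kl] assms(1) per_int by simp
  then have eq: "r - t = of_int (l - k) * p" by (simp add: algebra_simps)
  then have "\<bar>of_int (l - k)\<bar> * p < 1 * p" using assms(2) p_pos by (simp add: abs_mult)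
  then have "\<bar>of_int (l - k) :: real\<bar> < 1" using p_pos by (simp only: mult_less_cancel_right_pos)
  then have "l - k = 0" by linarith
  then show ?thesis using eq by simp
qed

text \<open>Uniform continuity of the inverse of the curve, modulo the period: over pairs of times
  whose distance lies between \<open>e\<close> and \<open>p / 2\<close>, the chord length has a
  positive minimum by compactness and injectivity.\<close>

lemma \<gamma>_close_imp_time_close:
  assumes "0 < e"
  obtains d where "0 < d" "\<And>r t. norm (\<gamma> r - \<gamma> t) < d \<Longrightarrow> \<exists>r'. \<gamma> r' = \<gamma> r \<and> \<bar>r' - t\<bar> \<le> e"
proof -
  define K where "K = {(r, t). t \<in> {0..p} \<and> \<bar>r - t\<bar> \<le> p / 2 \<and> e \<le> \<bar>r - t\<bar>}"
  have "closed K"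
  proof -
    have "K = (\<lambda>z. (snd z, \<bar>fst z - snd z\<bar>)) -` ({0..p} \<times> {e..p/2})" by (auto simp: K_def)
    then show ?thesis by (auto intro!: closed_vimage closed_Times continuous_intros)
  qed
  moreover have "bounded K"
  proof (rule bounded_subset[of "{-p..2*p} \<times> {0..p}"])
    show "K \<subseteq> {-p..2*p} \<times> {0..p}" using p_pos by (auto simp: K_def abs_if split: if_splits)
  qed (simp add: bounded_Times)
  ultimately have cK: "compact K" by (simp add: compact_eq_bounded_closed)
  have "\<exists>d>0. \<forall>z\<in>K. d \<le> norm (\<gamma> (fst z) - \<gamma> (snd z))"
  proof (cases "K = {}")
    case True then show ?thesis by (intro exI[of _ 1]) auto
  next
    case False
    have c: "continuous_on K (\<lambda>z. norm (\<gamma> (fst z) - \<gamma> (snd z)))"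
      by (intro continuous_intros continuous_on_compose2[OF cont_\<gamma>]) auto
    then obtain z where z: "z \<in> K" "\<And>y. y \<in> K \<Longrightarrow> norm (\<gamma> (fst z) - \<gamma> (snd z)) \<le> norm (\<gamma> (fst y) - \<gamma> (snd y))"
      using continuous_attains_inf[OF cK False c] by blast
    have "\<gamma> (fst z) \<noteq> \<gamma> (snd z)"
      using \<gamma>_eq_near[of "fst z" "snd z"] z(1) assms p_pos by (auto simp: K_def)
    then show ?thesis using z(2) by (intro exI[of _ "norm (\<gamma> (fst z) - \<gamma> (snd z))"]) auto
  qed
  then obtain d where d: "0 < d" "\<And>z. z \<in> K \<Longrightarrow> d \<le> norm (\<gamma> (fst z) - \<gamma> (snd z))" by blast
  show ?thesis
  proof
    fix r t assume close: "norm (\<gamma> r - \<gamma> t) < d"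
    obtain k :: int where "t + of_int k * p \<in> {0..<p}" using shift_into_period[OF p_pos] by blast
    then have t: "t + of_int k * p \<in> {0..p}" by auto
    \<comment> \<open>Rounds \<open>(r - t) / p\<close> to a nearest integer, so that the shifted
      time differs from \<open>t\<close> by at most \<open>p / 2\<close>.\<close>
    define j where "j = - \<lfloor>(r - t) / p + 1/2\<rfloor>"
    have "of_int (- j) \<le> (r - t) / p + 1/2" "(r - t) / p + 1/2 < of_int (- j) + 1" unfolding j_def by linarith+
    then have "r + of_int j * p - t \<le> p / 2" "- (p / 2) \<le> r + of_int j * p - t" using p_pos by (auto simp: field_simps)
    then have j: "\<bar>r + of_int j * p - t\<bar> \<le> p / 2" by linarith
    have "(r + of_int (j + k) * p, t + of_int k * p) \<notin> K"
      using d(2)[of "(r + of_int (j + k) * p, t + of_int k * p)"] close per_int[of r "j + k"] per_int[of t k] by auto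
    then have "\<bar>r + of_int j * p - t\<bar> \<le> e" using t j unfolding K_def by (auto simp: algebra_simps)
    then show "\<exists>r'. \<gamma> r' = \<gamma> r \<and> \<bar>r' - t\<bar> \<le> e" using per_int by blast
  qed (rule d(1))
qed

lemma \<gamma>'_bounds:
  obtains m M where "0 < m" "\<And>t. m \<le> norm (\<gamma>' t)" "\<And>t. norm (\<gamma>' t) \<le> M"
proof -
  have c: "continuous_on {0..p} (\<lambda>t. norm (\<gamma>' t))"
    by (intro continuous_intros continuous_on_subset[OF cont_\<gamma>']) auto
  have ne: "{0..p} \<noteq> {}" using p_pos by simp
  obtain a where a: "a \<in> {0..p}" "\<And>t. t \<in> {0..p} \<Longrightarrow> norm (\<gamma>' a) \<le> norm (\<gamma>' t)"
    using continuous_attains_inf[OF compact_Icc ne c] by blast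
  obtain b where b: "b \<in> {0..p}" "\<And>t. t \<in> {0..p} \<Longrightarrow> norm (\<gamma>' t) \<le> norm (\<gamma>' b)"
    using continuous_attains_sup[OF compact_Icc ne c] by blast
  have "\<exists>s\<in>{0..p}. \<gamma>' s = \<gamma>' t" for t
  proof -
    obtain k :: int where "t + of_int k * p \<in> {0..<p}" using shift_into_period[OF p_pos] by blast
    then have "t + of_int k * p \<in> {0..p}" by auto
    then show ?thesis using per_int' by blast
  qed
  then show ?thesis using that[of "norm (\<gamma>' a)" "norm (\<gamma>' b)"] a b \<gamma>'_nz by (metis zero_less_norm_iff)
qed

abbreviation "nrm t \<equiv> \<i> * \<gamma>' t"

text \<open>A move along \<open>nrm t\<close> does not change the component in the direction
  \<open>\<gamma>' t\<close>, while this component increases strictly along the curve near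
  \<open>t\<close>; hence the two curve points coincide. Base point and normal may belong to
  different nearby times, as is needed for pushing points that are not on the normal at
  \<open>t\<close>.\<close>

lemma normal_segment_avoids_curve:
  obtains d where "0 < d" "\<And>r t s \<mu>. \<bar>r - t\<bar> \<le> d \<Longrightarrow> \<bar>\<mu>\<bar> \<le> d \<Longrightarrow> \<gamma> r + of_real \<mu> * nrm t = \<gamma> s \<Longrightarrow> \<mu> = 0"
proof -
  obtain m M where mM: "0 < m" "\<And>t. m \<le> norm (\<gamma>' t)" "\<And>t. norm (\<gamma>' t) \<le> M" using \<gamma>'_bounds by blast
  have M: "0 < M" using mM by (meson less_le_trans order.trans)
  obtain e0 where e0: "0 < e0" "\<And>s t. \<bar>s - t\<bar> < e0 \<Longrightarrow> dist (\<gamma>' s) (\<gamma>' t) < m"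
    using periodic_uniformly_continuous[OF p_pos cont_\<gamma>' per_int' mM(1)] by metis
  \<comment> \<open>Two steps of length at most \<open>e\<close>, from \<open>s'\<close> to
    \<open>r\<close> and from \<open>r\<close> to \<open>t\<close>, have to stay below
    \<open>e0\<close>.\<close>
  define e where "e = e0 / 3"
  have e: "0 < e" using e0 by (simp add: e_def)
  obtain d0 where d0: "0 < d0" "\<And>r t. norm (\<gamma> r - \<gamma> t) < d0 \<Longrightarrow> \<exists>r'. \<gamma> r' = \<gamma> r \<and> \<bar>r' - t\<bar> \<le> e"
    using \<gamma>_close_imp_time_close[OF e] by metis
  define d where "d = min e (d0 / (2 * M))"
  show ?thesis
  proof
    show "0 < d" using e d0 M by (simp add: d_def)
    fix r t s \<mu> assume rt: "\<bar>r - t\<bar> \<le> d" and mu: "\<bar>\<mu>\<bar> \<le> d" and eq: "\<gamma> r + of_real \<mu> * nrm t = \<gamma> s"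
    have "norm (\<gamma> s - \<gamma> r) = \<bar>\<mu>\<bar> * norm (\<gamma>' t)" using eq[symmetric] by (simp add: norm_mult)
    also have "\<dots> \<le> d0 / (2 * M) * M" using mu mM M d0 by (intro mult_mono) (auto simp: d_def)
    also have "\<dots> < d0" using M d0 by simp
    finally obtain s' where s': "\<gamma> s' = \<gamma> s" "\<bar>s' - r\<bar> \<le> e" using d0(2) by blast
    define h where "h u = Re (\<gamma> u * cnj (\<gamma>' t))" for u
    have dh: "(h has_real_derivative Re (\<gamma>' u * cnj (\<gamma>' t))) (at u)" for u
      unfolding h_def has_real_derivative_iff_has_vector_derivative
      by (intro bounded_linear.has_vector_derivative[OF bounded_linear_Re] has_vector_derivative_mult_left der_\<gamma>)
    have pos: "0 < Re (\<gamma>' u * cnj (\<gamma>' t))" if "\<bar>u - t\<bar> < e0" for u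
    proof -
      have "norm (\<gamma>' u - \<gamma>' t) < norm (\<gamma>' t)" using e0(2)[OF that] mM(2)[of t] by (simp add: dist_norm)
      then have "norm ((\<gamma>' u - \<gamma>' t) * cnj (\<gamma>' t)) < (norm (\<gamma>' t))\<^sup>2"
        using \<gamma>'_nz[of t] by (simp add: norm_mult power2_eq_square del: complex_cnj_diff)
      moreover have "\<bar>Re ((\<gamma>' u - \<gamma>' t) * cnj (\<gamma>' t))\<bar> \<le> norm ((\<gamma>' u - \<gamma>' t) * cnj (\<gamma>' t))" by (rule abs_Re_le_cmod)
      moreover have "Re (\<gamma>' t * cnj (\<gamma>' t)) = (norm (\<gamma>' t))\<^sup>2"
        unfolding cmod_power2 by (simp add: power2_eq_square)
      ultimately show ?thesis by (simp add: algebra_simps)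
    qed
    have mono: "h a < h b" if "a < b" "\<bar>a - t\<bar> < e0" "\<bar>b - t\<bar> < e0" for a b
    proof (rule DERIV_pos_imp_increasing[OF that(1)])
      fix x assume "a \<le> x" "x \<le> b"
      then have "\<bar>x - t\<bar> < e0" using that by linarith
      then show "\<exists>y. (h has_real_derivative y) (at x) \<and> 0 < y" using dh pos by blast
    qed
    have "h s' = h r" unfolding h_def s'(1) eq[symmetric] by (simp add: algebra_simps)
    moreover have "\<bar>r - t\<bar> \<le> e" using rt by (simp add: d_def)
    then have "\<bar>s' - t\<bar> < e0" "\<bar>r - t\<bar> < e0" using s'(2) e e_def by linarith+
    ultimately have "s' = r" using mono[of s' r] mono[of r s'] by (cases s' r rule: linorder_cases) auto
    then show "\<mu> = 0" using s'(1) eq \<gamma>'_nz[of t] by simp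
  qed
qed

lemma range_\<gamma>_compact: "compact (range \<gamma>)"
  using compact_simple_path_image[OF simple_unit_loop] by (simp only: path_image_unit_loop)

text \<open>At a nearest point the squared distance is stationary, so the difference is orthogonal
  to the tangent.\<close>

lemma nearest_point_normal:
  assumes "a \<notin> range \<gamma>"
  obtains t c where "a = \<gamma> t + of_real c * nrm t" "\<And>s. norm (a - \<gamma> t) \<le> norm (a - \<gamma> s)"
proof -
  obtain z where z: "z \<in> range \<gamma>" "\<And>y. y \<in> range \<gamma> \<Longrightarrow> dist a z \<le> dist a y"
    using distance_attains_inf[of "range \<gamma>" a] compact_imp_closed[OF range_\<gamma>_compact] by auto
  then obtain t where t: "z = \<gamma> t" by blast
  have near: "norm (a - \<gamma> t) \<le> norm (a - \<gamma> s)" for s using z(2)[of "\<gamma> s"] by (simp add: t dist_norm)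
  have "((\<lambda>s. (norm (a - \<gamma> s))\<^sup>2) has_real_derivative - 2 * Re ((a - \<gamma> t) * cnj (\<gamma>' t))) (at t)"
  proof -
    have "((\<lambda>s. Re ((a - \<gamma> s) * cnj (a - \<gamma> s))) has_vector_derivative
      Re ((a - \<gamma> t) * cnj (0 - \<gamma>' t) + (0 - \<gamma>' t) * cnj (a - \<gamma> t))) (at t)"
      by (intro bounded_linear.has_vector_derivative[OF bounded_linear_Re] has_vector_derivative_mult has_vector_derivative_diff
          has_vector_derivative_const bounded_linear.has_vector_derivative[OF bounded_linear_cnj] der_\<gamma>)
    moreover have "Re ((a - \<gamma> s) * cnj (a - \<gamma> s)) = (norm (a - \<gamma> s))\<^sup>2" for s
      unfolding cmod_power2 by (simp add: power2_eq_square algebra_simps)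
    moreover have "Re ((a - \<gamma> t) * cnj (0 - \<gamma>' t) + (0 - \<gamma>' t) * cnj (a - \<gamma> t)) = - 2 * Re ((a - \<gamma> t) * cnj (\<gamma>' t))"
      by (simp add: algebra_simps)
    ultimately show ?thesis unfolding has_real_derivative_iff_has_vector_derivative by (simp only:)
  qed
  then have "- 2 * Re ((a - \<gamma> t) * cnj (\<gamma>' t)) = 0"
  proof (rule DERIV_local_min[where d=1])
    show "\<forall>s. \<bar>t - s\<bar> < 1 \<longrightarrow> (norm (a - \<gamma> t))\<^sup>2 \<le> (norm (a - \<gamma> s))\<^sup>2"
      by (intro allI impI power_mono near) simp
  qed simp
  then have re: "Re ((a - \<gamma> t) * cnj (\<gamma>' t)) = 0" by linarith
  define c where "c = Im ((a - \<gamma> t) * cnj (\<gamma>' t)) / (norm (\<gamma>' t))\<^sup>2"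
  have "a - \<gamma> t = ((a - \<gamma> t) * cnj (\<gamma>' t)) * \<gamma>' t / of_real ((norm (\<gamma>' t))\<^sup>2)"
  proof -
    have "((a - \<gamma> t) * cnj (\<gamma>' t)) * \<gamma>' t = (a - \<gamma> t) * (\<gamma>' t * cnj (\<gamma>' t))" by (simp only: mult_ac)
    moreover have "\<gamma>' t * cnj (\<gamma>' t) \<noteq> 0" using \<gamma>'_nz[of t] by simp
    ultimately show ?thesis unfolding complex_norm_square by (metis nonzero_mult_div_cancel_right)
  qed
  also have "(a - \<gamma> t) * cnj (\<gamma>' t) = \<i> * of_real (Im ((a - \<gamma> t) * cnj (\<gamma>' t)))"
    using re by (simp add: complex_eq_iff)
  finally have "a = \<gamma> t + of_real c * nrm t" by (simp add: c_def algebra_simps)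
  then show ?thesis using near that by blast
qed

text \<open>Each collar \<open>B \<sigma>\<close> is the image of a convex set and misses the curve,
  so it lies in one component. Each component has the curve as frontier, hence contains a point
  close to it, which a nearest curve point places in a collar. Two collars for two components leave
  exactly one for each.\<close>

lemma two_sides:
  obtains d \<sigma> where "0 < d" "\<sigma> \<in> {1, -1 :: real}"
    "\<And>r t \<mu>. \<bar>r - t\<bar> \<le> d \<Longrightarrow> 0 < \<mu> \<Longrightarrow> \<mu> \<le> d \<Longrightarrow> \<gamma> r + of_real (\<sigma> * \<mu>) * nrm t \<in> ins"
    "\<And>r t \<mu>. \<bar>r - t\<bar> \<le> d \<Longrightarrow> 0 < \<mu> \<Longrightarrow> \<mu> \<le> d \<Longrightarrow> \<gamma> r + of_real (- \<sigma> * \<mu>) * nrm t \<in> out"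
proof -
  obtain d where d: "0 < d"
    "\<And>r t s \<mu>. \<bar>r - t\<bar> \<le> d \<Longrightarrow> \<bar>\<mu>\<bar> \<le> d \<Longrightarrow> \<gamma> r + of_real \<mu> * nrm t = \<gamma> s \<Longrightarrow> \<mu> = 0"
    using normal_segment_avoids_curve by metis
  define C where "C = {(r, t, \<mu>). \<bar>r - t\<bar> \<le> d \<and> 0 < \<mu> \<and> \<mu> \<le> d}"
  define B where "B \<sigma> = (\<lambda>(r, t, \<mu>). \<gamma> r + of_real (\<sigma> * \<mu>) * nrm t) ` C" for \<sigma> :: real
  have "convex C"
  proof (rule convexI, clarsimp simp: C_def)
    fix r t \<mu> r' t' \<mu>' u v :: real
    assume *: "\<bar>r - t\<bar> \<le> d" "0 < \<mu>" "\<mu> \<le> d" "\<bar>r' - t'\<bar> \<le> d" "0 < \<mu>'" "\<mu>' \<le> d" "0 \<le> u" "0 \<le> v" "u + v = 1"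
    have "\<bar>u * r + v * r' - (u * t + v * t')\<bar> = \<bar>u * (r - t) + v * (r' - t')\<bar>" by (simp add: algebra_simps)
    also have "\<dots> \<le> u * \<bar>r - t\<bar> + v * \<bar>r' - t'\<bar>" using * by (intro order_trans[OF abs_triangle_ineq]) (simp add: abs_mult)
    also have "\<dots> \<le> d" using * by (intro convex_bound_le) auto
    finally have 1: "\<bar>u * r + v * r' - (u * t + v * t')\<bar> \<le> d" .
    have 2: "u * \<mu> + v * \<mu>' \<le> d" using * by (intro convex_bound_le) auto
    have "0 < u * \<mu> + v * \<mu>'"
    proof (cases "u = 0")
      case True then show ?thesis using * by simp
    next
      case False then show ?thesis using * by (intro add_pos_nonneg) auto
    qed
    with 1 2 show "\<bar>u * r + v * r' - (u * t + v * t')\<bar> \<le> d \<and> 0 < u * \<mu> + v * \<mu>' \<and> u * \<mu> + v * \<mu>' \<le> d" by blast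
  qed
  then have conn: "connected (B \<sigma>)" for \<sigma> unfolding B_def
    by (intro connected_continuous_image convex_connected)
      (auto simp: split_def intro!: continuous_intros continuous_on_compose2[OF cont_\<gamma>] continuous_on_compose2[OF cont_\<gamma>'])
  have disj: "B \<sigma> \<inter> range \<gamma> = {}" if "\<sigma> \<in> {1, -1}" for \<sigma>
  proof -
    have False if "(r, t, \<mu>) \<in> C" "\<gamma> r + of_real (\<sigma> * \<mu>) * nrm t = \<gamma> s" for r t \<mu> s
      using d(2)[of r t "\<sigma> * \<mu>" s] that \<open>\<sigma> \<in> {1, -1}\<close> by (auto simp: C_def)
    then show ?thesis unfolding B_def by fast
  qed
  have IO: "open ins" "open out" "ins \<inter> out = {}" "ins \<union> out = - range \<gamma>" "frontier ins = range \<gamma>" "frontier out = range \<gamma>"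
    using jordan by auto
  have side: "B \<sigma> \<subseteq> ins \<or> B \<sigma> \<subseteq> out" if "\<sigma> \<in> {1, -1}" for \<sigma>
    using connectedD[OF conn[of \<sigma>] IO(1,2)] disj[OF that] IO(3,4) by blast
  obtain m M where mM: "0 < m" "\<And>t. m \<le> norm (\<gamma>' t)" "\<And>t. norm (\<gamma>' t) \<le> M" using \<gamma>'_bounds by blast
  have meets: "\<exists>\<sigma>\<in>{1,-1}. B \<sigma> \<inter> D \<noteq> {}" if D: "open D" "frontier D = range \<gamma>" "D \<inter> range \<gamma> = {}" for D
  proof -
    have "\<gamma> 0 \<in> closure D" using D(2) unfolding frontier_def by (metis DiffD1 rangeI)
    then obtain a where a: "a \<in> D" "dist a (\<gamma> 0) < d * m"
      using d(1) mM(1) unfolding closure_approachable by (metis mult_pos_pos)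
    have "a \<notin> range \<gamma>" using a D by blast
    then obtain t c where tc: "a = \<gamma> t + of_real c * nrm t" "\<And>s. norm (a - \<gamma> t) \<le> norm (a - \<gamma> s)"
      using nearest_point_normal by metis
    have "\<bar>c\<bar> * m \<le> \<bar>c\<bar> * norm (\<gamma>' t)" using mM by (intro mult_left_mono) auto
    also have "\<dots> = norm (a - \<gamma> t)" using tc(1) by (simp add: norm_mult)
    also have "\<dots> < d * m" using tc(2)[of 0] a(2) by (simp add: dist_norm)
    finally have cd: "\<bar>c\<bar> < d" using mM(1) by simp
    have "c \<noteq> 0" using tc(1) \<open>a \<notin> range \<gamma>\<close> by auto
    define \<sigma> where "\<sigma> = sgn c"
    have \<sigma>: "\<sigma> \<in> {1, -1}" "\<sigma> * \<bar>c\<bar> = c" using \<open>c \<noteq> 0\<close> by (auto simp: \<sigma>_def sgn_if)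
    have "(t, t, \<bar>c\<bar>) \<in> C" using cd \<open>c \<noteq> 0\<close> d by (auto simp: C_def)
    then have "(\<lambda>(r, t, \<mu>). \<gamma> r + of_real (\<sigma> * \<mu>) * nrm t) (t, t, \<bar>c\<bar>) \<in> B \<sigma>" unfolding B_def by (rule imageI)
    then have "a \<in> B \<sigma>" by (simp only: prod.case \<sigma>(2) tc(1)[symmetric])
    then show ?thesis using a \<sigma> by blast
  qed
  have "ins \<inter> range \<gamma> = {}" "out \<inter> range \<gamma> = {}" using IO by blast+
  then have m1: "\<exists>\<sigma>\<in>{1,-1}. B \<sigma> \<inter> ins \<noteq> {}" and m2: "\<exists>\<sigma>\<in>{1,-1}. B \<sigma> \<inter> out \<noteq> {}"
    using meets[OF IO(1) IO(5)] meets[OF IO(2) IO(6)] by blast+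
  from m1 obtain \<sigma> where \<sigma>: "\<sigma> \<in> {1, -1}" "B \<sigma> \<inter> ins \<noteq> {}" by blast
  have si: "B \<sigma> \<subseteq> ins" using side[OF \<sigma>(1)] \<sigma>(2) IO(3) by blast
  have so: "B (- \<sigma>) \<subseteq> out"
  proof -
    obtain \<tau> where \<tau>: "\<tau> \<in> {1, -1}" "B \<tau> \<inter> out \<noteq> {}" using m2 by blast
    then have "\<tau> \<noteq> \<sigma>" using si IO(3) by blast
    then have "\<tau> = - \<sigma>" using \<tau>(1) \<sigma>(1) by auto
    then show ?thesis using side[OF \<tau>(1)] \<tau>(2) IO(3) by blast
  qed
  have mem: "\<gamma> r + of_real (\<tau> * \<mu>) * nrm t \<in> B \<tau>" if "\<bar>r - t\<bar> \<le> d" "0 < \<mu>" "\<mu> \<le> d" for r t \<mu> \<tau>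
    unfolding B_def by (rule image_eqI[where x="(r, t, \<mu>)"]) (use that in \<open>auto simp: C_def\<close>)
  show ?thesis
    by (rule that[OF d(1) \<sigma>(1)]) (use mem si so in blast)+
qed

text \<open>At a first exit from \<open>D\<close> the point is on the curve; stepping back from
  there leads out of \<open>D\<close> by \<open>out\<close>, yet the points just before the exit are
  in \<open>D\<close>. The starting point need not lie on the normal at \<open>t\<close>.\<close>

lemma push_along_normal:
  assumes D: "open D" "frontier D = range \<gamma>" and d: "0 < d"
    and out: "\<And>r t \<mu>. \<bar>r - t\<bar> \<le> d \<Longrightarrow> 0 < \<mu> \<Longrightarrow> \<mu> \<le> d \<Longrightarrow> \<gamma> r - of_real \<mu> * N t \<notin> D"
    and N: "\<And>t. norm (N t) = norm (\<gamma>' t)"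
  obtains e where "0 < e" "\<And>a t \<mu>. a \<in> D \<Longrightarrow> norm (a - \<gamma> t) \<le> e \<Longrightarrow> 0 \<le> \<mu> \<Longrightarrow> \<mu> \<le> e \<Longrightarrow> a + of_real \<mu> * N t \<in> D"
proof -
  obtain m M where mM: "0 < m" "\<And>t. m \<le> norm (\<gamma>' t)" "\<And>t. norm (\<gamma>' t) \<le> M" using \<gamma>'_bounds by blast
  have M: "0 < M" using mM by (meson less_le_trans order.trans)
  obtain d0 where d0: "0 < d0" "\<And>r t. norm (\<gamma> r - \<gamma> t) < d0 \<Longrightarrow> \<exists>r'. \<gamma> r' = \<gamma> r \<and> \<bar>r' - t\<bar> \<le> d"
    using \<gamma>_close_imp_time_close[OF d] by metis
  \<comment> \<open>Starting distance and push together are at most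
    \<open>e * (1 + M) = d0 / 2\<close>, so the exit point is close enough to
    \<open>\<gamma> t\<close>.\<close>
  define e where "e = d0 / 2 / (1 + M)"
  have e: "0 < e" using d0 M by (simp add: e_def)
  show ?thesis
  proof (rule that[OF e], rule ccontr)
    fix a t \<mu> assume a: "a \<in> D" "norm (a - \<gamma> t) \<le> e" and \<mu>: "0 \<le> \<mu>" "\<mu> \<le> e" and notin: "a + of_real \<mu> * N t \<notin> D"
    define Z where "Z = {0..\<mu>} \<inter> (\<lambda>\<nu>. a + of_real \<nu> * N t) -` (- D)"
    have "closed Z" unfolding Z_def
      by (intro closed_Int closed_vimage) (auto simp: D intro!: continuous_intros closed_Compl)
    then have "compact Z" unfolding Z_def by (simp add: compact_Int_closed compact_eq_bounded_closed bounded_Int)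
    moreover have "Z \<noteq> {}" using \<mu> notin by (auto simp: Z_def)
    ultimately obtain \<nu> where \<nu>: "\<nu> \<in> Z" "\<And>x. x \<in> Z \<Longrightarrow> \<nu> \<le> x" using compact_attains_inf by metis
    have "\<nu> \<noteq> 0" using \<nu>(1) a(1) by (auto simp: Z_def)
    then have \<nu>0: "0 < \<nu>" "\<nu> \<le> \<mu>" using \<nu>(1) by (auto simp: Z_def)
    have inD: "a + of_real x * N t \<in> D" if "0 \<le> x" "x < \<nu>" for x
      using \<nu>(2)[of x] that \<nu>0 by (auto simp: Z_def)
    have "a + of_real \<nu> * N t \<in> closure D"
    proof (rule Lim_in_closed_set[OF closed_closure])
      have "((\<lambda>x. a + of_real x * N t) \<longlongrightarrow> a + of_real \<nu> * N t) (at \<nu>)" by (intro tendsto_intros)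
      then show "((\<lambda>x. a + of_real x * N t) \<longlongrightarrow> a + of_real \<nu> * N t) (at_left \<nu>)" by (rule filterlim_mono) (auto simp: at_le)
      show "\<forall>\<^sub>F x in at_left \<nu>. a + of_real x * N t \<in> closure D"
        unfolding eventually_at_left[OF \<nu>0(1)] using inD \<nu>0 closure_subset by (intro exI[of _ 0]) force
    qed auto
    moreover have "a + of_real \<nu> * N t \<notin> D" using \<nu>(1) by (auto simp: Z_def)
    ultimately have "a + of_real \<nu> * N t \<in> range \<gamma>" using D by (metis DiffI frontier_def interior_open)
    then obtain r0 where r0: "\<gamma> r0 = a + of_real \<nu> * N t" by auto
    have "norm (\<gamma> r0 - \<gamma> t) \<le> norm (a - \<gamma> t) + \<nu> * norm (N t)"
      unfolding r0 using \<nu>0 norm_triangle_ineq[of "a - \<gamma> t" "of_real \<nu> * N t"] by (simp add: norm_mult algebra_simps)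
    also have "\<dots> \<le> e + e * M" using a \<nu>0 \<mu> mM N M by (intro add_mono mult_mono) auto
    also have "\<dots> = e * (1 + M)" by (simp add: algebra_simps)
    also have "\<dots> = d0 / 2" using M by (metis e_def nonzero_divide_eq_eq add_pos_pos less_irrefl zero_less_one)
    also have "\<dots> < d0" using d0 by simp
    finally obtain r where r: "\<gamma> r = \<gamma> r0" "\<bar>r - t\<bar> \<le> d" using d0(2) by blast
    define x where "x = min \<nu> d / 2"
    have x: "0 < x" "x \<le> d" "0 \<le> \<nu> - x" "\<nu> - x < \<nu>" using \<nu>0 d by (auto simp: x_def)
    have "\<gamma> r - of_real x * N t = a + of_real (\<nu> - x) * N t" unfolding r r0 by (simp add: algebra_simps)
    then show False using out[OF r(2) x(1,2)] inD[OF x(3,4)] by simp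
  qed
qed

text \<open>The vectors from the inner parallel curve to the outer one form a zero-free function on the torus, whose
  diagonal is a multiple of the normal. Its winding numbers in the two variables are those of the curve
  about an inner point and of the inner curve about an outer point, that is, \<open>w\<close> and 0.\<close>

theorem tangent_winding: "loop_winding p \<gamma>' w"
proof -
  obtain d \<sigma> where d: "0 < d" and \<sigma>: "\<sigma> \<in> {1, -1 :: real}"
    and ii: "\<And>r t \<mu>. \<bar>r - t\<bar> \<le> d \<Longrightarrow> 0 < \<mu> \<Longrightarrow> \<mu> \<le> d \<Longrightarrow> \<gamma> r + of_real (\<sigma> * \<mu>) * nrm t \<in> ins"
    and oo: "\<And>r t \<mu>. \<bar>r - t\<bar> \<le> d \<Longrightarrow> 0 < \<mu> \<Longrightarrow> \<mu> \<le> d \<Longrightarrow> \<gamma> r + of_real (- \<sigma> * \<mu>) * nrm t \<in> out"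
    using two_sides by metis
  define P where "P t = \<gamma> t + of_real (\<sigma> * d) * nrm t" for t
  define Q where "Q x t = \<gamma> t + of_real (- \<sigma> * (x * d)) * nrm t" for x t
  have P: "P t \<in> ins" for t unfolding P_def using ii[of t t d] d by simp
  have Q: "Q x t \<notin> ins" if "0 \<le> x" "x \<le> 1" for x t
  proof (cases "x = 0")
    case True
    moreover have "\<gamma> t \<notin> ins" by (metis disjoint_iff inside_no_overlap rangeI)
    ultimately show ?thesis by (simp add: Q_def)
  next
    case False
    then have "Q x t \<in> out" unfolding Q_def using oo[of t t "x * d"] d that by (simp add: mult_left_le_one_le)
    then show ?thesis using jordan by blast
  qed
  have Q1: "Q 1 t \<in> out" for t unfolding Q_def using oo[of t t d] d by simp
  have contP: "continuous_on UNIV P" and perP: "P (t + p) = P t" for t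
    unfolding P_def using per_\<gamma> per_\<gamma>' by (auto intro!: continuous_intros cont_\<gamma> cont_\<gamma>')
  have perQ: "Q x (t + p) = Q x t" for x t unfolding Q_def using per_\<gamma> per_\<gamma>' by simp
  have contQ: "continuous_on S (\<lambda>z. Q (a z) (b z))" if "continuous_on S a" "continuous_on S b" for S :: "(real \<times> real) set" and a b
    unfolding Q_def by (intro continuous_intros continuous_on_compose2[OF cont_\<gamma>] continuous_on_compose2[OF cont_\<gamma>'] that) auto
  have "loop_winding p (\<lambda>t. (\<lambda>z. Q 1 (snd z) - P (fst z)) (t, t)) (w + 0)"
  proof (rule torus_diagonal_winding[where K="\<lambda>z. Q 1 (snd z) - P (fst z)"])
    show "continuous_on UNIV (\<lambda>z. Q 1 (snd z) - P (fst z))"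
      by (intro continuous_intros contQ continuous_on_compose2[OF contP]) auto
    show "Q 1 (snd (s, t)) - P (fst (s, t)) \<noteq> 0" for s t
      using P[of s] Q[of 1 t] by auto
    \<comment> \<open>Sliding \<open>Q x\<close> from the outer curve back to \<gamma> never enters
      \<open>ins\<close>, so its winding about the inner point \<open>P 0\<close> does not
      change.\<close>
    have "loop_winding p (\<lambda>t. (\<lambda>z. Q (fst z) (snd z) - P 0) (0, t)) w \<longleftrightarrow> loop_winding p (\<lambda>t. (\<lambda>z. Q (fst z) (snd z) - P 0) (1, t)) w"
    proof (rule loop_winding_homotopy[where K="\<lambda>z. Q (fst z) (snd z) - P 0"])
      show "continuous_on ({0..1} \<times> UNIV) (\<lambda>z. Q (fst z) (snd z) - P 0)"
        by (intro continuous_intros contQ)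
      show "Q (fst (x, t)) (snd (x, t)) - P 0 \<noteq> 0" if "x \<in> {0..1}" for x t
        using P[of 0] Q[of x t] that by auto
    qed (simp add: perQ)
    moreover have "Q 0 t = \<gamma> t" for t by (simp add: Q_def)
    ultimately show "loop_winding p (\<lambda>t. Q 1 (snd (0::real, t)) - P (fst (0, t))) w"
      using winding_in[OF P[of 0]] by simp
    have "loop_winding p (\<lambda>s. (\<lambda>z. Q 1 0 - z) (P s)) 0"
    proof (rule winding_zero_of_nonvanishing[where h="\<lambda>z. Q 1 0 - z" and q=P])
      show "Q 1 0 - z \<noteq> 0" if "z \<in> closure ins" for z
        using that Q1[of 0] compl_closure_ins by auto
    qed (use contP perP P closure_subset in \<open>auto intro!: continuous_intros\<close>)
    then show "loop_winding p (\<lambda>s. Q 1 (snd (s, 0::real)) - P (fst (s, 0))) 0" by simp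
  qed (simp_all add: perP perQ)
  moreover have "Q 1 t - P t = of_real (- 2 * \<sigma> * d) * \<i> * \<gamma>' t" for t
    by (simp add: Q_def P_def algebra_simps)
  ultimately have *: "loop_winding p (\<lambda>t. of_real (- 2 * \<sigma> * d) * \<i> * \<gamma>' t) w" by simp
  define c where "c = of_real (- 2 * \<sigma> * d) * \<i>"
  have c: "c \<noteq> 0" using \<sigma> d by (auto simp: c_def)
  have "loop_winding p (\<lambda>t. inverse c * (c * \<gamma>' t)) (0 + w)"
    by (rule loop_winding_mult[OF loop_winding_const]) (use c * in \<open>auto simp: c_def\<close>)
  moreover have "inverse c * (c * \<gamma>' t) = \<gamma>' t" for t using c by simp
  ultimately show ?thesis by simp
qed

end

section \<open>Perturbations of an autonomous system\<close>

lemma C1_lipschitz_on_compact: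
  fixes f :: "'a::euclidean_space \<Rightarrow> 'b::real_normed_vector"
  assumes der: "\<And>x. (f has_derivative blinfun_apply (f' x)) (at x)" and cont: "continuous_on UNIV f'"
    and K: "compact K" "convex K"
  obtains L where "0 < L" "\<And>x y. x \<in> K \<Longrightarrow> y \<in> K \<Longrightarrow> norm (f x - f y) \<le> L * norm (x - y)"
    "\<And>x. x \<in> K \<Longrightarrow> norm (f' x) \<le> L"
proof -
  have "bounded (f' ` K)"
    by (intro compact_imp_bounded compact_continuous_image K continuous_on_subset[OF cont]) auto
  then obtain L where L: "0 < L" "\<And>x. x \<in> K \<Longrightarrow> norm (f' x) \<le> L"
    unfolding bounded_pos by auto
  have "norm (f x - f y) \<le> L * norm (x - y)" if "x \<in> K" "y \<in> K" for x y
    by (rule differentiable_bound[OF K(2) _ _ that(1,2)])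
      (use L der in \<open>auto intro: has_derivative_at_withinI simp: norm_blinfun.rep_eq\<close>)
  then show ?thesis using L that by blast
qed

text \<open>\<open>f\<close> is Lipschitz only on bounded sets, but over a compact interval both
  solutions stay in a common ball.\<close>

lemma C1_solution_unique:
  fixes f :: "'a::euclidean_space \<Rightarrow> 'a"
  assumes der: "\<And>x. (f has_derivative blinfun_apply (f' x)) (at x)" and cont: "continuous_on UNIV f'"
    and x: "\<And>t. t \<in> {a..b} \<Longrightarrow> (x has_vector_derivative f (x t)) (at t within {a..b})"
    and y: "\<And>t. t \<in> {a..b} \<Longrightarrow> (y has_vector_derivative f (y t)) (at t within {a..b})"
    and st: "s \<in> {a..b}" "t \<in> {a..b}" "x s = y s"
  shows "x t = y t"
proof -
  have "bounded (x ` {a..b})" "bounded (y ` {a..b})"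
    using continuous_on_vector_derivative[OF x] continuous_on_vector_derivative[OF y]
    by (auto intro!: compact_imp_bounded compact_continuous_image)
  then have "bounded (x ` {a..b} \<union> y ` {a..b})" by simp
  then obtain R where R: "\<And>z. z \<in> x ` {a..b} \<union> y ` {a..b} \<Longrightarrow> norm z \<le> R" unfolding bounded_iff by blast
  obtain L where L: "0 < L" "\<And>x y. x \<in> cball 0 R \<Longrightarrow> y \<in> cball 0 R \<Longrightarrow> norm (f x - f y) \<le> L * norm (x - y)"
    using C1_lipschitz_on_compact[OF der cont compact_cball convex_cball] by metis
  have "norm (x t - y t) \<le> (norm (x s - y s) + 0 * \<bar>t - s\<bar>) * exp (L * \<bar>t - s\<bar>)"
  proof (rule gronwall[where e'="\<lambda>t. f (x t) - f (y t)" and a=a and b=b])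
    show "((\<lambda>t. x t - y t) has_vector_derivative f (x r) - f (y r)) (at r within {a..b})" if "r \<in> {a..b}" for r
      by (intro derivative_intros x y that)
    show "norm (f (x r) - f (y r)) \<le> L * norm (x r - y r) + 0" if "r \<in> {a..b}" for r
      using L(2)[of "x r" "y r"] R that by simp
  qed (use st L in simp_all)
  then show ?thesis using st by simp
qed

section \<open>Truncation and first-order expansion\<close>

locale truncated_system =
  fixes T R :: real and f :: "'a::euclidean_space \<Rightarrow> 'a" and f' :: "'a \<Rightarrow> 'a \<Rightarrow>\<^sub>L 'a"
    and g :: "real \<Rightarrow> 'a \<Rightarrow> real \<Rightarrow> 'a"
  assumes T_pos: "0 < T" and R_pos: "0 < R"
    and der_f: "\<And>x. (f has_derivative blinfun_apply (f' x)) (at x)" and cont_f': "continuous_on UNIV f'"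
    and cont_g: "continuous_on (UNIV \<times> UNIV \<times> {0..1}) (\<lambda>(t, x, \<epsilon>). g t x \<epsilon>)"
begin

text \<open>Precomposing with the projection \<open>pr\<close> onto a ball makes \<open>f\<close> globally Lipschitz and \<open>g\<close> bounded; solutions near
  the cycle stay inside the ball and are not affected.\<close>

definition pr :: "'a \<Rightarrow> 'a" where "pr = closest_point (cball 0 R)"

lemma pr_eq: "norm x \<le> R \<Longrightarrow> pr x = x"
  unfolding pr_def by (rule closest_point_self) simp

lemma norm_pr: "norm (pr x) \<le> R"
  using closest_point_in_set[of "cball 0 R" x] R_pos by (simp add: pr_def)

lemma pr_lipschitz: "norm (pr x - pr y) \<le> norm (x - y)"
  using closest_point_lipschitz[of "cball 0 R" x y] R_pos by (simp add: pr_def dist_norm)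

lemma continuous_on_pr [continuous_intros]: "continuous_on S h \<Longrightarrow> continuous_on S (\<lambda>x. pr (h x))"
  using continuous_on_compose2[OF continuous_on_closest_point[of "cball 0 R" UNIV]] R_pos unfolding pr_def by auto

text \<open>One constant for two purposes: Lipschitz estimates of \<open>f\<close> on the ball and
  the bound on its derivative in the linearized equation.\<close>

definition L where "L = (SOME L. 0 < L \<and> (\<forall>x\<in>cball 0 R. \<forall>y\<in>cball 0 R. norm (f x - f y) \<le> L * norm (x - y))
  \<and> (\<forall>x\<in>cball 0 R. norm (f' x) \<le> L))"

lemma L_pos: "0 < L" and L_lip: "\<And>x y. norm x \<le> R \<Longrightarrow> norm y \<le> R \<Longrightarrow> norm (f x - f y) \<le> L * norm (x - y)"
  and L_f': "\<And>x. norm x \<le> R \<Longrightarrow> norm (f' x) \<le> L"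
proof -
  have "\<exists>L. 0 < L \<and> (\<forall>x\<in>cball 0 R. \<forall>y\<in>cball 0 R. norm (f x - f y) \<le> L * norm (x - y))
     \<and> (\<forall>x\<in>cball 0 R. norm (f' x) \<le> L)"
    using C1_lipschitz_on_compact[OF der_f cont_f' compact_cball convex_cball, of 0 R] by metis
  from someI_ex[OF this, folded L_def]
  show "0 < L" "\<And>x y. norm x \<le> R \<Longrightarrow> norm y \<le> R \<Longrightarrow> norm (f x - f y) \<le> L * norm (x - y)"
    "\<And>x. norm x \<le> R \<Longrightarrow> norm (f' x) \<le> L" by auto
qed

definition fh where "fh x = f (pr x)"

sublocale lipschitz_field fh L
proof
  show "norm (fh x - fh y) \<le> L * norm (x - y)" for x y
  proof -
    have "norm (fh x - fh y) \<le> L * norm (pr x - pr y)" unfolding fh_def by (intro L_lip norm_pr)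
    also have "\<dots> \<le> L * norm (x - y)" using pr_lipschitz L_pos by simp
    finally show ?thesis .
  qed
qed (rule L_pos)

lemma fh_eq: "norm x \<le> R \<Longrightarrow> fh x = f x" by (simp add: fh_def pr_eq)

lemma continuous_on_g [continuous_intros]:
  assumes "continuous_on S a" "continuous_on S b" "continuous_on S c" "\<And>x. x \<in> S \<Longrightarrow> c x \<in> {0..1}"
  shows "continuous_on S (\<lambda>x. g (a x) (b x) (c x))"
proof -
  have "continuous_on S (\<lambda>x. (a x, b x, c x))" by (intro continuous_on_Pair assms)
  from continuous_on_compose2[OF cont_g this] show ?thesis using assms(4) by fastforce
qed

definition B where "B = (SOME B. 0 < B \<and> (\<forall>t\<in>{0..T}. \<forall>x\<in>cball 0 R. \<forall>\<epsilon>\<in>{0..1}. norm (g t x \<epsilon>) \<le> B))"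

lemma B_pos: "0 < B" and B_g: "\<And>t x \<epsilon>. t \<in> {0..T} \<Longrightarrow> norm x \<le> R \<Longrightarrow> \<epsilon> \<in> {0..1} \<Longrightarrow> norm (g t x \<epsilon>) \<le> B"
proof -
  have "compact ((\<lambda>z. g (fst z) (fst (snd z)) (snd (snd z))) ` ({0..T} \<times> cball 0 R \<times> {0..1}))"
    by (intro compact_continuous_image continuous_intros compact_Times) auto
  then have "bounded ((\<lambda>z. g (fst z) (fst (snd z)) (snd (snd z))) ` ({0..T} \<times> cball 0 R \<times> {0..1}))" by (rule compact_imp_bounded)
  then obtain b where "0 < b" "\<forall>y\<in>(\<lambda>z. g (fst z) (fst (snd z)) (snd (snd z))) ` ({0..T} \<times> cball 0 R \<times> {0..1}). norm y \<le> b"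
    unfolding bounded_pos by blast
  then have "\<exists>B. 0 < B \<and> (\<forall>t\<in>{0..T}. \<forall>x\<in>cball 0 R. \<forall>\<epsilon>\<in>{0..1}. norm (g t x \<epsilon>) \<le> B)"
    by (intro exI[of _ b]) force
  from someI_ex[OF this, folded B_def] show "0 < B"
    "\<And>t x \<epsilon>. t \<in> {0..T} \<Longrightarrow> norm x \<le> R \<Longrightarrow> \<epsilon> \<in> {0..1} \<Longrightarrow> norm (g t x \<epsilon>) \<le> B" by auto
qed

text \<open>The defect is measured relative to \<open>\<epsilon>\<close>, so that one estimate covers all perturbations uniformly \<open>\<kappa>\<close>-close
  to \<open>g\<close>.\<close>

definition approx_solution :: "real \<Rightarrow> real \<Rightarrow> (real \<Rightarrow> 'a) \<Rightarrow> bool" where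
  "approx_solution \<epsilon> \<kappa> x \<longleftrightarrow> (\<forall>t\<in>{0..T}. \<exists>d. (x has_vector_derivative d) (at t within {0..T}) \<and>
     norm (d - (fh (x t) + \<epsilon> *\<^sub>R g t (pr (x t)) \<epsilon>)) \<le> \<epsilon> * \<kappa>)"

lemma approx_solution_mono:
  "approx_solution \<epsilon> \<kappa> x \<Longrightarrow> 0 \<le> \<epsilon> \<Longrightarrow> \<kappa> \<le> \<kappa>' \<Longrightarrow> approx_solution \<epsilon> \<kappa>' x"
  unfolding approx_solution_def by (meson mult_left_mono order_trans)

text \<open>Gronwall constant: perturbation and defect, divided by \<epsilon>, amount to at most
  \<open>B + 1\<close> over a time of length \<open>T\<close>.\<close>

definition C0 where "C0 = (B + 1) * T * exp (L * T)"

lemma C0_pos: "0 < C0" using B_pos T_pos by (simp add: C0_def)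

lemma approx_solution_dist:
  assumes x: "approx_solution \<epsilon> \<kappa> x" and u: "\<And>t. t \<in> {0..T} \<Longrightarrow> (u has_vector_derivative fh (u t)) (at t within {0..T})"
    and \<epsilon>: "0 \<le> \<epsilon>" "\<epsilon> \<le> 1" and \<kappa>: "\<kappa> \<le> 1" and st: "s \<in> {0..T}" "t \<in> {0..T}"
  shows "norm (x t - u t) \<le> norm (x s - u s) * exp (L * T) + \<epsilon> * C0"
proof -
  obtain d where d: "\<And>t. t \<in> {0..T} \<Longrightarrow> (x has_vector_derivative d t) (at t within {0..T})"
    "\<And>t. t \<in> {0..T} \<Longrightarrow> norm (d t - (fh (x t) + \<epsilon> *\<^sub>R g t (pr (x t)) \<epsilon>)) \<le> \<epsilon> * \<kappa>"
    using x unfolding approx_solution_def by metis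
  have "norm (x t - u t) \<le> (norm (x s - u s) + (\<epsilon> * (B + 1)) * \<bar>t - s\<bar>) * exp (L * \<bar>t - s\<bar>)"
  proof (rule gronwall[where e'="\<lambda>t. d t - fh (u t)" and a=0 and b=T])
    show "((\<lambda>t. x t - u t) has_vector_derivative d r - fh (u r)) (at r within {0..T})" if "r \<in> {0..T}" for r
      by (intro derivative_intros d u that)
    fix r assume r: "r \<in> {0..T}"
    have "d r - fh (u r) = (d r - (fh (x r) + \<epsilon> *\<^sub>R g r (pr (x r)) \<epsilon>)) + (fh (x r) - fh (u r)) + \<epsilon> *\<^sub>R g r (pr (x r)) \<epsilon>"
      by simp
    also have "norm \<dots> \<le> \<epsilon> * \<kappa> + L * norm (x r - u r) + \<epsilon> * B"
      using d(2)[OF r] lip B_g[OF r norm_pr] \<epsilon> by (intro norm_triangle_le add_mono) (auto simp: mult_left_mono)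
    also have "\<dots> \<le> L * norm (x r - u r) + \<epsilon> * (B + 1)"
      using \<epsilon> \<kappa> mult_left_mono[of \<kappa> 1 \<epsilon>] by (simp add: algebra_simps)
    finally show "norm (d r - fh (u r)) \<le> L * norm (x r - u r) + \<epsilon> * (B + 1)" .
  qed (use L_pos B_pos \<epsilon> st in auto)
  also have "\<dots> \<le> (norm (x s - u s) + (\<epsilon> * (B + 1)) * T) * exp (L * T)"
  proof (intro mult_mono add_mono order_refl)
    show "\<bar>t - s\<bar> \<le> T" using st by auto
    then show "exp (L * \<bar>t - s\<bar>) \<le> exp (L * T)" using L_pos by simp
  qed (use B_pos \<epsilon> T_pos in auto)
  finally show ?thesis by (simp add: C0_def algebra_simps)
qed

text \<open>The factor 3 counts three errors of size \<open>\<epsilon> * \<kappa>\<close>: the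
  defect, the linearization remainder of \<open>f\<close>, and the variation of
  \<open>g\<close>.\<close>

definition C1 where "C1 = 3 * T * exp (L * T)"

lemma C1_pos: "0 < C1" using T_pos by (simp add: C1_def)

lemma uniform_linearization:
  assumes "0 < \<kappa>"
  obtains \<delta> where "0 < \<delta>" "\<And>a b. norm a \<le> R \<Longrightarrow> norm b \<le> R \<Longrightarrow> norm (a - b) < \<delta> \<Longrightarrow>
     norm (f a - f b - blinfun_apply (f' b) (a - b)) \<le> \<kappa> * norm (a - b)"
proof -
  have "uniformly_continuous_on (cball 0 R) f'"
    by (intro compact_uniformly_continuous continuous_on_subset[OF cont_f']) auto
  then obtain \<delta> where \<delta>: "0 < \<delta>" "\<And>a b. a \<in> cball 0 R \<Longrightarrow> b \<in> cball 0 R \<Longrightarrow> dist a b < \<delta> \<Longrightarrow> dist (f' a) (f' b) < \<kappa>"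
    using assms unfolding uniformly_continuous_on_def by metis
  show ?thesis
  proof (rule that[OF \<delta>(1)])
    fix a b :: 'a assume ab: "norm a \<le> R" "norm b \<le> R" "norm (a - b) < \<delta>"
    have seg: "z \<in> cball 0 R \<and> dist z b < \<delta>" if z: "z \<in> closed_segment b a" for z
    proof
      show "z \<in> cball 0 R" using z ab closed_segment_subset[of b "cball 0 R" a] by auto
      have "norm (z - b) \<le> norm (a - b)" using segment_bound(1)[OF z] by (simp add: norm_minus_commute)
      then show "dist z b < \<delta>" using ab by (simp add: dist_norm)
    qed
    have "norm (f a - f b - blinfun_apply (f' b) (a - b)) \<le> norm (a - b) * \<kappa>"
    proof (rule differentiable_bound_linearization[where S="closed_segment b a" and f'="\<lambda>x. blinfun_apply (f' x)"])
      show "b + t *\<^sub>R (a - b) \<in> closed_segment b a" if "t \<in> {0..1}" for t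
        using that by (auto simp: closed_segment_def algebra_simps intro!: exI[of _ t])
      show "(f has_derivative blinfun_apply (f' x)) (at x within closed_segment b a)" for x
        by (rule has_derivative_at_withinI[OF der_f])
      fix x assume x: "x \<in> closed_segment b a"
      have "dist (f' x) (f' b) < \<kappa>" using \<delta>(2)[of x b] seg[OF x] ab by auto
      then show "onorm (blinfun_apply (f' x) - blinfun_apply (f' b)) \<le> \<kappa>"
        by (simp add: dist_norm norm_blinfun.rep_eq minus_blinfun.rep_eq fun_diff_def)
    qed auto
    then show "norm (f a - f b - blinfun_apply (f' b) (a - b)) \<le> \<kappa> * norm (a - b)" by (simp add: mult.commute)
  qed
qed

definition linear_solution :: "(real \<Rightarrow> 'a) \<Rightarrow> (real \<Rightarrow> 'a) \<Rightarrow> bool" where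
  "linear_solution u y \<longleftrightarrow> ode_solution (\<lambda>t v. blinfun_apply (f' (u t)) v + g t (u t) 0) {0..T} y"

text \<open>The threshold \<open>\<epsilon>0\<close> depends on neither the solution nor the base time \<open>s\<close>; compactness arguments over the
  cycle rest on this.\<close>

lemma first_order_expansion:
  assumes \<kappa>: "0 < \<kappa>" "\<kappa> \<le> 1"
  obtains \<epsilon>0 where "0 < \<epsilon>0" "\<epsilon>0 \<le> 1"
    "\<forall>\<epsilon> x u y s t. 0 < \<epsilon> \<longrightarrow> \<epsilon> \<le> \<epsilon>0 \<longrightarrow> approx_solution \<epsilon> \<kappa> x \<longrightarrow> ode_solution (\<lambda>_. f) {0..T} u \<longrightarrow>
      (\<forall>t\<in>{0..T}. norm (u t) + 1 \<le> R) \<longrightarrow> linear_solution u y \<longrightarrow> s \<in> {0..T} \<longrightarrow> x s = u s \<longrightarrow> y s = 0 \<longrightarrow>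
      t \<in> {0..T} \<longrightarrow> norm (x t - u t - \<epsilon> *\<^sub>R y t) \<le> \<epsilon> * (\<kappa> * C1)"
proof -
  \<comment> \<open>\<open>x - u\<close> will have norm at most \<open>\<epsilon> * C0\<close>, so a
    remainder of relative size \<open>\<kappa> / C0\<close> is at most
    \<open>\<epsilon> * \<kappa>\<close>.\<close>
  obtain \<delta>1 where \<delta>1: "0 < \<delta>1" "\<And>a b. norm a \<le> R \<Longrightarrow> norm b \<le> R \<Longrightarrow> norm (a - b) < \<delta>1 \<Longrightarrow>
     norm (f a - f b - blinfun_apply (f' b) (a - b)) \<le> \<kappa> / C0 * norm (a - b)"
    using uniform_linearization[of "\<kappa> / C0"] \<kappa> C0_pos by (metis divide_pos_pos)
  have "uniformly_continuous_on ({0..T} \<times> cball 0 R \<times> {0..1}) (\<lambda>z. g (fst z) (fst (snd z)) (snd (snd z)))"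
    by (intro compact_uniformly_continuous continuous_intros compact_Times) auto
  then obtain \<delta>2 where \<delta>2: "0 < \<delta>2" "\<And>z z'. z \<in> {0..T} \<times> cball 0 R \<times> {0..1} \<Longrightarrow> z' \<in> {0..T} \<times> cball 0 R \<times> {0..1} \<Longrightarrow> dist z z' < \<delta>2 \<Longrightarrow>
     dist (g (fst z) (fst (snd z)) (snd (snd z))) (g (fst z') (fst (snd z')) (snd (snd z'))) < \<kappa>"
    using \<kappa> unfolding uniformly_continuous_on_def by metis
  have g_close: "norm (g t a \<epsilon> - g t b 0) \<le> \<kappa>"
    if "t \<in> {0..T}" "norm a \<le> R" "norm b \<le> R" "norm (a - b) < \<delta>2 / 2" "0 \<le> \<epsilon>" "\<epsilon> \<le> 1" "\<epsilon> < \<delta>2 / 2" for t a b \<epsilon>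
  proof -
    have "dist (t, a, \<epsilon>) (t, b, 0) = dist (a, \<epsilon>) (b, 0)" by (simp add: dist_Pair_Pair)
    also have "\<dots> \<le> dist a b + dist \<epsilon> 0" by (simp add: dist_Pair_Pair order_trans[OF sqrt_sum_squares_le_sum_abs])
    also have "\<dots> < \<delta>2" using that by (simp add: dist_norm)
    finally have "dist (t, a, \<epsilon>) (t, b, 0) < \<delta>2" .
    from \<delta>2(2)[OF _ _ this] that show ?thesis by (simp add: dist_norm)
  qed
  \<comment> \<open>Keeps \<open>\<epsilon> * C0\<close> at most 1, so that \<open>x\<close> stays
    in the ball, and below \<open>\<delta>1\<close> and \<open>\<delta>2 / 2\<close>, the ranges of
    the two continuity estimates; \<epsilon> itself is a variable of \<open>g\<close> and stays
    below \<open>\<delta>2 / 2\<close>.\<close>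
  define \<epsilon>0 where "\<epsilon>0 = min (1/2) (min (1 / C0) (min (\<delta>1 / (2 * C0)) (min (\<delta>2 / 4) (\<delta>2 / (4 * C0)))))"
  have e0: "0 < \<epsilon>0" "\<epsilon>0 \<le> 1" using C0_pos \<delta>1 \<delta>2 by (auto simp: \<epsilon>0_def)
  show ?thesis
  proof (rule that[OF e0], intro allI impI)
    fix \<epsilon> x u y s t
    assume \<epsilon>: "0 < \<epsilon>" "\<epsilon> \<le> \<epsilon>0" and x: "approx_solution \<epsilon> \<kappa> x" and u: "ode_solution (\<lambda>_. f) {0..T} u"
      and uR0: "\<forall>t\<in>{0..T}. norm (u t) + 1 \<le> R" and y: "linear_solution u y"
      and s: "s \<in> {0..T}" "x s = u s" "y s = 0" and t: "t \<in> {0..T}"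
    have uR: "norm (u r) + 1 \<le> R" if "r \<in> {0..T}" for r using uR0 that by blast
    have e: "\<epsilon> * C0 \<le> 1" "\<epsilon> * C0 < \<delta>1" "\<epsilon> * C0 < \<delta>2 / 2" "\<epsilon> < \<delta>2 / 2" "\<epsilon> \<le> 1"
    proof -
      have "\<epsilon> \<le> 1 / C0" "\<epsilon> \<le> \<delta>1 / (2 * C0)" "\<epsilon> \<le> \<delta>2 / 4" "\<epsilon> \<le> \<delta>2 / (4 * C0)" "\<epsilon> \<le> 1/2" using \<epsilon> by (auto simp: \<epsilon>0_def)
      then show "\<epsilon> * C0 \<le> 1" "\<epsilon> * C0 < \<delta>1" "\<epsilon> * C0 < \<delta>2 / 2" "\<epsilon> < \<delta>2 / 2" "\<epsilon> \<le> 1"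
        using C0_pos \<delta>1(1) \<delta>2(1) by (auto simp: field_simps)
    qed
    have u': "(u has_vector_derivative f (u r)) (at r within {0..T})" if "r \<in> {0..T}" for r
      using u that unfolding ode_solution_def by blast
    have y': "(y has_vector_derivative blinfun_apply (f' (u r)) (y r) + g r (u r) 0) (at r within {0..T})" if "r \<in> {0..T}" for r
      using y that unfolding linear_solution_def ode_solution_def by blast
    have uR': "norm (u r) \<le> R" if "r \<in> {0..T}" for r using uR[OF that] by simp
    have xu: "norm (x r - u r) \<le> \<epsilon> * C0" if r: "r \<in> {0..T}" for r
      using approx_solution_dist[OF x _ _ e(5) \<kappa>(2) s(1) r, of u] u' uR' \<epsilon> s(2) by (simp add: fh_eq)
    have xR: "norm (x r) \<le> R" if r: "r \<in> {0..T}" for r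
    proof -
      have "norm (x r) \<le> norm (x r - u r) + norm (u r)" by norm
      then show ?thesis using xu[OF r] uR[OF r] e(1) by linarith
    qed
    obtain d where d: "\<And>t. t \<in> {0..T} \<Longrightarrow> (x has_vector_derivative d t) (at t within {0..T})"
      "\<And>t. t \<in> {0..T} \<Longrightarrow> norm (d t - (fh (x t) + \<epsilon> *\<^sub>R g t (pr (x t)) \<epsilon>)) \<le> \<epsilon> * \<kappa>"
      using x unfolding approx_solution_def by metis
    define e' where "e' r = d r - f (u r) - \<epsilon> *\<^sub>R (blinfun_apply (f' (u r)) (y r) + g r (u r) 0)" for r
    have "norm (x t - u t - \<epsilon> *\<^sub>R y t) \<le> (norm (x s - u s - \<epsilon> *\<^sub>R y s) + (\<epsilon> * (3 * \<kappa>)) * \<bar>t - s\<bar>) * exp (L * \<bar>t - s\<bar>)"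
    proof (rule gronwall[where e'=e' and a=0 and b=T])
      show "((\<lambda>t. x t - u t - \<epsilon> *\<^sub>R y t) has_vector_derivative e' r) (at r within {0..T})" if "r \<in> {0..T}" for r
        unfolding e'_def by (rule derivative_eq_intros d(1) u' y' that refl | simp)+
      fix r assume r: "r \<in> {0..T}"
      let ?A = "blinfun_apply (f' (u r))"
      have lin: "?A (x r - u r - \<epsilon> *\<^sub>R y r) = ?A (x r - u r) - \<epsilon> *\<^sub>R ?A (y r)"
        by (simp add: blinfun.diff_right blinfun.scaleR_right)
      have "e' r = (d r - (f (x r) + \<epsilon> *\<^sub>R g r (x r) \<epsilon>)) + (f (x r) - f (u r) - ?A (x r - u r))
         + ?A (x r - u r - \<epsilon> *\<^sub>R y r) + \<epsilon> *\<^sub>R (g r (x r) \<epsilon> - g r (u r) 0)"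
        unfolding e'_def lin by (simp add: algebra_simps)
      also have "norm \<dots> \<le> \<epsilon> * \<kappa> + \<epsilon> * \<kappa> + L * norm (x r - u r - \<epsilon> *\<^sub>R y r) + \<epsilon> * \<kappa>"
      proof (intro norm_triangle_le add_mono)
        show "norm (d r - (f (x r) + \<epsilon> *\<^sub>R g r (x r) \<epsilon>)) \<le> \<epsilon> * \<kappa>"
          using d(2)[OF r] by (simp add: fh_eq pr_eq xR[OF r])
        have "norm (f (x r) - f (u r) - ?A (x r - u r)) \<le> \<kappa> / C0 * norm (x r - u r)"
          using xu[OF r] e by (intro \<delta>1(2) xR uR' r) auto
        also have "\<dots> \<le> \<kappa> / C0 * (\<epsilon> * C0)" using xu[OF r] \<kappa> C0_pos by (intro mult_left_mono) auto
        finally show "norm (f (x r) - f (u r) - ?A (x r - u r)) \<le> \<epsilon> * \<kappa>" using C0_pos by (simp add: mult.commute)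
        have "norm (?A (x r - u r - \<epsilon> *\<^sub>R y r)) \<le> norm (f' (u r)) * norm (x r - u r - \<epsilon> *\<^sub>R y r)" by (rule norm_blinfun)
        also have "\<dots> \<le> L * norm (x r - u r - \<epsilon> *\<^sub>R y r)" using L_f'[OF uR'[OF r]] by (intro mult_right_mono) auto
        finally show "norm (?A (x r - u r - \<epsilon> *\<^sub>R y r)) \<le> L * norm (x r - u r - \<epsilon> *\<^sub>R y r)" .
        have "norm (g r (x r) \<epsilon> - g r (u r) 0) \<le> \<kappa>"
          using xu[OF r] e \<epsilon> by (intro g_close r xR uR') auto
        then show "norm (\<epsilon> *\<^sub>R (g r (x r) \<epsilon> - g r (u r) 0)) \<le> \<epsilon> * \<kappa>" using \<epsilon> by (simp add: mult_left_mono)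
      qed
      finally show "norm (e' r) \<le> L * norm (x r - u r - \<epsilon> *\<^sub>R y r) + \<epsilon> * (3 * \<kappa>)" by simp
    qed (use L_pos \<epsilon> \<kappa> s t in auto)
    also have "\<dots> = \<epsilon> * (3 * \<kappa>) * \<bar>t - s\<bar> * exp (L * \<bar>t - s\<bar>)" using s by simp
    also have "\<dots> \<le> \<epsilon> * (3 * \<kappa>) * T * exp (L * T)"
    proof (intro mult_mono order_refl)
      show "\<bar>t - s\<bar> \<le> T" using s t by auto
      then show "exp (L * \<bar>t - s\<bar>) \<le> exp (L * T)" using L_pos by simp
    qed (use \<kappa> \<epsilon> T_pos in auto)
    finally show "norm (x t - u t - \<epsilon> *\<^sub>R y t) \<le> \<epsilon> * (\<kappa> * C1)" by (simp add: C1_def mult_ac)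
  qed
qed

end

section \<open>Periodic extension and compactness of approximate solutions\<close>

lemma periodic_extension:
  fixes x :: "real \<Rightarrow> 'a::real_normed_vector"
  assumes T: "0 < T" and x: "ode_solution F {0..T} x" and per: "x 0 = x T"
    and F: "\<And>t v. F (t + T) v = F t v"
  obtains X where "periodic_solution T F X" "\<And>t. t \<in> {0..T} \<Longrightarrow> X t = x t"
proof -
  have Fint: "F (t + of_int k * T) v = F t v" for t v and k :: int
    by (rule periodic_shift_int[of "\<lambda>t. F t v"]) (rule F)
  define X where "X t = x (t - of_int \<lfloor>t / T\<rfloor> * T)" for t
  \<comment> \<open>At the right end of a period the floor has already moved on to the next index;
    \<open>x 0 = x T\<close> makes both formulas agree.\<close>
  have X: "X t = x (t - of_int k * T)" if "t \<in> {of_int k * T..of_int (k + 1) * T}" for t and k :: int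
  proof (cases "t = of_int (k + 1) * T")
    case True
    then have "t / T = of_int (k + 1)" using T by simp
    then have "\<lfloor>t / T\<rfloor> = k + 1" by linarith
    then show ?thesis using True per by (simp add: X_def algebra_simps)
  next
    case False
    then have "of_int k \<le> t / T" "t / T < of_int k + 1" using that T by (auto simp: field_simps)
    then have "\<lfloor>t / T\<rfloor> = k" by linarith
    then show ?thesis by (simp add: X_def)
  qed
  have dX: "(X has_vector_derivative F t (X t)) (at t within {of_int k * T..of_int (k + 1) * T})"
    if t: "t \<in> {of_int k * T..of_int (k + 1) * T}" for t and k :: int
  proof -
    have img: "(\<lambda>t. t - of_int k * T) ` {of_int k * T..of_int (k + 1) * T} = {0..T}"
      using image_add_atLeastAtMost[of "- of_int k * T" "of_int k * T" "of_int (k + 1) * T"] by (simp add: algebra_simps)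
    have "((x \<circ> (\<lambda>t. t - of_int k * T)) has_vector_derivative 1 *\<^sub>R F (t - of_int k * T) (x (t - of_int k * T)))
      (at t within {of_int k * T..of_int (k + 1) * T})"
    proof (rule vector_diff_chain_within)
      show "((\<lambda>t. t - of_int k * T) has_vector_derivative 1) (at t within {of_int k * T..of_int (k + 1) * T})"
        by (auto intro!: derivative_eq_intros)
      have "t - of_int k * T \<in> {0..T}" using t by (auto simp: algebra_simps)
      then show "(x has_vector_derivative F (t - of_int k * T) (x (t - of_int k * T)))
         (at (t - of_int k * T) within (\<lambda>t. t - of_int k * T) ` {of_int k * T..of_int (k + 1) * T})"
        unfolding img using x by (simp add: ode_solution_def)
    qed
    then have "((\<lambda>t. x (t - of_int k * T)) has_vector_derivative F t (X t)) (at t within {of_int k * T..of_int (k + 1) * T})"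
      using Fint[of "t - of_int k * T" k] X[OF t] by (simp add: o_def)
    then show ?thesis
      by (rule has_vector_derivative_transform[OF t, rotated]) (rule X)
  qed
  have "(X has_vector_derivative F t (X t)) (at t)" for t
  proof -
    define k where "k = \<lfloor>t / T\<rfloor>"
    have "of_int k \<le> t / T" "t / T < of_int k + 1" unfolding k_def by linarith+
    then have k: "of_int k * T \<le> t" "t < of_int (k + 1) * T" using T by (auto simp: field_simps)
    show ?thesis
    proof (cases "t = of_int k * T")
      case False
      then have i: "t \<in> interior {of_int k * T..of_int (k + 1) * T}" using k by (simp add: interior_atLeastAtMost_real)
      show ?thesis using dX[of t k] at_within_interior[OF i] k by simp
    next
      case True
      \<comment> \<open>At a junction the two one-sided derivatives coincide, and the union of the
        adjacent periods is a neighbourhood of the point.\<close>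
      have 1: "(X has_vector_derivative F t (X t)) (at t within {of_int k * T..of_int (k + 1) * T})" using dX[of t k] k by simp
      have "t \<in> {of_int (k - 1) * T..of_int (k - 1 + 1) * T}" using True T by (auto simp: algebra_simps)
      then have 2: "(X has_vector_derivative F t (X t)) (at t within {of_int (k - 1) * T..of_int (k - 1 + 1) * T})" by (rule dX)
      have un: "{of_int k * T..of_int (k + 1) * T} \<union> {of_int (k - 1) * T..of_int (k - 1 + 1) * T} = {of_int (k - 1) * T..of_int (k + 1) * T}"
        using T by (auto simp: algebra_simps)
      have "(X has_vector_derivative F t (X t)) (at t within {of_int (k - 1) * T..of_int (k + 1) * T})"
        using 1 2 unfolding has_vector_derivative_def has_derivative_within un[symmetric] by (auto intro: Lim_Un)
      moreover have "t \<in> interior {of_int (k - 1) * T..of_int (k + 1) * T}"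
        using True T by (simp add: interior_atLeastAtMost_real algebra_simps)
      ultimately show ?thesis using at_within_interior by metis
    qed
  qed
  moreover have "X (t + T) = X t" for t
  proof -
    have "\<lfloor>(t + T) / T\<rfloor> = \<lfloor>t / T\<rfloor> + 1" using T by (simp add: add_divide_distrib)
    then show ?thesis by (simp add: X_def algebra_simps)
  qed
  ultimately have "periodic_solution T F X" by (simp add: periodic_solution_def ode_solution_def)
  moreover have "X t = x t" if "t \<in> {0..T}" for t using X[of t 0] that by simp
  ultimately show ?thesis using that by blast
qed

context truncated_system
begin

text \<open>For a merely continuous \<open>g\<close> a value need not determine the solution, so a
  displacement might not be well defined. A polynomial within \<kappa> of \<open>g\<close> on the
  ball is Lipschitz there, and solutions become unique and continuous in their value at time
  \<open>T\<close>.\<close>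

lemma approx_solution_map:
  assumes \<epsilon>: "0 < \<epsilon>" "\<epsilon> \<le> 1" and \<kappa>: "0 < \<kappa>"
  obtains X where "\<And>v. approx_solution \<epsilon> \<kappa> (X v)" "\<And>v. X v T = v" "continuous_on UNIV (\<lambda>v. X v 0)"
proof -
  have cpt: "compact ({0..T} \<times> cball (0::'a) R)" by (intro compact_Times) auto
  have cvx: "convex ({0..T} \<times> cball (0::'a) R)" by (intro convex_Times) auto
  have cg: "continuous_on ({0..T} \<times> cball 0 R) (\<lambda>z. g (fst z) (snd z) \<epsilon>)"
    using \<epsilon> by (intro continuous_intros) auto
  obtain q :: "real \<times> 'a \<Rightarrow> 'a" where q: "polynomial_function q"
    "\<forall>z\<in>{0..T} \<times> cball 0 R. norm (g (fst z) (snd z) \<epsilon> - q z) < \<kappa>"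
    using Stone_Weierstrass_polynomial_function[OF cpt cg \<kappa>] by (elim exE conjE)
  obtain q' :: "real \<times> 'a \<Rightarrow> (real \<times> 'a) \<Rightarrow>\<^sub>L 'a"
    where q': "continuous_on UNIV q'" "\<And>x. (q has_derivative blinfun_apply (q' x)) (at x)"
    using polynomial_function_C1[OF q(1)] by blast
  define K where "K = {0..T} \<times> cball (0::'a) R"
  have "\<exists>M>0. \<forall>z\<in>K. \<forall>z'\<in>K. norm (q z - q z') \<le> M * norm (z - z')"
  proof (rule C1_lipschitz_on_compact[OF q'(2,1) cpt cvx, folded K_def])
    fix M assume "0 < M" "\<And>x y. x \<in> K \<Longrightarrow> y \<in> K \<Longrightarrow> norm (q x - q y) \<le> M * norm (x - y)"
    then show ?thesis by (intro exI[of _ M] conjI ballI)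
  qed
  then obtain M where M: "0 < M" "\<And>z z'. z \<in> K \<Longrightarrow> z' \<in> K \<Longrightarrow> norm (q z - q z') \<le> M * norm (z - z')"
    by blast
  define F where "F t x = fh x + \<epsilon> *\<^sub>R q (t, pr x)" for t x
  have Flip: "norm (F t x - F t y) \<le> (L + M) * norm (x - y)" if t: "t \<in> {0..T}" for t x y
  proof -
    have "norm (q (t, pr x) - q (t, pr y)) \<le> M * norm ((t, pr x) - (t, pr y))"
      using t norm_pr by (intro M(2)) (auto simp: K_def)
    also have "norm ((t, pr x) - (t, pr y)) = norm (pr x - pr y)" by (simp add: norm_Pair)
    also have "M * norm (pr x - pr y) \<le> M * norm (x - y)" using pr_lipschitz M(1) by simp
    finally have "\<epsilon> * norm (q (t, pr x) - q (t, pr y)) \<le> 1 * (M * norm (x - y))" using \<epsilon> by (intro mult_mono) auto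
    then have "norm (\<epsilon> *\<^sub>R (q (t, pr x) - q (t, pr y))) \<le> M * norm (x - y)" using \<epsilon> by simp
    moreover have "F t x - F t y = (fh x - fh y) + \<epsilon> *\<^sub>R (q (t, pr x) - q (t, pr y))" by (simp add: F_def algebra_simps)
    ultimately show ?thesis
      using norm_triangle_ineq[of "fh x - fh y" "\<epsilon> *\<^sub>R (q (t, pr x) - q (t, pr y))"] lip[of x y] by (simp add: distrib_right)
  qed
  have "continuous_on ({0..T} \<times> UNIV) (\<lambda>z. F (fst z) (snd z))" unfolding F_def
    by (intro continuous_intros continuous_on_compose2[OF continuous_F] continuous_on_compose2[OF continuous_on_polymonial_function[OF q(1)]]) auto
  then have Fcont: "continuous_on ({0..T} \<times> UNIV) (\<lambda>(t, x). F t x)" by (simp add: split_def)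
  have "\<exists>x. x T = v \<and> (\<forall>t\<in>{0..T}. (x has_vector_derivative F t (x t)) (at t within {0..T}))" for v
    by (rule picard[OF _ Fcont Flip, where ?t0.0=T and ?x0.0=v]) (use T_pos L_pos M in auto)
  then obtain X where X: "\<And>v. X v T = v" "\<And>v t. t \<in> {0..T} \<Longrightarrow> (X v has_vector_derivative F t (X v t)) (at t within {0..T})"
    by metis
  have "approx_solution \<epsilon> \<kappa> (X v)" for v unfolding approx_solution_def
  proof
    fix t assume t: "t \<in> {0..T}"
    have "F t (X v t) - (fh (X v t) + \<epsilon> *\<^sub>R g t (pr (X v t)) \<epsilon>) = \<epsilon> *\<^sub>R (q (t, pr (X v t)) - g t (pr (X v t)) \<epsilon>)"
      by (simp add: F_def algebra_simps)
    moreover have "norm (q (t, pr (X v t)) - g t (pr (X v t)) \<epsilon>) \<le> \<kappa>"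
      using q(2)[rule_format, of "(t, pr (X v t))"] t norm_pr by (simp add: norm_minus_commute less_imp_le)
    ultimately have "norm (F t (X v t) - (fh (X v t) + \<epsilon> *\<^sub>R g t (pr (X v t)) \<epsilon>)) \<le> \<epsilon> * \<kappa>"
      using \<epsilon> by (simp add: mult_left_mono)
    then show "\<exists>d. (X v has_vector_derivative d) (at t within {0..T}) \<and>
        norm (d - (fh (X v t) + \<epsilon> *\<^sub>R g t (pr (X v t)) \<epsilon>)) \<le> \<epsilon> * \<kappa>" using X(2)[OF t] by blast
  qed
  moreover have "continuous_on UNIV (\<lambda>v. X v 0)"
  proof (rule lipschitz_on_continuous_on[where L="exp ((L + M) * T)"], rule lipschitz_onI)
    fix v w
    have "norm (X v 0 - X w 0) \<le> (norm (X v T - X w T) + 0 * \<bar>0 - T\<bar>) * exp ((L + M) * \<bar>0 - T\<bar>)"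
    proof (rule gronwall[where e="\<lambda>t. X v t - X w t" and e'="\<lambda>t. F t (X v t) - F t (X w t)" and a=0 and b=T])
      show "((\<lambda>t. X v t - X w t) has_vector_derivative F r (X v r) - F r (X w r)) (at r within {0..T})" if "r \<in> {0..T}" for r
        by (intro derivative_intros X that)
      show "norm (F r (X v r) - F r (X w r)) \<le> (L + M) * norm (X v r - X w r) + 0" if "r \<in> {0..T}" for r
        using Flip[OF that] by simp
    qed (use L_pos M T_pos in auto)
    then show "dist (X v 0) (X w 0) \<le> exp ((L + M) * T) * dist v w" using T_pos by (simp add: X dist_norm mult.commute)
  qed simp
  ultimately show ?thesis using that X(1) by blast
qed

lemma bounded_fh: obtains M where "0 < M" "\<And>x. norm (fh x) \<le> M"
proof -
  have "bounded (f ` cball 0 R)"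
    by (intro compact_imp_bounded compact_continuous_image has_derivative_continuous_on[of _ f "\<lambda>x. blinfun_apply (f' x)"])
      (auto intro: has_derivative_at_withinI[OF der_f])
  then obtain M where "0 < M" "\<And>x. x \<in> cball 0 R \<Longrightarrow> norm (f x) \<le> M" unfolding bounded_pos by auto
  then show ?thesis using that[of M] norm_pr by (simp add: fh_def)
qed

text \<open>Approximate solutions with defects tending to 0 are bounded and equi-Lipschitz, so
  Arzela-Ascoli gives a uniform limit, and the right-hand sides converge uniformly with it.
  Compactness of \<open>G\<close> bounds the end values and keeps their limit in
  \<open>G\<close>.\<close>

lemma exact_solution_from_approx:
  assumes \<epsilon>: "0 < \<epsilon>" "\<epsilon> \<le> 1" and G: "compact G"
    and ex: "\<And>\<kappa>. 0 < \<kappa> \<Longrightarrow> \<kappa> \<le> 1 \<Longrightarrow> \<exists>x. approx_solution \<epsilon> \<kappa> x \<and> x 0 = x T \<and> x T \<in> G"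
  shows "\<exists>x. approx_solution \<epsilon> 0 x \<and> x 0 = x T \<and> x T \<in> G"
proof -
  have "\<exists>x. approx_solution \<epsilon> (inverse (real (Suc n))) x \<and> x 0 = x T \<and> x T \<in> G" for n
    by (rule ex) (auto simp: field_simps)
  then obtain x where x: "\<And>n. approx_solution \<epsilon> (inverse (real (Suc n))) (x n)" "\<And>n. x n 0 = x n T" "\<And>n. x n T \<in> G" by metis
  define H where "H t z = fh z + \<epsilon> *\<^sub>R g t (pr z) \<epsilon>" for t z
  obtain d where d: "\<And>n t. t \<in> {0..T} \<Longrightarrow> (x n has_vector_derivative d n t) (at t within {0..T})"
    "\<And>n t. t \<in> {0..T} \<Longrightarrow> norm (d n t - H t (x n t)) \<le> \<epsilon> * inverse (real (Suc n))"
    using x(1) unfolding approx_solution_def H_def by metis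
  obtain Mf where Mf: "0 < Mf" "\<And>x. norm (fh x) \<le> Mf" using bounded_fh by blast
  \<comment> \<open>A common speed bound: the field, the perturbation, and a defect of at most
    1.\<close>
  define M where "M = Mf + B + 1"
  have M: "0 < M" using Mf B_pos by (simp add: M_def)
  have dM: "norm (d n t) \<le> M" if t: "t \<in> {0..T}" for n t
  proof -
    have "norm (d n t) \<le> norm (d n t - H t (x n t)) + norm (fh (x n t)) + norm (\<epsilon> *\<^sub>R g t (pr (x n t)) \<epsilon>)"
      unfolding H_def by (smt (verit) norm_triangle_ineq norm_triangle_sub)
    also have "\<dots> \<le> 1 + Mf + 1 * B"
    proof (intro add_mono Mf)
      have "\<epsilon> * inverse (real (Suc n)) \<le> 1 * 1" using \<epsilon> by (intro mult_mono) (auto simp: field_simps)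
      then show "norm (d n t - H t (x n t)) \<le> 1" using d(2)[OF t, of n] by simp
      have "\<epsilon> * norm (g t (pr (x n t)) \<epsilon>) \<le> 1 * B"
        using \<epsilon> B_g[OF t norm_pr, of \<epsilon>] by (intro mult_mono) auto
      then show "norm (\<epsilon> *\<^sub>R g t (pr (x n t)) \<epsilon>) \<le> 1 * B" using \<epsilon> by simp
    qed
    finally show ?thesis by (simp add: M_def)
  qed
  have lipx: "norm (x n s - x n t) \<le> M * norm (s - t)" if "s \<in> {0..T}" "t \<in> {0..T}" for n s t
  proof (rule differentiable_bound[where f'="\<lambda>t h. h *\<^sub>R d n t" and S="{0..T}"])
    show "(x n has_derivative (\<lambda>h. h *\<^sub>R d n r)) (at r within {0..T})" if "r \<in> {0..T}" for r
      using d(1)[OF that] by (simp add: has_vector_derivative_def)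
    show "onorm (\<lambda>h. h *\<^sub>R d n r) \<le> M" if "r \<in> {0..T}" for r
      using dM[OF that, of n] M by (intro onorm_le) (simp add: mult.commute[of M] mult_left_mono)
  qed (use that in auto)
  obtain G0 where G0: "\<And>z. z \<in> G \<Longrightarrow> norm z \<le> G0" using compact_imp_bounded[OF G] unfolding bounded_iff by blast
  have bnd: "norm (x n t) \<le> G0 + M * T" if t: "t \<in> {0..T}" for n t
  proof -
    have "norm (x n t) \<le> norm (x n t - x n T) + norm (x n T)" by norm
    also have "norm (x n t - x n T) \<le> M * norm (t - T)" using t T_pos by (intro lipx) auto
    also have "\<dots> \<le> M * T" using t M by (intro mult_left_mono) auto
    finally show ?thesis using G0[OF x(3)[of n]] by linarith
  qed
  obtain z k where z: "continuous_on {0..T} z" "strict_mono (k :: nat \<Rightarrow> nat)"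
    "\<And>e. 0 < e \<Longrightarrow> \<exists>N. \<forall>n t. N \<le> n \<and> t \<in> {0..T} \<longrightarrow> norm (x (k n) t - z t) < e"
  proof (rule Arzela_Ascoli[of "{0..T}" x "G0 + M * T"])
    fix t e :: real assume t: "t \<in> {0..T}" and e: "0 < e"
    show "\<exists>d>0. \<forall>n s. s \<in> {0..T} \<and> norm (t - s) < d \<longrightarrow> norm (x n t - x n s) < e"
    proof (intro exI[of _ "e / M"] conjI allI impI)
      fix n s assume s: "s \<in> {0..T} \<and> norm (t - s) < e / M"
      have "norm (x n t - x n s) \<le> M * norm (t - s)" using s t by (intro lipx) auto
      also have "\<dots> < M * (e / M)" using s M by (intro mult_strict_left_mono) auto
      finally show "norm (x n t - x n s) < e" using M by simp
    qed (use e M in simp)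
  qed (use bnd in auto)
  have lim: "(\<lambda>n. x (k n) t) \<longlonglongrightarrow> z t" if t: "t \<in> {0..T}" for t
  proof (rule LIMSEQ_I)
    fix e :: real assume "0 < e"
    from z(3)[OF this] t show "\<exists>no. \<forall>n\<ge>no. norm (x (k n) t - z t) < e" by blast
  qed
  have zb: "norm (z t) \<le> G0 + M * T" if t: "t \<in> {0..T}" for t
    by (rule Lim_norm_ubound[OF _ lim[OF t]]) (use bnd[OF t] in auto)
  have ucH: "uniformly_continuous_on ({0..T} \<times> cball 0 (G0 + M * T)) (\<lambda>p. H (fst p) (snd p))"
    unfolding H_def using \<epsilon> by (intro compact_uniformly_continuous compact_Times continuous_intros continuous_on_compose2[OF continuous_F]) auto
  have uc: "\<exists>\<delta>>0. \<forall>t\<in>{0..T}. \<forall>a\<in>cball 0 (G0 + M * T). \<forall>b\<in>cball 0 (G0 + M * T). dist a b < \<delta> \<longrightarrow> dist (H t a) (H t b) < e" if e: "0 < e" for e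
  proof -
    obtain \<delta> where "0 < \<delta>" "\<And>p q. p \<in> {0..T} \<times> cball 0 (G0 + M * T) \<Longrightarrow> q \<in> {0..T} \<times> cball 0 (G0 + M * T) \<Longrightarrow> dist p q < \<delta> \<Longrightarrow>
       dist (H (fst p) (snd p)) (H (fst q) (snd q)) < e"
      using ucH e unfolding uniformly_continuous_on_def by metis
    from this(1) this(2)[of "(_, _)" "(_, _)"] show ?thesis by (intro exI[of _ \<delta>]) (auto simp: dist_Pair_Pair)
  qed
  have "\<exists>g. \<forall>t\<in>{0..T}. (\<lambda>n. x (k n) t) \<longlonglongrightarrow> g t \<and> (g has_derivative (\<lambda>h. h *\<^sub>R H t (z t))) (at t within {0..T})"
  proof (rule has_derivative_sequence[where f'="\<lambda>n t h. h *\<^sub>R d (k n) t" and ?x0.0=0 and l="z 0"])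
    fix e :: real assume e: "0 < e"
    obtain \<delta> where \<delta>: "0 < \<delta>" "\<And>t a b. t \<in> {0..T} \<Longrightarrow> a \<in> cball 0 (G0 + M * T) \<Longrightarrow> b \<in> cball 0 (G0 + M * T) \<Longrightarrow> dist a b < \<delta> \<Longrightarrow> dist (H t a) (H t b) < e / 2"
      using uc[of "e / 2"] e by (metis half_gt_zero)
    obtain N1 where N1: "\<And>n t. N1 \<le> n \<Longrightarrow> t \<in> {0..T} \<Longrightarrow> norm (x (k n) t - z t) < \<delta>" using z(3)[OF \<delta>(1)] by blast
    obtain N2 where N2: "inverse (real (Suc N2)) < e / 2" using reals_Archimedean[of "e / 2"] e by auto
    have close: "norm (d (k n) t - H t (z t)) \<le> e" if n: "max N1 N2 \<le> n" and t: "t \<in> {0..T}" for n t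
    proof -
      have "norm (d (k n) t - H t (z t)) \<le> norm (d (k n) t - H t (x (k n) t)) + norm (H t (x (k n) t) - H t (z t))" by norm
      moreover have "norm (H t (x (k n) t) - H t (z t)) < e / 2"
        using \<delta>(2)[OF t, of "x (k n) t" "z t"] N1[of n t] n t bnd[OF t] zb[OF t] by (simp add: dist_norm)
      moreover have "norm (d (k n) t - H t (x (k n) t)) \<le> e / 2"
      proof -
        have "N2 \<le> k n" using n seq_suble[OF z(2), of n] by simp
        then have "inverse (real (Suc (k n))) \<le> inverse (real (Suc N2))" by (simp add: field_simps)
        then have "\<epsilon> * inverse (real (Suc (k n))) \<le> 1 * inverse (real (Suc N2))" using \<epsilon> by (intro mult_mono) auto
        then show ?thesis using d(2)[OF t, of "k n"] N2 by linarith
      qed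
      ultimately show ?thesis by linarith
    qed
    show "\<forall>\<^sub>F n in sequentially. \<forall>t\<in>{0..T}. \<forall>h. norm (h *\<^sub>R d (k n) t - h *\<^sub>R H t (z t)) \<le> e * norm h"
      unfolding eventually_sequentially
    proof (intro exI[of _ "max N1 N2"] allI impI ballI)
      fix n t and h :: real assume "max N1 N2 \<le> n" "t \<in> {0..T}"
      then show "norm (h *\<^sub>R d (k n) t - h *\<^sub>R H t (z t)) \<le> e * norm h"
        using close by (simp add: scaleR_diff_right[symmetric] mult.commute[of e] mult_left_mono)
    qed
  qed (use d(1) lim T_pos in \<open>auto simp: has_vector_derivative_def\<close>)
  then obtain y where y: "\<And>t. t \<in> {0..T} \<Longrightarrow> (\<lambda>n. x (k n) t) \<longlonglongrightarrow> y t"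
    "\<And>t. t \<in> {0..T} \<Longrightarrow> (y has_vector_derivative H t (z t)) (at t within {0..T})"
    unfolding has_vector_derivative_def by blast
  have yz: "y t = z t" if "t \<in> {0..T}" for t using LIMSEQ_unique[OF y(1)[OF that] lim[OF that]] .
  have "approx_solution \<epsilon> 0 y" unfolding approx_solution_def
  proof
    fix t assume t: "t \<in> {0..T}"
    show "\<exists>d. (y has_vector_derivative d) (at t within {0..T}) \<and> norm (d - (fh (y t) + \<epsilon> *\<^sub>R g t (pr (y t)) \<epsilon>)) \<le> \<epsilon> * 0"
      using y(2)[OF t] yz[OF t] by (intro exI[of _ "H t (z t)"]) (simp add: H_def)
  qed
  moreover have "y 0 = y T"
  proof (rule LIMSEQ_unique)
    show "(\<lambda>n. x (k n) 0) \<longlonglongrightarrow> y 0" using y(1)[of 0] T_pos by simp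
    show "(\<lambda>n. x (k n) 0) \<longlonglongrightarrow> y T" unfolding x(2) using y(1)[of T] T_pos by simp
  qed
  moreover have "y T \<in> G"
    by (rule closed_sequentially[OF compact_imp_closed[OF G] _ y(1)]) (use x(3) T_pos in auto)
  ultimately show ?thesis by blast
qed

section \<open>The linearized solutions and continuity of Phi\<close>

lemma flow_ode_solution:
  assumes "\<And>t. t \<in> {0..T} \<Longrightarrow> norm (flow t \<xi>) \<le> R"
  shows "ode_solution (\<lambda>_. f) {0..T} (\<lambda>t. flow t \<xi>)"
  unfolding ode_solution_def
proof
  fix t assume "t \<in> {0..T}"
  then show "((\<lambda>t. flow t \<xi>) has_vector_derivative f (flow t \<xi>)) (at t within {0..T})"
    using flow_deriv[of \<xi> t "{0..T}"] fh_eq[OF assms] by simp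
qed

text \<open>\<open>Omega\<close> is a chosen solution of the original system. While the truncated
  flow stays in the ball it solves the same problem, and uniqueness identifies both.\<close>

lemma Omega_eq_flow:
  assumes "\<And>t. t \<in> {0..T} \<Longrightarrow> norm (flow t \<xi>) \<le> R" "t \<in> {0..T}"
  shows "Omega f T t 0 \<xi> = flow t \<xi>"
proof -
  let ?P = "\<lambda>x. ode_solution (\<lambda>_. f) {0..T} x \<and> x 0 = \<xi>"
  have "\<exists>x. ?P x" using flow_ode_solution[OF assms(1)] by (intro exI[of _ "\<lambda>t. flow t \<xi>"]) simp
  then have P: "?P (SOME x. ?P x)" by (rule someI_ex)
  have "(SOME x. ?P x) t = flow t \<xi>"
  proof (rule C1_solution_unique[OF der_f cont_f', where s=0 and a=0 and b=T])
    show "((SOME x. ?P x) has_vector_derivative f ((SOME x. ?P x) r)) (at r within {0..T})" if "r \<in> {0..T}" for r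
      using P that unfolding ode_solution_def by blast
    show "((\<lambda>t. flow t \<xi>) has_vector_derivative f (flow r \<xi>)) (at r within {0..T})" if "r \<in> {0..T}" for r
      using flow_ode_solution[OF assms(1)] that unfolding ode_solution_def by blast
  qed (use assms(2) T_pos P in auto)
  then show ?thesis by (simp add: Omega_def)
qed

lemma linear_field_bound:
  assumes "norm (u t) \<le> R"
  shows "norm (blinfun_apply (f' (u t)) v) \<le> L * norm v"
  using norm_blinfun[of "f' (u t)" v] mult_right_mono[OF L_f'[OF assms] norm_ge_zero[of v]] by linarith

lemma linear_solution_exists:
  assumes u: "continuous_on {0..T} u" "\<And>t. t \<in> {0..T} \<Longrightarrow> norm (u t) \<le> R" and s: "s \<in> {0..T}"
  shows "\<exists>y. linear_solution u y \<and> y s = 0"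
proof -
  let ?F = "\<lambda>t v. blinfun_apply (f' (u t)) v + g t (u t) 0"
  have "continuous_on ({0..T} \<times> UNIV) (\<lambda>z. ?F (fst z) (snd z))"
    by (intro continuous_intros continuous_on_compose2[OF cont_f'] continuous_on_compose2[OF u(1)]) auto
  then have c: "continuous_on ({0..T} \<times> UNIV) (\<lambda>(t, v). ?F t v)" by (simp add: split_def)
  have lip: "norm (?F t x - ?F t y) \<le> L * norm (x - y)" if "t \<in> {0..T}" for t x y
    using linear_field_bound[of u t "x - y", OF u(2)[OF that]] by (simp add: blinfun.diff_right)
  show ?thesis
  proof (rule picard[OF s c lip L_pos, where ?x0.0=0])
    fix y assume "y s = 0" "\<And>t. t \<in> {0..T} \<Longrightarrow> (y has_vector_derivative ?F t (y t)) (at t within {0..T})"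
    then show ?thesis unfolding linear_solution_def ode_solution_def by blast
  qed
qed

lemma eta_linear_solution:
  assumes \<xi>: "\<And>t. t \<in> {0..T} \<Longrightarrow> norm (flow t \<xi>) \<le> R" and s: "s \<in> {0..T}"
  shows "linear_solution (\<lambda>t. flow t \<xi>) (\<lambda>t. eta f f' g T t s \<xi>)" and "eta f f' g T s s \<xi> = 0"
proof -
  \<comment> \<open>The equivalence holds for every \<open>y\<close>, because the equation is posed
    on \<open>{0..T}\<close> only; hence the two choice operators select the same function.\<close>
  have eq: "ode_solution (\<lambda>t v. blinfun_apply (f' (Omega f T t 0 \<xi>)) v + g t (Omega f T t 0 \<xi>) 0) {0..T} y
     \<longleftrightarrow> linear_solution (\<lambda>t. flow t \<xi>) y" for y
    unfolding linear_solution_def ode_solution_def using Omega_eq_flow[OF \<xi>] by simp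
  have "\<exists>y. linear_solution (\<lambda>t. flow t \<xi>) y \<and> y s = 0"
    by (rule linear_solution_exists[OF _ \<xi> s]) (auto intro!: continuous_intros)
  from someI_ex[OF this]
  have "linear_solution (\<lambda>t. flow t \<xi>) (SOME y. linear_solution (\<lambda>t. flow t \<xi>) y \<and> y s = 0)"
    "(SOME y. linear_solution (\<lambda>t. flow t \<xi>) y \<and> y s = 0) s = 0" by auto
  then show "linear_solution (\<lambda>t. flow t \<xi>) (\<lambda>t. eta f f' g T t s \<xi>)" "eta f f' g T s s \<xi> = 0"
    unfolding eta_def eq by simp_all
qed

text \<open>The two linearized solutions are compared from the base time \<open>s\<close> of the
  first: this one vanishes there, and the other is small since it vanishes at the nearby
  \<open>s0\<close>.\<close>

lemma continuous_on_Phi: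
  assumes K: "compact K" and KR: "\<And>t \<xi>. t \<in> {0..T} \<Longrightarrow> \<xi> \<in> K \<Longrightarrow> norm (flow t \<xi>) \<le> R"
  shows "continuous_on ({0..T} \<times> K) (\<lambda>(s, \<xi>). Phi f f' g T s \<xi>)"
  unfolding continuous_on_iff
proof (intro ballI allI impI)
  fix z0 and e :: real assume z0: "z0 \<in> {0..T} \<times> K" and e: "0 < e"
  obtain s0 \<xi>0 where z0_eq: "z0 = (s0, \<xi>0)" by (cases z0)
  have s0: "s0 \<in> {0..T}" and \<xi>0: "\<xi>0 \<in> K" using z0 z0_eq by auto
  define y where "y s \<xi> t = eta f f' g T t s \<xi>" for s \<xi> t
  have ysol: "(y s \<xi> has_vector_derivative blinfun_apply (f' (flow t \<xi>)) (y s \<xi> t) + g t (flow t \<xi>) 0) (at t within {0..T})"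
    "y s \<xi> s = 0" if "s \<in> {0..T}" "\<xi> \<in> K" "t \<in> {0..T}" for s \<xi> t
    using eta_linear_solution[of \<xi> s, OF KR] that unfolding linear_solution_def ode_solution_def y_def by auto
  have contY: "continuous_on {0..T} (y s0 \<xi>0)"
    by (rule continuous_on_vector_derivative) (rule ysol(1)[OF s0 \<xi>0])
  then have "bounded (y s0 \<xi>0 ` {0..T})" by (intro compact_imp_bounded compact_continuous_image) auto
  then obtain Y where Y: "0 < Y" "\<And>t. t \<in> {0..T} \<Longrightarrow> norm (y s0 \<xi>0 t) \<le> Y" unfolding bounded_pos by auto
  define E where "E = exp (L * T)"
  have E: "0 < E" by (simp add: E_def)
  define W where "W = (Y + 1) * T * E"
  have W: "0 < W" using Y T_pos E by (simp add: W_def)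
  \<comment> \<open>Coefficients and inhomogeneity then contribute \<open>e / 8\<close>, and the
    discrepancy at time \<open>s\<close> another \<open>e / 8\<close>; Phi collects such errors at
    the two times \<open>T\<close> and 0.\<close>
  define \<kappa> where "\<kappa> = e / 8 / W"
  have \<kappa>: "0 < \<kappa>" using e W by (simp add: \<kappa>_def)
  have "uniformly_continuous_on ({0..T} \<times> K) (\<lambda>z. f' (flow (fst z) (snd z)))"
    by (intro compact_uniformly_continuous compact_Times K continuous_intros continuous_on_compose2[OF cont_f']) auto
  then obtain \<delta>1 where \<delta>1: "0 < \<delta>1" "\<And>z z'. z \<in> {0..T} \<times> K \<Longrightarrow> z' \<in> {0..T} \<times> K \<Longrightarrow> dist z z' < \<delta>1 \<Longrightarrow>
      dist (f' (flow (fst z) (snd z))) (f' (flow (fst z') (snd z'))) < \<kappa>"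
    using \<kappa> unfolding uniformly_continuous_on_def by metis
  have "uniformly_continuous_on ({0..T} \<times> K) (\<lambda>z. g (fst z) (flow (fst z) (snd z)) 0)"
    by (intro compact_uniformly_continuous compact_Times K continuous_intros) auto
  then obtain \<delta>2 where \<delta>2: "0 < \<delta>2" "\<And>z z'. z \<in> {0..T} \<times> K \<Longrightarrow> z' \<in> {0..T} \<times> K \<Longrightarrow> dist z z' < \<delta>2 \<Longrightarrow>
      dist (g (fst z) (flow (fst z) (snd z)) 0) (g (fst z') (flow (fst z') (snd z')) 0) < \<kappa>"
    using \<kappa> unfolding uniformly_continuous_on_def by metis
  have "0 < e / (8 * E)" using e E by simp
  then obtain \<delta>3 where \<delta>3: "0 < \<delta>3" "\<And>s. s \<in> {0..T} \<Longrightarrow> dist s s0 < \<delta>3 \<Longrightarrow> dist (y s0 \<xi>0 s) (y s0 \<xi>0 s0) < e / (8 * E)"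
    using contY s0 unfolding continuous_on_iff by metis
  show "\<exists>d>0. \<forall>z\<in>{0..T} \<times> K. dist z z0 < d \<longrightarrow> dist ((\<lambda>(s, \<xi>). Phi f f' g T s \<xi>) z) ((\<lambda>(s, \<xi>). Phi f f' g T s \<xi>) z0) < e"
  proof (intro exI[of _ "min \<delta>1 (min \<delta>2 \<delta>3)"] conjI ballI impI)
    fix z assume z: "z \<in> {0..T} \<times> K" and d: "dist z z0 < min \<delta>1 (min \<delta>2 \<delta>3)"
    obtain s \<xi> where z_eq: "z = (s, \<xi>)" by (cases z)
    have s: "s \<in> {0..T}" and \<xi>: "\<xi> \<in> K" using z z_eq by auto
    have ds: "dist s s0 < \<delta>3" and d\<xi>: "dist \<xi> \<xi>0 < \<delta>1" "dist \<xi> \<xi>0 < \<delta>2"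
      using d dist_fst_le[of z z0] dist_snd_le[of z z0] by (auto simp: z_eq z0_eq)
    have close: "norm (y s \<xi> t - y s0 \<xi>0 t) \<le> e / 4" if t: "t \<in> {0..T}" for t
    proof -
      have "norm (y s \<xi> t - y s0 \<xi>0 t) \<le> (norm (y s \<xi> s - y s0 \<xi>0 s) + (\<kappa> * (Y + 1)) * \<bar>t - s\<bar>) * exp (L * \<bar>t - s\<bar>)"
      proof (rule gronwall[where a=0 and b=T and e="\<lambda>t. y s \<xi> t - y s0 \<xi>0 t" and e'="\<lambda>r. blinfun_apply (f' (flow r \<xi>)) (y s \<xi> r) + g r (flow r \<xi>) 0 -
          (blinfun_apply (f' (flow r \<xi>0)) (y s0 \<xi>0 r) + g r (flow r \<xi>0) 0)"])
        fix r assume r: "r \<in> {0..T}"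
        let ?A = "f' (flow r \<xi>)" and ?Az = "f' (flow r \<xi>0)" and ?b = "g r (flow r \<xi>) 0" and ?bz = "g r (flow r \<xi>0) 0"
        show "((\<lambda>t. y s \<xi> t - y s0 \<xi>0 t) has_vector_derivative (blinfun_apply ?A (y s \<xi> r) + ?b - (blinfun_apply ?Az (y s0 \<xi>0 r) + ?bz))) (at r within {0..T})"
          by (rule has_vector_derivative_diff[OF ysol(1)[OF s \<xi> r] ysol(1)[OF s0 \<xi>0 r]])
        have "blinfun_apply ?A (y s \<xi> r) + ?b - (blinfun_apply ?Az (y s0 \<xi>0 r) + ?bz) =
           blinfun_apply ?A (y s \<xi> r - y s0 \<xi>0 r) + blinfun_apply (?A - ?Az) (y s0 \<xi>0 r) + (?b - ?bz)"
          by (simp add: blinfun.diff_left blinfun.diff_right)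
        also have "norm \<dots> \<le> L * norm (y s \<xi> r - y s0 \<xi>0 r) + \<kappa> * Y + \<kappa>"
        proof (intro norm_triangle_le add_mono)
          show "norm (blinfun_apply ?A (y s \<xi> r - y s0 \<xi>0 r)) \<le> L * norm (y s \<xi> r - y s0 \<xi>0 r)"
            using linear_field_bound[of "\<lambda>r. flow r \<xi>" r, OF KR[OF r \<xi>]] .
          have "norm (?A - ?Az) \<le> \<kappa>"
            using \<delta>1(2)[of "(r, \<xi>)" "(r, \<xi>0)"] r \<xi> \<xi>0 d\<xi> by (simp add: dist_Pair_Pair dist_norm)
          then have "norm (?A - ?Az) * norm (y s0 \<xi>0 r) \<le> \<kappa> * Y" using Y(2)[OF r] \<kappa> by (intro mult_mono) auto
          then show "norm (blinfun_apply (?A - ?Az) (y s0 \<xi>0 r)) \<le> \<kappa> * Y"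
            using norm_blinfun[of "?A - ?Az" "y s0 \<xi>0 r"] by linarith
          show "norm (?b - ?bz) \<le> \<kappa>"
            using \<delta>2(2)[of "(r, \<xi>)" "(r, \<xi>0)"] r \<xi> \<xi>0 d\<xi> by (simp add: dist_Pair_Pair dist_norm)
        qed
        finally show "norm (blinfun_apply ?A (y s \<xi> r) + ?b - (blinfun_apply ?Az (y s0 \<xi>0 r) + ?bz)) \<le> L * norm (y s \<xi> r - y s0 \<xi>0 r) + \<kappa> * (Y + 1)"
          by (simp add: algebra_simps)
      qed (use L_pos \<kappa> Y s t in auto)
      also have "norm (y s \<xi> s - y s0 \<xi>0 s) = norm (y s0 \<xi>0 s)" using ysol(2)[OF s \<xi> s] by simp
      also have "(norm (y s0 \<xi>0 s) + (\<kappa> * (Y + 1)) * \<bar>t - s\<bar>) * exp (L * \<bar>t - s\<bar>) \<le> (e / (8 * E) + (\<kappa> * (Y + 1)) * T) * E"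
      proof (intro mult_mono add_mono order_refl)
        show "norm (y s0 \<xi>0 s) \<le> e / (8 * E)" using \<delta>3(2)[OF s ds] ysol(2)[OF s0 \<xi>0 s0] by simp
        show "\<bar>t - s\<bar> \<le> T" using s t by auto
        then show "exp (L * \<bar>t - s\<bar>) \<le> E" using L_pos by (simp add: E_def)
      qed (use \<kappa> Y T_pos E e in auto)
      also have "\<dots> = e / 4"
      proof -
        have "\<kappa> * ((Y + 1) * T * E) = e / 8"
          using W by (simp add: \<kappa>_def flip: W_def)
        moreover have "e / (8 * E) * E = e / 8" using E by simp
        ultimately show ?thesis by (simp add: algebra_simps)
      qed
      finally show ?thesis .
    qed
    have "norm ((y s \<xi> T - y s \<xi> 0) - (y s0 \<xi>0 T - y s0 \<xi>0 0)) \<le> norm (y s \<xi> T - y s0 \<xi>0 T) + norm (y s \<xi> 0 - y s0 \<xi>0 0)"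
      by norm
    also have "\<dots> \<le> e / 4 + e / 4" using T_pos by (intro add_mono close) auto
    also have "\<dots> < e" using e by simp
    finally show "dist ((\<lambda>(s, \<xi>). Phi f f' g T s \<xi>) z) ((\<lambda>(s, \<xi>). Phi f f' g T s \<xi>) z0) < e"
      by (simp add: z_eq z0_eq Phi_def y_def dist_norm)
  qed (use \<delta>1 \<delta>2 \<delta>3 in auto)
qed

section \<open>Solutions of the untruncated perturbed system\<close>

lemma exact_solution_in_ball:
  assumes "approx_solution \<epsilon> 0 x" "\<And>t. t \<in> {0..T} \<Longrightarrow> norm (x t) \<le> R"
  shows "ode_solution (\<lambda>t x. f x + \<epsilon> *\<^sub>R g t x \<epsilon>) {0..T} x"
  using assms unfolding approx_solution_def ode_solution_def by (force simp: fh_eq pr_eq)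

lemma approx_of_exact_solution:
  assumes "ode_solution (\<lambda>t x. f x + \<epsilon> *\<^sub>R g t x \<epsilon>) {0..T} x" "\<And>t. t \<in> {0..T} \<Longrightarrow> norm (x t) \<le> R" "0 \<le> \<epsilon>" "0 \<le> \<kappa>"
  shows "approx_solution \<epsilon> \<kappa> x"
  using assms unfolding approx_solution_def ode_solution_def by (force simp: fh_eq pr_eq)

text \<open>The bounds on \<open>f\<close> and \<open>g\<close> hold in the ball only. The solution
  is therefore followed from \<open>s\<close> to the nearest time \<open>q\<close> at which its
  distance from \<open>u\<close> is at least 1; up to \<open>q\<close> it is in the ball, and
  Gronwall gives a distance below 1. Taking the nearest time treats both time directions at
  once.\<close>

lemma perturbed_stays_close:
  assumes x: "ode_solution (\<lambda>t x. f x + \<epsilon> *\<^sub>R g t x \<epsilon>) {0..T} x" and u: "ode_solution (\<lambda>_. f) {0..T} u"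
    and uR: "\<And>t. t \<in> {0..T} \<Longrightarrow> norm (u t) + 1 \<le> R" and s: "s \<in> {0..T}" "x s = u s"
    and \<epsilon>: "0 \<le> \<epsilon>" "\<epsilon> \<le> 1" "\<epsilon> * C0 < 1" and t: "t \<in> {0..T}"
  shows "norm (x t - u t) < 1"
proof (rule ccontr)
  assume "\<not> norm (x t - u t) < 1"
  define h where "h t = norm (x t - u t)" for t
  have x': "(x has_vector_derivative f (x r) + \<epsilon> *\<^sub>R g r (x r) \<epsilon>) (at r within {0..T})" if "r \<in> {0..T}" for r
    using x that unfolding ode_solution_def by blast
  have u': "(u has_vector_derivative f (u r)) (at r within {0..T})" if "r \<in> {0..T}" for r
    using u that unfolding ode_solution_def by blast
  have conth: "continuous_on {0..T} h" unfolding h_def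
    by (intro continuous_intros continuous_on_vector_derivative[OF x'] continuous_on_vector_derivative[OF u'])
  define Z where "Z = {r \<in> {0..T}. 1 \<le> h r}"
  have "closed Z" unfolding Z_def
    by (rule continuous_on_closed_Collect_le) (use conth in \<open>auto intro!: continuous_intros\<close>)
  then have cZ: "closed Z" "Z \<noteq> {}" using \<open>\<not> norm (x t - u t) < 1\<close> t by (auto simp: Z_def h_def)
  obtain q where q: "q \<in> Z" "\<And>r. r \<in> Z \<Longrightarrow> dist s q \<le> dist s r" using distance_attains_inf[OF cZ] by metis
  have qT: "q \<in> {0..T}" "1 \<le> h q" using q(1) by (auto simp: Z_def)
  have "s \<noteq> q" using qT s(2) by (auto simp: h_def)
  have segT: "closed_segment s q \<subseteq> {0..T}" using s qT by (intro closed_segment_subset) auto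
  have "h r \<le> 1" if r: "r \<in> closed_segment s q" for r
  proof (rule continuous_le_on_closure[where f=h and x=r and a=1 and S="open_segment s q"])
    show "continuous_on (closure (open_segment s q)) h" using conth segT \<open>s \<noteq> q\<close> continuous_on_subset by auto
    show "r \<in> closure (open_segment s q)" using r \<open>s \<noteq> q\<close> by simp
    fix r' assume r': "r' \<in> open_segment s q"
    then have "r' \<in> {0..T}" "dist s r' < dist s q"
      using segT segment_open_subset_closed[of s q] dist_in_open_segment[OF r'] by (auto simp: dist_commute)
    then show "h r' \<le> 1" using q(2)[of r'] by (force simp: Z_def)
  qed
  then have xR: "norm (x r) \<le> R" if "r \<in> closed_segment s q" for r
    using that uR[of r] segT norm_triangle_ineq[of "x r - u r" "u r"] by (force simp: h_def)
  define a b where "a = min s q" and "b = max s q"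
  have ab: "{a..b} = closed_segment s q" by (auto simp: a_def b_def closed_segment_eq_real_ivl)
  have abT: "{a..b} \<subseteq> {0..T}" using segT ab by simp
  have "h q \<le> (norm (x s - u s) + (\<epsilon> * B) * \<bar>q - s\<bar>) * exp (L * \<bar>q - s\<bar>)"
    unfolding h_def
  proof (rule gronwall[where a=a and b=b])
    fix r assume r: "r \<in> {a..b}"
    then have rT: "r \<in> {0..T}" using abT by blast
    show "((\<lambda>t. x t - u t) has_vector_derivative (f (x r) + \<epsilon> *\<^sub>R g r (x r) \<epsilon> - f (u r))) (at r within {a..b})"
      by (intro derivative_intros has_vector_derivative_within_subset[OF x'[OF rT] abT] has_vector_derivative_within_subset[OF u'[OF rT] abT])
    have "norm (f (x r) + \<epsilon> *\<^sub>R g r (x r) \<epsilon> - f (u r)) \<le> norm (f (x r) - f (u r)) + norm (\<epsilon> *\<^sub>R g r (x r) \<epsilon>)"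
      using norm_triangle_ineq[of "f (x r) - f (u r)" "\<epsilon> *\<^sub>R g r (x r) \<epsilon>"] by (simp add: algebra_simps)
    also have "\<dots> \<le> L * norm (x r - u r) + \<epsilon> * B"
    proof (intro add_mono)
      show "norm (f (x r) - f (u r)) \<le> L * norm (x r - u r)" using xR[of r] uR[OF rT] r ab by (intro L_lip) auto
      show "norm (\<epsilon> *\<^sub>R g r (x r) \<epsilon>) \<le> \<epsilon> * B" using B_g[OF rT xR[of r], of \<epsilon>] \<epsilon> r ab by (simp add: mult_left_mono)
    qed
    finally show "norm (f (x r) + \<epsilon> *\<^sub>R g r (x r) \<epsilon> - f (u r)) \<le> L * norm (x r - u r) + \<epsilon> * B" .
  qed (use L_pos B_pos \<epsilon> in \<open>auto simp: a_def b_def\<close>)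
  also have "\<dots> = (\<epsilon> * B) * \<bar>q - s\<bar> * exp (L * \<bar>q - s\<bar>)" using s by simp
  also have "\<dots> \<le> (\<epsilon> * (B + 1)) * T * exp (L * T)"
  proof (intro mult_mono order_refl)
    show "\<bar>q - s\<bar> \<le> T" using s qT by auto
    then show "exp (L * \<bar>q - s\<bar>) \<le> exp (L * T)" using L_pos by simp
  qed (use B_pos \<epsilon> T_pos in auto)
  also have "\<dots> = \<epsilon> * C0" by (simp add: C0_def)
  finally show False using \<epsilon> qT by simp
qed

text \<open>A periodic solution that meets \<open>K\<close> at time \<open>s\<close> is compared
  with the unperturbed orbit through the contact point. That orbit returns after time
  \<open>T\<close> too, so the first-order terms at 0 and \<open>T\<close> must nearly agree, which
  makes Phi with base time \<open>s\<close> nearly zero. This is where all base times enter.\<close>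

lemma no_touch:
  assumes K: "compact K" "K \<noteq> {}" and KR: "\<And>\<zeta>. \<zeta> \<in> K \<Longrightarrow> norm \<zeta> + 1 \<le> R"
    and inv: "\<And>t \<zeta>. \<zeta> \<in> K \<Longrightarrow> flow t \<zeta> \<in> K" and per: "\<And>\<zeta>. \<zeta> \<in> K \<Longrightarrow> flow T \<zeta> = \<zeta>"
    and nz: "\<And>s \<zeta>. s \<in> {0..T} \<Longrightarrow> \<zeta> \<in> K \<Longrightarrow> Phi f f' g T s \<zeta> \<noteq> 0"
  obtains \<epsilon>0 where "0 < \<epsilon>0" "\<epsilon>0 \<le> 1"
    "\<And>\<epsilon> x t. 0 < \<epsilon> \<Longrightarrow> \<epsilon> \<le> \<epsilon>0 \<Longrightarrow> ode_solution (\<lambda>t x. f x + \<epsilon> *\<^sub>R g t x \<epsilon>) {0..T} x \<Longrightarrow> x 0 = x T \<Longrightarrow> t \<in> {0..T} \<Longrightarrow> x t \<notin> K"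
proof -
  have KR': "norm (flow t \<zeta>) \<le> R" if "\<zeta> \<in> K" for t \<zeta> using KR[OF inv[OF that, of t]] by simp
  have "continuous_on ({0..T} \<times> K) (\<lambda>z. norm ((\<lambda>(s, \<xi>). Phi f f' g T s \<xi>) z))"
    by (intro continuous_on_norm continuous_on_Phi K KR')
  moreover have "compact ({0..T} \<times> K)" "{0..T} \<times> K \<noteq> {}" using K T_pos by (auto intro!: compact_Times)
  ultimately obtain z where z: "z \<in> {0..T} \<times> K"
    "\<And>y. y \<in> {0..T} \<times> K \<Longrightarrow> norm ((\<lambda>(s, \<xi>). Phi f f' g T s \<xi>) z) \<le> norm ((\<lambda>(s, \<xi>). Phi f f' g T s \<xi>) y)"
    using continuous_attains_inf by meson
  define m where "m = norm ((\<lambda>(s, \<xi>). Phi f f' g T s \<xi>) z)"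
  have m: "0 < m" "\<And>s \<zeta>. s \<in> {0..T} \<Longrightarrow> \<zeta> \<in> K \<Longrightarrow> m \<le> norm (Phi f f' g T s \<zeta>)"
    using z nz unfolding m_def by fastforce+
  \<comment> \<open>Two expansion errors of at most \<open>\<epsilon> * m / 4\<close> each leave Phi
    below its minimal norm \<open>m\<close>.\<close>
  define \<kappa> where "\<kappa> = min 1 (m / (4 * C1))"
  have "0 < m / (4 * C1)" using m C1_pos by simp
  then have \<kappa>: "0 < \<kappa>" "\<kappa> \<le> 1" by (auto simp: \<kappa>_def)
  have "\<kappa> * C1 \<le> m / (4 * C1) * C1" using C1_pos by (intro mult_right_mono) (auto simp: \<kappa>_def)
  then have \<kappa>C1: "\<kappa> * C1 \<le> m / 4" using C1_pos by simp
  obtain \<epsilon>1 where \<epsilon>1: "0 < \<epsilon>1" "\<epsilon>1 \<le> 1"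
    "\<forall>\<epsilon> x u y s t. 0 < \<epsilon> \<longrightarrow> \<epsilon> \<le> \<epsilon>1 \<longrightarrow> approx_solution \<epsilon> \<kappa> x \<longrightarrow> ode_solution (\<lambda>_. f) {0..T} u \<longrightarrow>
      (\<forall>t\<in>{0..T}. norm (u t) + 1 \<le> R) \<longrightarrow> linear_solution u y \<longrightarrow> s \<in> {0..T} \<longrightarrow> x s = u s \<longrightarrow> y s = 0 \<longrightarrow>
      t \<in> {0..T} \<longrightarrow> norm (x t - u t - \<epsilon> *\<^sub>R y t) \<le> \<epsilon> * (\<kappa> * C1)"
    by (rule first_order_expansion[OF \<kappa>])
  define \<epsilon>0 where "\<epsilon>0 = min \<epsilon>1 (1 / (2 * C0))"
  have e0: "0 < \<epsilon>0" "\<epsilon>0 \<le> 1" using \<epsilon>1 C0_pos by (auto simp: \<epsilon>0_def)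
  show ?thesis
  proof (rule that[OF e0], rule notI)
    fix \<epsilon> x s assume \<epsilon>: "0 < \<epsilon>" "\<epsilon> \<le> \<epsilon>0" and x: "ode_solution (\<lambda>t x. f x + \<epsilon> *\<^sub>R g t x \<epsilon>) {0..T} x"
      and x0T: "x 0 = x T" and s: "s \<in> {0..T}" and xK: "x s \<in> K"
    \<comment> \<open>The value at time 0 of the unperturbed orbit that passes through the contact
      point at time \<open>s\<close>.\<close>
    define \<zeta> where "\<zeta> = flow (- s) (x s)"
    have \<zeta>: "\<zeta> \<in> K" unfolding \<zeta>_def by (rule inv[OF xK])
    have xs: "x s = flow s \<zeta>" unfolding \<zeta>_def by (simp flip: flow_add)
    have u: "ode_solution (\<lambda>_. f) {0..T} (\<lambda>t. flow t \<zeta>)" by (rule flow_ode_solution) (rule KR'[OF \<zeta>])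
    have uR: "norm (flow t \<zeta>) + 1 \<le> R" for t by (rule KR[OF inv[OF \<zeta>]])
    have "\<epsilon> \<le> 1 / (2 * C0)" using \<epsilon> by (simp add: \<epsilon>0_def)
    then have "\<epsilon> * C0 < 1" using C0_pos by (simp add: field_simps)
    then have "norm (x t - flow t \<zeta>) < 1" if "t \<in> {0..T}" for t
      using perturbed_stays_close[OF x u uR s xs _ _ _ that] \<epsilon> e0 by simp
    then have "norm (x t) \<le> R" if "t \<in> {0..T}" for t
      using uR[of t] that norm_triangle_ineq[of "x t - flow t \<zeta>" "flow t \<zeta>"] by force
    then have ax: "approx_solution \<epsilon> \<kappa> x" using x \<epsilon> \<kappa> by (intro approx_of_exact_solution) auto
    define y where "y t = eta f f' g T t s \<zeta>" for t
    have y: "linear_solution (\<lambda>t. flow t \<zeta>) y" "y s = 0"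
      using eta_linear_solution[of \<zeta> s, OF KR'[OF \<zeta>] s] by (simp_all add: y_def[abs_def])
    have \<epsilon>': "\<epsilon> \<le> \<epsilon>1" using \<epsilon> by (simp add: \<epsilon>0_def)
    have est: "norm (x t - flow t \<zeta> - \<epsilon> *\<^sub>R y t) \<le> \<epsilon> * (\<kappa> * C1)" if "t \<in> {0..T}" for t
      by (rule \<epsilon>1(3)[rule_format, OF \<epsilon>(1) \<epsilon>' ax u uR y(1) s xs y(2) that])
    have eq: "\<epsilon> *\<^sub>R (y T - y 0) = (x 0 - flow 0 \<zeta> - \<epsilon> *\<^sub>R y 0) - (x T - flow T \<zeta> - \<epsilon> *\<^sub>R y T)"
      using x0T per[OF \<zeta>] by (simp add: algebra_simps)
    have "norm (\<epsilon> *\<^sub>R (y T - y 0)) \<le> \<epsilon> * (\<kappa> * C1) + \<epsilon> * (\<kappa> * C1)"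
      unfolding eq by (rule order_trans[OF norm_triangle_ineq4]) (intro add_mono est; use T_pos in simp)
    then have "\<epsilon> * norm (y T - y 0) \<le> \<epsilon> * (2 * (\<kappa> * C1))" using \<epsilon> by simp
    then have "norm (y T - y 0) \<le> 2 * (\<kappa> * C1)" using \<epsilon> by simp
    then have "norm (Phi f f' g T s \<zeta>) \<le> m / 2" using \<kappa>C1 by (simp add: Phi_def y_def)
    then show False using m(1) m(2)[OF s \<zeta>] by simp
  qed
qed

end

section \<open>The planar cycle\<close>

text \<open>The given period need not be the least, but a Jordan loop must be injective on one
  period. By \<open>hom\<close> the periods form a closed group, and \<open>loc\<close> excludes
  small ones, so there is a least positive period and it divides \<open>T\<close>.\<close>

lemma minimal_period:
  fixes x :: "real \<Rightarrow> 'a::metric_space"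
  assumes T: "0 < T" and cont: "continuous_on UNIV x" and per: "\<And>t. x (t + T) = x t"
    and hom: "\<And>s t u. x s = x t \<Longrightarrow> x (u + s) = x (u + t)"
    and loc: "0 < d" "\<And>s. 0 < \<bar>s\<bar> \<Longrightarrow> \<bar>s\<bar> < d \<Longrightarrow> x s \<noteq> x 0"
  obtains p k where "0 < p" "T = real k * p" "\<And>t. x (t + p) = x t" "inj_on x {0..<p}"
proof -
  define P where "P = {q. \<forall>t. x (t + q) = x t}"
  have P_iff: "q \<in> P \<longleftrightarrow> x q = x 0" for q
    using hom[of q 0] unfolding P_def by (auto dest: spec[of _ 0])
  have Pd: "q = 0" if "q \<in> P" "\<bar>q\<bar> < d" for q
    using loc(2)[of q] that P_iff[of q] by force
  have TP: "T \<in> P" using per by (simp add: P_def)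
  have dT: "d \<le> T" using Pd[OF TP] T by force
  have "closed P"
  proof -
    have "P = x -` {x 0}" using P_iff by auto
    then show ?thesis by (simp add: closed_vimage cont)
  qed
  then have "compact (P \<inter> {d..T})" by (simp add: closed_Int_compact)
  moreover have "P \<inter> {d..T} \<noteq> {}" using TP dT by auto
  ultimately obtain p where p: "p \<in> P \<inter> {d..T}" "\<And>q. q \<in> P \<inter> {d..T} \<Longrightarrow> p \<le> q"
    using compact_attains_inf by metis
  have p0: "0 < p" using p loc(1) by auto
  have least: "q = 0" if q: "q \<in> P" "0 \<le> q" "q < p" for q
  proof (rule ccontr)
    assume "q \<noteq> 0"
    then have "d \<le> q" using Pd[OF q(1)] q(2) by force
    then show False using p q by force
  qed
  have sub: "a - b \<in> P" if "a \<in> P" "b \<in> P" for a b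
    unfolding P_def mem_Collect_eq
  proof
    fix t
    have "x (t + (a - b) + b) = x (t + (a - b))" using that(2) unfolding P_def mem_Collect_eq by (rule spec)
    moreover have "x (t + a) = x t" using that(1) unfolding P_def mem_Collect_eq by (rule spec)
    ultimately show "x (t + (a - b)) = x t" by simp
  qed
  have mult: "real n * p \<in> P" for n
  proof (induction n)
    case (Suc n)
    have "x (t + real (Suc n) * p) = x ((t + p) + real n * p)" for t by (simp add: algebra_simps)
    then show ?case using Suc p by (simp add: P_def)
  qed (simp add: P_def)
  define k where "k = nat \<lfloor>T / p\<rfloor>"
  have "real k = of_int \<lfloor>T / p\<rfloor>" using T p0 by (simp add: k_def)
  then have "real k \<le> T / p" "T / p < real k + 1" by linarith+
  then have "0 \<le> T - real k * p" "T - real k * p < p" using p0 by (auto simp: field_simps)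
  then have "T - real k * p = 0" using least[OF sub[OF TP mult]] by blast
  then have k: "T = real k * p" by simp
  have "inj_on x {0..<p}"
  proof (rule inj_onI)
    have main: "s = t" if "s \<in> {0..<p}" "t \<in> {0..<p}" "x s = x t" "s \<le> t" for s t
    proof -
      have "x (- s + t) = x (- s + s)" using hom[of t s "- s"] that by simp
      then have "t - s \<in> P" by (simp add: P_iff)
      then show ?thesis using least[of "t - s"] that by auto
    qed
    fix s t assume "s \<in> {0..<p}" "t \<in> {0..<p}" "x s = x t"
    then show "s = t" using main[of s t] main[of t s] by (cases "s \<le> t") auto
  qed
  then show ?thesis using that[OF p0 k _ \<open>inj_on x {0..<p}\<close>] p by (simp add: P_def)
qed

section \<open>Free homotopies of periodic loops\<close>

definition loops_homotopic :: "real \<Rightarrow> 'a::topological_space set \<Rightarrow> (real \<Rightarrow> 'a) \<Rightarrow> (real \<Rightarrow> 'a) \<Rightarrow> bool" where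
  "loops_homotopic T G c c' \<longleftrightarrow> (\<exists>\<Gamma>. continuous_on ({0..1::real} \<times> UNIV) \<Gamma> \<and>
     (\<forall>s\<in>{0..1}. \<forall>t. \<Gamma> (s, t + T) = \<Gamma> (s, t)) \<and> \<Gamma> ` ({0..1} \<times> UNIV) \<subseteq> G \<and>
     (\<forall>t. \<Gamma> (0, t) = c t) \<and> (\<forall>t. \<Gamma> (1, t) = c' t))"

lemma loops_homotopic_winding:
  assumes "loops_homotopic T G c c'" and h: "continuous_on G h" "\<And>v. v \<in> G \<Longrightarrow> h v \<noteq> 0"
  shows "loop_winding T (\<lambda>t. h (c t)) n \<longleftrightarrow> loop_winding T (\<lambda>t. h (c' t)) n"
proof -
  obtain \<Gamma> where \<Gamma>: "continuous_on ({0..1::real} \<times> UNIV) \<Gamma>" "\<forall>s\<in>{0..1}. \<forall>t. \<Gamma> (s, t + T) = \<Gamma> (s, t)"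
    "\<Gamma> ` ({0..1} \<times> UNIV) \<subseteq> G" "\<forall>t. \<Gamma> (0, t) = c t" "\<forall>t. \<Gamma> (1, t) = c' t"
    using assms(1) unfolding loops_homotopic_def by (elim exE conjE)
  have "loop_winding T (\<lambda>t. h (\<Gamma> (0, t))) n \<longleftrightarrow> loop_winding T (\<lambda>t. h (\<Gamma> (1, t))) n"
  proof (rule loop_winding_homotopy[where K="\<lambda>z. h (\<Gamma> z)"])
    show "continuous_on ({0..1} \<times> UNIV) (\<lambda>z. h (\<Gamma> z))" by (rule continuous_on_compose2[OF h(1) \<Gamma>(1,3)])
    show "h (\<Gamma> (s, t)) \<noteq> 0" if "s \<in> {0..1}" for s t using \<Gamma>(3) that by (intro h(2)) auto
  qed (simp add: \<Gamma>(2))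
  then show ?thesis by (simp add: \<Gamma>(4,5))
qed

lemma periodic_image_compact:
  fixes \<Gamma> :: "real \<times> real \<Rightarrow> 'a::t2_space"
  assumes "0 < T" "continuous_on ({0..1} \<times> UNIV) \<Gamma>" "\<And>s t. s \<in> {0..1} \<Longrightarrow> \<Gamma> (s, t + T) = \<Gamma> (s, t)"
  shows "compact (\<Gamma> ` ({0..1} \<times> UNIV))"
proof -
  have int: "\<Gamma> (s, t + of_int k * T) = \<Gamma> (s, t)" if "s \<in> {0..1}" for s t and k :: int
    by (rule periodic_shift_int[of "\<lambda>t. \<Gamma> (s, t)"]) (rule assms(3)[OF that])
  have "\<Gamma> ` ({0..1} \<times> UNIV) = \<Gamma> ` ({0..1} \<times> {0..T})"
  proof
    show "\<Gamma> ` ({0..1} \<times> UNIV) \<subseteq> \<Gamma> ` ({0..1} \<times> {0..T})"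
    proof clarify
      fix s t :: real assume s: "s \<in> {0..1}"
      obtain k :: int where "t + of_int k * T \<in> {0..<T}" using shift_into_period[OF assms(1)] by blast
      then show "\<Gamma> (s, t) \<in> \<Gamma> ` ({0..1} \<times> {0..T})" using int[OF s, of t k] s by (intro image_eqI[where x="(s, t + of_int k * T)"]) auto
    qed
  qed auto
  moreover have "compact (\<Gamma> ` ({0..1} \<times> {0..T}))"
    by (intro compact_continuous_image continuous_on_subset[OF assms(2)] compact_Times) auto
  ultimately show ?thesis by simp
qed

text \<open>Links angles to half-planes: a displacement that points along or against
  \<open>f\<close> has a quotient by \<open>f\<close> with positive or negative real part.\<close>

lemma Re_divide_to_complex: "Re (to_complex a / to_complex b) = (a \<bullet> b) / (norm b)\<^sup>2"
proof -
  have "a \<bullet> b = a $ 1 * b $ 1 + a $ 2 * b $ 2" by (simp add: inner_vec_def sum_2)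
  moreover have "(norm b)\<^sup>2 = (b $ 1)\<^sup>2 + (b $ 2)\<^sup>2"
    using norm_to_complex[of b] by (simp add: to_complex_def cmod_power2 flip: norm_to_complex)
  ultimately show ?thesis by (simp add: Re_divide to_complex_def)
qed

text \<open>Here \<open>p\<close> is the least period and \<open>T\<close> a multiple of it. The
  margin 2 in \<open>R_ins\<close> leaves room for points within distance 1 of the cycle and for
  perturbed solutions that deviate by less than 1.\<close>

locale planar_cycle = truncated_system T R f f' g
  for T R :: real and f :: "real^2 \<Rightarrow> real^2" and f' :: "real^2 \<Rightarrow> (real^2) \<Rightarrow>\<^sub>L (real^2)" and g +
  fixes x :: "real \<Rightarrow> real^2" and p :: real and k :: nat
  assumes x_der: "\<And>t. (x has_vector_derivative f (x t)) (at t)"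
    and p_pos: "0 < p" and T_eq: "T = real k * p" and x_per: "\<And>t. x (t + p) = x t" and x_inj: "inj_on x {0..<p}"
    and f_nz: "\<And>t. f (x t) \<noteq> 0"
    and R_ins: "\<And>v. v \<in> closure (inside (range x)) \<Longrightarrow> norm v + 2 \<le> R"
    and A1: "\<exists>V. open V \<and> range x \<subseteq> V \<and>
          (\<forall>y. periodic_cycle T f y \<and> range y \<subseteq> V \<longrightarrow> (\<exists>c. \<forall>t. y t = x (t + c)))"
    and Phi_nz: "\<And>\<xi> s. \<xi> \<in> range x \<Longrightarrow> s \<in> {0..T} \<Longrightarrow> Phi f f' g T s \<xi> \<noteq> 0"
    and deg: "brouwer_degree (\<lambda>\<xi>. - Phi f f' g T T \<xi>) (inside (range x)) \<noteq> 1"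
begin

lemma cont_x: "continuous_on S x"
  by (rule continuous_on_vector_derivative) (rule has_vector_derivative_at_within[OF x_der])

lemma cont_f: "continuous_on S f"
  by (rule has_derivative_continuous_on) (rule has_derivative_at_withinI[OF der_f])

sublocale smooth_loop "\<lambda>t. to_complex (x t)" p "\<lambda>t. to_complex (f (x t))"
proof
  show "inj_on (\<lambda>t. to_complex (x t)) {0..<p}" using x_inj by (simp add: inj_on_def to_complex_eq_iff)
  show "((\<lambda>t. to_complex (x t)) has_vector_derivative to_complex (f (x t))) (at t)" for t
    by (rule bounded_linear.has_vector_derivative[OF bounded_linear_to_complex x_der])
  show "continuous_on UNIV (\<lambda>t. to_complex (f (x t)))"
    by (intro continuous_intros continuous_on_compose2[OF cont_f] cont_x) auto
qed (auto simp: p_pos x_per f_nz intro!: continuous_intros cont_x)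

section \<open>The two sides of the cycle\<close>

abbreviation "K \<equiv> range x"

lemma K_image: "K = of_complex ` range (\<lambda>t. to_complex (x t))"
  by (auto simp: image_image)

lemma inside_K: "inside K = U"
  unfolding K_image inside_of_complex by (simp add: image_image)

definition Out where "Out = of_complex ` out"

lemma frontier_U: "frontier U = K" and open_U: "open U" and frontier_Out: "frontier Out = K" and open_Out: "open Out"
proof -
  show "frontier U = K" "open U" using U_facts K_image by auto
  show "frontier Out = K" unfolding Out_def frontier_of_complex K_image using jordan by simp
  have "interior Out = Out" using jordan by (simp add: Out_def interior_of_complex interior_open)
  then show "open Out" by (metis open_interior)
qed

lemma U_Out: "U \<inter> Out = {}" "U \<inter> K = {}" "Out \<inter> K = {}"
proof -
  have "ins \<inter> out = {}" "ins \<inter> range (\<lambda>t. to_complex (x t)) = {}" "out \<inter> range (\<lambda>t. to_complex (x t)) = {}"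
    by simp_all
  then show "U \<inter> Out = {}" "U \<inter> K = {}" "Out \<inter> K = {}"
    unfolding Out_def K_image by (simp_all only: image_Int[OF inj_of_complex, symmetric] image_empty)
qed

lemma K_closure: "closure U = U \<union> K"
  using frontier_U by (simp add: closure_Un_frontier)

lemma compact_K: "compact K" and K_ne: "K \<noteq> {}"
proof -
  show "compact K" unfolding K_image
    by (intro compact_continuous_image range_\<gamma>_compact continuous_intros)
qed simp

lemma K_R: "v \<in> K \<Longrightarrow> norm v + 2 \<le> R"
  using R_ins[of v] unfolding inside_K K_closure by simp

lemma x_flow: "x t = flow (t - s) (x s)"
proof (rule global_solution_eq_flow)
  show "(x has_vector_derivative fh (x t)) (at t)" for t using x_der[of t] K_R[of "x t"] by (simp add: fh_eq)
qed

lemma flow_K: "\<zeta> \<in> K \<Longrightarrow> flow t \<zeta> \<in> K"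
proof -
  assume "\<zeta> \<in> K"
  then obtain s where "\<zeta> = x s" by blast
  then have "flow t \<zeta> = x (s + t)" using x_flow[of "s + t" s] by simp
  then show "flow t \<zeta> \<in> K" by simp
qed

lemma x_T: "x (t + T) = x t"
proof -
  have "x (t + of_int (int k) * p) = x t" by (rule periodic_shift_int) (rule x_per)
  then show ?thesis by (simp add: T_eq)
qed

lemma flow_T_K: "\<zeta> \<in> K \<Longrightarrow> flow T \<zeta> = \<zeta>"
proof -
  assume "\<zeta> \<in> K"
  then obtain s where "\<zeta> = x s" by blast
  then show "flow T \<zeta> = \<zeta>" using x_flow[of "s + T" s] x_T[of s] by simp
qed

lemma stays_in_side:
  assumes D: "frontier D = K" and S: "connected S" "continuous_on S c" "\<And>t. t \<in> S \<Longrightarrow> c t \<notin> K"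
    and s: "s \<in> S" "c s \<in> D" "t \<in> S"
  shows "c t \<in> D"
proof (rule ccontr)
  assume "c t \<notin> D"
  then have "c ` S \<inter> frontier D \<noteq> {}"
    using s by (intro connected_Int_frontier connected_continuous_image S) auto
  then show False using D S(3) by auto
qed

text \<open>The cycle is invariant in both time directions, so an orbit that starts off it never
  reaches it.\<close>

lemma flow_side:
  assumes D: "frontier D = K" "D \<inter> K = {}" and v: "v \<in> D"
  shows "flow t v \<in> D"
proof (rule stays_in_side[OF D(1), of UNIV "\<lambda>t. flow t v" 0 t])
  show "flow t v \<notin> K" for t
  proof
    assume "flow t v \<in> K"
    then have "flow (- t) (flow t v) \<in> K" by (rule flow_K)
    then show False using v D(2) by (auto simp flip: flow_add)
  qed
qed (use v in \<open>auto intro!: continuous_intros\<close>)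

text \<open>Orbits that start in the closed interior stay there for all time, so the truncated flow
  computes Phi on the whole domain of the degree.\<close>

lemma flow_closure_U:
  assumes "v \<in> closure U" shows "norm (flow t v) \<le> R"
proof -
  have "flow t v \<in> closure U"
    using assms flow_K flow_side[OF frontier_U U_Out(2)] unfolding K_closure by blast
  then show ?thesis using R_ins[of "flow t v"] by (simp add: inside_K)
qed

lemma continuous_Phi_T: "continuous_on (closure U) (\<lambda>\<xi>. - Phi f f' g T T \<xi>)"
proof -
  have "compact (closure U)" using U_facts(2) by (simp only: compact_closure)
  then have "continuous_on ({0..T} \<times> closure U) (\<lambda>(s, \<xi>). Phi f f' g T s \<xi>)"
    by (rule continuous_on_Phi) (rule flow_closure_U)
  then have "continuous_on (closure U) (\<lambda>\<xi>. (\<lambda>(s, \<xi>). Phi f f' g T s \<xi>) (T, \<xi>))"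
    by (rule continuous_on_compose2) (use T_pos in \<open>auto intro!: continuous_intros\<close>)
  then show ?thesis by (auto intro!: continuous_intros)
qed

lemma k_pos: "0 < k" using T_pos T_eq by (cases k) auto

text \<open>Without winding of the quotient, -Phi would wind along the cycle like the tangent
  \<open>f\<close>, that is \<open>w\<close> times, and the degree would be 1. Passing from
  \<open>p\<close> to \<open>T\<close> multiplies the number by \<open>k\<close>, which is
  positive.\<close>

lemma Phi_winding:
  obtains n where "n \<noteq> 0" "loop_winding T (\<lambda>t. to_complex (- Phi f f' g T T (x t)) / to_complex (f (x t))) n"
proof -
  let ?q = "\<lambda>t. to_complex (- Phi f f' g T T (x t)) / to_complex (f (x t))"
  have c: "continuous_on UNIV ?q"
    by (intro continuous_intros continuous_on_compose2[OF continuous_Phi_T] continuous_on_compose2[OF cont_f] cont_x)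
      (auto simp: K_closure f_nz)
  have nz: "?q t \<noteq> 0" for t using Phi_nz[of "x t" T] T_pos f_nz[of t] by (simp add: to_complex_linear_simps)
  obtain n where n: "loop_winding p ?q n"
    using loop_winding_exists[of ?q p, OF c nz] x_per by auto
  have "n \<noteq> 0"
  proof
    assume "n = 0"
    then have "loop_winding p (\<lambda>t. to_complex (f (x t)) * ?q t) (w + 0)"
      by (intro loop_winding_mult tangent_winding) (use n in simp)
    then have "loop_winding p (\<lambda>t. to_complex (- Phi f f' g T T (of_complex (to_complex (x t))))) w"
      by (simp add: f_nz)
    then have "brouwer_degree (\<lambda>\<xi>. - Phi f f' g T T \<xi>) U = 1"
      by (intro brouwer_degree_eq_1 continuous_Phi_T) (use Phi_nz T_pos frontier_U in auto)
    then show False using deg inside_K by simp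
  qed
  then show ?thesis using that[of "int k * n"] loop_winding_iterate[OF n, of k] k_pos T_eq by simp
qed

section \<open>Uniform estimates near the cycle\<close>

lemma near_K:
  assumes "infdist v K \<le> \<eta>"
  obtains t where "norm (v - x t) \<le> \<eta>"
proof -
  obtain z where z: "z \<in> K" "infdist v K = dist v z"
    using infdist_attains_inf[OF compact_imp_closed[OF compact_K] K_ne] by blast
  then obtain t where "z = x t" by blast
  then show ?thesis using z assms that by (simp add: dist_norm)
qed

lemma infdist_K_le: "infdist v K \<le> norm (v - x t)"
  using infdist_le[of "x t" K v] by (simp add: dist_norm)

lemma compact_near_K: "compact {v. infdist v K \<le> \<eta>}"
proof -
  have "closed {v. infdist v K \<le> \<eta>}"
    by (intro closed_Collect_le continuous_intros)
  moreover have "bounded {v. infdist v K \<le> \<eta>}"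
  proof (rule boundedI[of _ "R + \<eta>"])
    fix v assume "v \<in> {v. infdist v K \<le> \<eta>}"
    then obtain t where "norm (v - x t) \<le> \<eta>" using near_K by blast
    then show "norm v \<le> R + \<eta>" using K_R[of "x t"] norm_triangle_ineq[of "v - x t" "x t"] by simp
  qed
  ultimately show ?thesis by (simp add: compact_eq_bounded_closed)
qed

lemma near_K_in_open:
  assumes "open W" "K \<subseteq> W"
  obtains \<eta> where "0 < \<eta>" "\<And>v. infdist v K \<le> \<eta> \<Longrightarrow> v \<in> W"
proof -
  obtain \<eta> where \<eta>: "0 < \<eta>" "(\<Union>z\<in>K. cball z \<eta>) \<subseteq> W"
    using compact_subset_open_imp_cball_epsilon_subset[OF compact_K assms] by blast
  have "v \<in> W" if v: "infdist v K \<le> \<eta>" for v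
  proof -
    obtain t where "norm (v - x t) \<le> \<eta>" using near_K[OF v] by metis
    then have "v \<in> cball (x t) \<eta>" by (simp add: dist_norm norm_minus_commute)
    then show ?thesis using \<eta>(2) by blast
  qed
  then show ?thesis using that \<eta>(1) by blast
qed

lemma near_K_f_nz:
  obtains \<eta> where "0 < \<eta>" "\<eta> \<le> 1" "\<And>v. infdist v K \<le> \<eta> \<Longrightarrow> f v \<noteq> 0"
proof -
  have "open {v. f v \<noteq> 0}" by (rule open_Collect_neq) (auto intro!: cont_f continuous_intros)
  then obtain \<eta> where "0 < \<eta>" "\<And>v. infdist v K \<le> \<eta> \<Longrightarrow> v \<in> {v. f v \<noteq> 0}"
    using near_K_in_open[of "{v. f v \<noteq> 0}"] f_nz by blast
  then show ?thesis using that[of "min \<eta> 1"] by simp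
qed

lemma near_K_R: "infdist v K \<le> 1 \<Longrightarrow> norm v + 1 \<le> R"
  using near_K[of v 1] K_R norm_triangle_sub by (smt (verit) rangeI)

lemma flow_period_int:
  assumes "flow T v = v" shows "flow (t + of_int j * T) v = flow t v"
  by (rule periodic_shift_int[of "\<lambda>t. flow t v"]) (simp add: flow_add assms)

lemma flow_near_x:
  assumes "t \<in> {0..T}"
  shows "norm (flow t v - x (s + t)) \<le> norm (v - x s) * exp (L * T)"
proof -
  have "x (s + t) = flow t (x s)" using x_flow[of "s + t" s] by simp
  then have "norm (flow t v - x (s + t)) \<le> norm (v - x s) * exp (L * \<bar>t\<bar>)" using flow_dist by simp
  also have "\<dots> \<le> norm (v - x s) * exp (L * T)" using assms L_pos by (intro mult_left_mono) auto
  finally show ?thesis .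
qed

text \<open>A fixed point of the time \<open>- T\<close> map generates a \<open>T\<close>-periodic
  orbit; by Gronwall over one period this orbit stays within \<open>\<eta> * E\<close> of the cycle,
  hence in \<open>V\<close>, and it is nonconstant because \<open>f\<close> does not vanish there.
  So \<open>A1\<close> makes it a time shift of the cycle.\<close>

lemma isolated_cycle:
  obtains \<eta> where "0 < \<eta>" "\<eta> \<le> 1" "\<And>v. infdist v K \<le> \<eta> \<Longrightarrow> f v \<noteq> 0"
    "\<And>v. infdist v K \<le> \<eta> \<Longrightarrow> flow (- T) v = v \<Longrightarrow> v \<in> K"
proof -
  obtain V where V: "open V" "K \<subseteq> V" "\<forall>y. periodic_cycle T f y \<and> range y \<subseteq> V \<longrightarrow> (\<exists>c. \<forall>t. y t = x (t + c))"
    using A1 by (elim exE conjE)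
  obtain \<eta>1 where \<eta>1: "0 < \<eta>1" "\<And>v. infdist v K \<le> \<eta>1 \<Longrightarrow> v \<in> V" using near_K_in_open[OF V(1,2)] by metis
  obtain \<eta>2 where \<eta>2: "0 < \<eta>2" "\<eta>2 \<le> 1" "\<And>v. infdist v K \<le> \<eta>2 \<Longrightarrow> f v \<noteq> 0" using near_K_f_nz by metis
  define E where "E = exp (L * T)"
  have E: "1 \<le> E" using L_pos T_pos by (simp add: E_def)
  define \<eta> where "\<eta> = min \<eta>1 \<eta>2 / E"
  have \<eta>: "0 < \<eta>" "\<eta> * E = min \<eta>1 \<eta>2" using \<eta>1 \<eta>2 E by (auto simp: \<eta>_def)
  have "\<eta> * 1 \<le> \<eta> * E" using \<eta>(1) E by (intro mult_left_mono) auto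
  then have \<eta>le: "\<eta> \<le> \<eta>1" "\<eta> \<le> \<eta>2" using \<eta>(2) by auto
  show ?thesis
  proof (rule that[OF \<eta>(1)])
    show "\<eta> \<le> 1" using \<eta>le \<eta>2 by simp
    show "f v \<noteq> 0" if "infdist v K \<le> \<eta>" for v using \<eta>2(3) \<eta>le that by simp
    fix v assume v: "infdist v K \<le> \<eta>" and fx: "flow (- T) v = v"
    have fT: "flow T v = v"
    proof -
      have "flow T (flow (- T) v) = v" by (simp flip: flow_add)
      then show ?thesis using fx by simp
    qed
    obtain s where s: "norm (v - x s) \<le> \<eta>" using near_K[OF v] by metis
    have near: "infdist (flow t v) K \<le> min \<eta>1 \<eta>2" for t
    proof -
      obtain j :: int where j: "t + of_int j * T \<in> {0..<T}" using shift_into_period[OF T_pos] by blast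
      have "norm (flow (t + of_int j * T) v - x (s + (t + of_int j * T))) \<le> norm (v - x s) * exp (L * T)"
        by (rule flow_near_x) (use j in auto)
      also have "\<dots> \<le> \<eta> * E" using s E by (simp add: E_def)
      finally have "infdist (flow (t + of_int j * T) v) K \<le> \<eta> * E" using infdist_K_le order_trans by blast
      then show ?thesis using flow_period_int[OF fT, of t j] \<eta>(2) by simp
    qed
    have R1: "norm (flow t v) \<le> R" for t
      using near_K_R[of "flow t v"] near[of t] \<eta>2 by simp
    have d: "((\<lambda>t. flow t v) has_vector_derivative f (flow t v)) (at t)" for t
      using flow_deriv[of v t UNIV] fh_eq[OF R1] by simp
    have "periodic_cycle T f (\<lambda>t. flow t v)"
      unfolding periodic_cycle_def periodic_solution_def ode_solution_def
    proof (intro conjI ballI allI)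
      show "((\<lambda>t. flow t v) has_vector_derivative f (flow t v)) (at t)" for t by (rule d)
      show "flow (t + T) v = flow t v" for t using flow_add[of t T v] fT by simp
      show "\<exists>s t. flow s v \<noteq> flow t v"
      proof (rule ccontr)
        assume "\<not> (\<exists>s t. flow s v \<noteq> flow t v)"
        then have "(\<lambda>t. flow t v) = (\<lambda>t. v)" by (metis flow_0)
        then have "((\<lambda>t. v) has_vector_derivative f v) (at 0)" using d[of 0] by simp
        then have "f v = 0" using vector_derivative_unique_at[OF _ has_vector_derivative_const] by blast
        then show False using \<eta>2(3)[of v] near[of 0] by simp
      qed
    qed
    moreover have "range (\<lambda>t. flow t v) \<subseteq> V" using near \<eta>1(2) by auto
    ultimately have "\<exists>c. \<forall>t. flow t v = x (t + c)" using V(3) by simp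
    then obtain c where "\<forall>t. flow t v = x (t + c)" ..
    then have "v = x c" by (metis add_0 flow_0)
    then show "v \<in> K" by simp
  qed
qed

text \<open>For fixed \<open>v\<close>, the function \<open>flow s v \<bullet> f v\<close> has at
  \<open>s = 0\<close> a derivative bounded below uniformly near the cycle; uniform continuity keeps
  the derivative positive, and the function increasing, over a common time range.\<close>

lemma short_time_flow:
  obtains \<delta> \<eta> where "0 < \<delta>" "0 < \<eta>"
    "\<And>v r. infdist v K \<le> \<eta> \<Longrightarrow> 0 < r \<Longrightarrow> r \<le> \<delta> \<Longrightarrow> 0 < (flow r v - v) \<bullet> f v \<and> (flow (- r) v - v) \<bullet> f v < 0"
proof -
  obtain \<eta> where \<eta>: "0 < \<eta>" "\<eta> \<le> 1" "\<And>v. infdist v K \<le> \<eta> \<Longrightarrow> f v \<noteq> 0" using near_K_f_nz by metis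
  define N where "N = {v. infdist v K \<le> \<eta>}"
  have N: "compact N" "N \<noteq> {}" "\<And>v. v \<in> N \<Longrightarrow> fh v = f v" "\<And>v. v \<in> N \<Longrightarrow> f v \<noteq> 0"
  proof -
    have "x 0 \<in> N" using \<eta> by (simp add: N_def)
    then show "N \<noteq> {}" by blast
    show "fh v = f v" if "v \<in> N" for v using near_K_R[of v] that \<eta> by (intro fh_eq) (auto simp: N_def)
  qed (use compact_near_K \<eta> in \<open>auto simp: N_def\<close>)
  have "continuous_on N (\<lambda>v. f v \<bullet> f v)" by (intro continuous_intros cont_f)
  then obtain v0 where v0: "v0 \<in> N" "\<And>v. v \<in> N \<Longrightarrow> f v0 \<bullet> f v0 \<le> f v \<bullet> f v"
    using continuous_attains_inf[OF N(1,2)] by blast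
  define m where "m = f v0 \<bullet> f v0"
  have m: "0 < m" using N(4)[OF v0(1)] by (simp add: m_def)
  have "uniformly_continuous_on ({-1..1} \<times> N) (\<lambda>z. fh (flow (fst z) (snd z)) \<bullet> f (snd z))"
    by (intro compact_uniformly_continuous compact_Times N continuous_intros
        continuous_on_compose2[OF continuous_F] continuous_on_compose2[OF cont_f]) auto
  then obtain \<delta> where \<delta>: "0 < \<delta>" "\<And>z z'. z \<in> {-1..1} \<times> N \<Longrightarrow> z' \<in> {-1..1} \<times> N \<Longrightarrow> dist z z' < \<delta> \<Longrightarrow>
     dist (fh (flow (fst z) (snd z)) \<bullet> f (snd z)) (fh (flow (fst z') (snd z')) \<bullet> f (snd z')) < m"
    using m unfolding uniformly_continuous_on_def by metis
  have pos: "0 < fh (flow r v) \<bullet> f v" if v: "v \<in> N" and r: "\<bar>r\<bar> < min \<delta> 1" for r v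
    using \<delta>(2)[of "(r, v)" "(0, v)"] v r v0(2)[OF v] N(3)[OF v] by (simp add: dist_Pair_Pair dist_norm m_def abs_less_iff)
  show ?thesis
  proof (rule that[of "min \<delta> 1 / 2" \<eta>])
    fix v r assume v: "infdist v K \<le> \<eta>" and r: "0 < r" "r \<le> min \<delta> 1 / 2"
    have vN: "v \<in> N" using v by (simp add: N_def)
    define h where "h s = flow s v \<bullet> f v" for s
    have dh: "(h has_real_derivative fh (flow s v) \<bullet> f v) (at s)" for s
      unfolding h_def has_real_derivative_iff_has_vector_derivative
      by (rule bounded_linear.has_vector_derivative[OF bounded_linear_inner_left flow_deriv])
    have mono: "h a < h b" if "a < b" "\<bar>a\<bar> < min \<delta> 1" "\<bar>b\<bar> < min \<delta> 1" for a b
    proof (rule DERIV_pos_imp_increasing[OF that(1)])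
      fix s assume "a \<le> s" "s \<le> b"
      then have "\<bar>s\<bar> < min \<delta> 1" using that by linarith
      then show "\<exists>y. (h has_real_derivative y) (at s) \<and> 0 < y" using dh pos[OF vN] by blast
    qed
    have "h 0 < h r" "h (- r) < h 0" using r \<delta>(1) by (auto intro!: mono)
    then show "0 < (flow r v - v) \<bullet> f v \<and> (flow (- r) v - v) \<bullet> f v < 0" by (simp add: h_def inner_diff_left)
  qed (use \<delta> \<eta> in auto)
qed

text \<open>The sign of the normal is absorbed into \<open>nv\<close>, so that inside and outside
  can be treated alike. The last property serves points of a nearby closed orbit, which need not lie
  on the normal at the given time.\<close>

lemma side_normal:
  assumes "D = U \<or> D = Out"
  obtains nv d where "0 < d" "continuous_on UNIV nv" "\<And>t. nv (t + T) = nv t" "\<And>t. norm (nv t) = norm (f (x t))"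
    "\<And>t \<mu>. 0 < \<mu> \<Longrightarrow> \<mu> \<le> d \<Longrightarrow> x t + \<mu> *\<^sub>R nv t \<in> D"
    "\<And>a t \<mu>. a \<in> D \<Longrightarrow> norm (a - x t) \<le> d \<Longrightarrow> 0 \<le> \<mu> \<Longrightarrow> \<mu> \<le> d \<Longrightarrow> a + \<mu> *\<^sub>R nv t \<in> D"
proof -
  define X where "X t = to_complex (x t)" for t
  define Y where "Y t = \<i> * to_complex (f (x t))" for t
  obtain d0 \<sigma> where d0: "0 < d0" "\<sigma> \<in> {1, -1 :: real}"
    "\<And>r t \<mu>. \<bar>r - t\<bar> \<le> d0 \<Longrightarrow> 0 < \<mu> \<Longrightarrow> \<mu> \<le> d0 \<Longrightarrow> X r + of_real (\<sigma> * \<mu>) * Y t \<in> ins"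
    "\<And>r t \<mu>. \<bar>r - t\<bar> \<le> d0 \<Longrightarrow> 0 < \<mu> \<Longrightarrow> \<mu> \<le> d0 \<Longrightarrow> X r + of_real (- \<sigma> * \<mu>) * Y t \<in> out"
    using two_sides unfolding X_def Y_def by metis
  obtain D' \<tau> where D': "D = of_complex ` D'" "open D'" "frontier D' = range X" "\<tau> \<in> {1, -1 :: real}"
    and pos: "\<And>r t \<mu>. \<bar>r - t\<bar> \<le> d0 \<Longrightarrow> 0 < \<mu> \<Longrightarrow> \<mu> \<le> d0 \<Longrightarrow> X r + of_real \<mu> * (of_real \<tau> * Y t) \<in> D'"
    and neg: "\<And>r t \<mu>. \<bar>r - t\<bar> \<le> d0 \<Longrightarrow> 0 < \<mu> \<Longrightarrow> \<mu> \<le> d0 \<Longrightarrow> X r - of_real \<mu> * (of_real \<tau> * Y t) \<notin> D'"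
  proof -
    have io: "ins \<inter> out = {}" using jordan by blast
    show ?thesis
    proof (cases "D = U")
      case True
      show ?thesis
      proof (rule that[of ins \<sigma>])
        fix r t \<mu> :: real assume a: "\<bar>r - t\<bar> \<le> d0" "0 < \<mu>" "\<mu> \<le> d0"
        show "X r + of_real \<mu> * (of_real \<sigma> * Y t) \<in> ins" using d0(3)[OF a] by (simp add: mult_ac)
        show "X r - of_real \<mu> * (of_real \<sigma> * Y t) \<notin> ins"
        proof -
          have "X r - of_real \<mu> * (of_real \<sigma> * Y t) \<in> out" using d0(4)[OF a] by (simp add: mult_ac)
          then show ?thesis using io by (meson disjoint_iff)
        qed
      qed (use True jordan d0 in \<open>auto simp: X_def\<close>)
    next
      case False
      show ?thesis
      proof (rule that[of out "- \<sigma>"])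
        fix r t \<mu> :: real assume a: "\<bar>r - t\<bar> \<le> d0" "0 < \<mu>" "\<mu> \<le> d0"
        show "X r + of_real \<mu> * (of_real (- \<sigma>) * Y t) \<in> out" using d0(4)[OF a] by (simp add: mult_ac)
        show "X r - of_real \<mu> * (of_real (- \<sigma>) * Y t) \<notin> out"
        proof -
          have "X r - of_real \<mu> * (of_real (- \<sigma>) * Y t) \<in> ins" using d0(3)[OF a] by (simp add: mult_ac)
          then show ?thesis using io by (meson disjoint_iff)
        qed
      qed (use False assms jordan d0 in \<open>auto simp: X_def Out_def\<close>)
    qed
  qed
  have nN: "norm (of_real \<tau> * Y t) = norm (to_complex (f (x t)))" for t
    using D'(4) by (auto simp: Y_def norm_mult)
  obtain e where e: "0 < e" "\<And>a t \<mu>. a \<in> D' \<Longrightarrow> norm (a - X t) \<le> e \<Longrightarrow> 0 \<le> \<mu> \<Longrightarrow> \<mu> \<le> e \<Longrightarrow> a + of_real \<mu> * (of_real \<tau> * Y t) \<in> D'"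
    using push_along_normal[OF D'(2) D'(3)[unfolded X_def] d0(1) neg[unfolded X_def] nN] unfolding X_def by metis
  define nv where "nv t = of_complex (of_real \<tau> * Y t)" for t
  have eq: "to_complex (a + \<mu> *\<^sub>R nv t) = to_complex a + of_real \<mu> * (of_real \<tau> * Y t)" for a \<mu> t
    by (simp add: nv_def to_complex_linear_simps) (simp add: scaleR_conv_of_real)
  show ?thesis
  proof (rule that[of "min d0 e" nv])
    show "continuous_on UNIV nv" unfolding nv_def Y_def
      by (intro continuous_intros continuous_on_compose2[OF cont_f] cont_x) auto
    show "norm (nv t) = norm (f (x t))" for t using nN[of t] by (simp add: nv_def)
    show "x t + \<mu> *\<^sub>R nv t \<in> D" if "0 < \<mu>" "\<mu> \<le> min d0 e" for t \<mu>
      using pos[of t t \<mu>] that d0(1) unfolding D'(1) of_complex_image_iff eq X_def by simp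
    show "a + \<mu> *\<^sub>R nv t \<in> D" if "a \<in> D" "norm (a - x t) \<le> min d0 e" "0 \<le> \<mu>" "\<mu> \<le> min d0 e" for a t \<mu>
    proof -
      have "to_complex a \<in> D'" using that(1) unfolding D'(1) of_complex_image_iff .
      moreover have "norm (to_complex a - X t) \<le> e"
        using that(2) by (simp add: X_def flip: to_complex_linear_simps)
      ultimately show ?thesis using e(2)[of "to_complex a" t \<mu>] that unfolding D'(1) of_complex_image_iff eq by simp
    qed
  qed (use d0 e x_T in \<open>auto simp: nv_def Y_def\<close>)
qed

section \<open>A reference loop on either side\<close>

lemma flow_speed:
  assumes "\<And>v. norm (fh v) \<le> M"
  shows "norm (flow a v - flow b v) \<le> M * \<bar>a - b\<bar>"
proof -
  have "norm (flow a v - flow b v) \<le> M * norm (a - b)"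
  proof (rule differentiable_bound[where S=UNIV and f'="\<lambda>t h. h *\<^sub>R fh (flow t v)"])
    show "((\<lambda>t. flow t v) has_derivative (\<lambda>h. h *\<^sub>R fh (flow t v))) (at t within UNIV)" for t
      using flow_deriv[of v t UNIV] by (simp add: has_vector_derivative_def)
    show "onorm (\<lambda>h. h *\<^sub>R fh (flow t v)) \<le> M" for t
      using assms[of "flow t v"] by (intro onorm_le) (simp add: mult.commute[of M] mult_left_mono)
  qed auto
  then show ?thesis by simp
qed

text \<open>The homotopy is handed over as invariance of winding numbers for maps on
  \<open>G\<close>, since one case uses a single homotopy and the other a chain of three.
  \<open>G\<close> is also the compact region in which the perturbed displacement will have its
  zero.\<close>

lemma reference_loop:
  assumes side: "D = U \<or> D = Out" and \<eta>: "0 < \<eta>" "\<eta> \<le> 1" "\<And>v. infdist v K \<le> \<eta> \<Longrightarrow> f v \<noteq> 0"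
    and iso: "\<And>v. infdist v K \<le> \<eta> \<Longrightarrow> flow (- T) v = v \<Longrightarrow> v \<in> K"
  obtains G c where "compact G" "G \<subseteq> D \<union> K" "\<And>v. v \<in> G \<Longrightarrow> infdist v K \<le> \<eta>"
    "continuous_on UNIV c" "\<And>t. c (t + T) = c t" "range c \<subseteq> G" "\<And>t. flow (- T) (c t) \<noteq> c t"
    "loop_winding T (\<lambda>t. to_complex (flow (- T) (c t) - c t) / to_complex (f (c t))) 0"
    "\<forall>h n. continuous_on G h \<longrightarrow> (\<forall>v\<in>G. h v \<noteq> 0) \<longrightarrow>
       loop_winding T (\<lambda>t. h (x t)) n = loop_winding T (\<lambda>t. h (c t)) n"
proof -
  have D: "frontier D = K" "open D" "D \<inter> K = {}"
    using side frontier_U frontier_Out open_U open_Out U_Out by auto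
  obtain nv d where nv: "0 < d" "continuous_on UNIV nv" "\<And>t. nv (t + T) = nv t" "\<And>t. norm (nv t) = norm (f (x t))"
    and leave: "\<And>t \<mu>. 0 < \<mu> \<Longrightarrow> \<mu> \<le> d \<Longrightarrow> x t + \<mu> *\<^sub>R nv t \<in> D"
    and push: "\<And>a t \<mu>. a \<in> D \<Longrightarrow> norm (a - x t) \<le> d \<Longrightarrow> 0 \<le> \<mu> \<Longrightarrow> \<mu> \<le> d \<Longrightarrow> a + \<mu> *\<^sub>R nv t \<in> D"
    using side_normal[OF side] by metis
  obtain M where M: "0 < M" "\<And>v. norm (fh v) \<le> M" using bounded_fh by metis
  have nvM: "norm (nv t) \<le> M" for t using M(2)[of "x t"] K_R[of "x t"] by (simp add: nv(4) fh_eq)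
  have contx: "continuous_on S (\<lambda>s. x (a s))" if "continuous_on S a" for S :: "(real \<times> real) set" and a
    by (rule continuous_on_compose2[OF cont_x[of UNIV] that]) simp
  have contnv: "continuous_on S (\<lambda>s. nv (a s))" if "continuous_on S a" for S :: "(real \<times> real) set" and a
    by (rule continuous_on_compose2[OF nv(2) that]) simp
  have leave_near: "infdist (x t + \<mu> *\<^sub>R nv t) K \<le> \<mu> * M" if "0 \<le> \<mu>" for t \<mu>
  proof -
    have "infdist (x t + \<mu> *\<^sub>R nv t) K \<le> norm (\<mu> *\<^sub>R nv t)" using infdist_K_le[of "x t + \<mu> *\<^sub>R nv t" t] by simp
    also have "\<dots> \<le> \<mu> * M" using that nvM by (simp add: mult_left_mono)
    finally show ?thesis .
  qed
  \<comment> \<open>Half of \<eta> is reserved for the push along the normal, the other half for the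
    distance of a closed orbit from the cycle.\<close>
  define \<mu> where "\<mu> = min d (\<eta> / 2 / M)"
  have \<mu>: "0 < \<mu>" "\<mu> \<le> d" using nv(1) \<eta>(1) M(1) by (auto simp: \<mu>_def)
  have "\<mu> * M \<le> \<eta> / 2 / M * M" using M(1) by (intro mult_right_mono) (auto simp: \<mu>_def)
  then have \<mu>M: "\<mu> * M \<le> \<eta> / 2" using M(1) by simp
  define z where "z t = x t + \<mu> *\<^sub>R nv t" for t
  have zT: "z (t + T) = z t" for t by (simp add: z_def x_T nv(3))
  have "compact ((\<lambda>p. z (snd p)) ` ({0..1::real} \<times> UNIV))"
    by (rule periodic_image_compact[OF T_pos]) (auto simp: z_def x_T nv(3) intro!: continuous_intros contx contnv)
  moreover have "(\<lambda>p. z (snd p)) ` ({0..1::real} \<times> UNIV) = range z" by force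
  ultimately have "compact (range z)" by simp
  moreover have "range z \<inter> K = {}" using leave[OF \<mu>] D(3) by (auto simp: z_def)
  ultimately obtain \<rho> where \<rho>: "0 < \<rho>" "\<And>a b. a \<in> range z \<Longrightarrow> b \<in> K \<Longrightarrow> \<rho> \<le> dist a b"
    using separate_compact_closed[OF _ compact_imp_closed[OF compact_K]] by metis
  obtain \<delta>1 \<eta>1 where short: "0 < \<delta>1" "0 < \<eta>1"
    "\<And>v r. infdist v K \<le> \<eta>1 \<Longrightarrow> 0 < r \<Longrightarrow> r \<le> \<delta>1 \<Longrightarrow> 0 < (flow r v - v) \<bullet> f v \<and> (flow (- r) v - v) \<bullet> f v < 0"
    using short_time_flow by metis
  \<comment> \<open>Allowed distance between closed orbit and cycle at equal parameters: small
    enough for \<open>push\<close>, for the short-time estimate, for staying within \<eta>, and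
    below the distance \<rho> of \<open>z\<close> from the cycle.\<close>
  define \<tau> where "\<tau> = min (min d \<eta>1) (min (\<eta> / 2) (\<rho> / 2))"
  have \<tau>: "0 < \<tau>" "\<tau> \<le> d" "\<tau> \<le> \<eta> / 2" "\<tau> < \<rho>" "\<tau> \<le> \<eta>1"
    using nv(1) \<eta>(1) \<rho>(1) short(2) by (auto simp: \<tau>_def)
  \<comment> \<open>Moving for a time of at most \<delta> displaces a point by at most
    \<open>\<tau> / 2\<close>.\<close>
  define \<delta> where "\<delta> = min \<delta>1 (\<tau> / 2 / M)"
  have \<delta>: "0 < \<delta>" "\<delta> \<le> \<delta>1" using short(1) \<tau>(1) M(1) by (auto simp: \<delta>_def)
  have "M * \<delta> \<le> M * (\<tau> / 2 / M)" using M(1) by (intro mult_left_mono) (auto simp: \<delta>_def)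
  then have \<delta>M: "M * \<delta> \<le> \<tau> / 2" using M(1) by simp
  have flow_mT_K: "flow (- T) (x t) = x t" for t using x_flow[of "t - T" t] x_T[of "t - T"] by simp
  \<comment> \<open>On the cycle only the extra time \<delta> acts, so the displacement points
    strictly against \<open>f\<close>; this open condition persists nearby.\<close>
  obtain \<eta>2 where \<eta>2: "0 < \<eta>2" "\<And>v. infdist v K \<le> \<eta>2 \<Longrightarrow> (flow (- (T + \<delta>)) v - v) \<bullet> f v < 0"
  proof -
    let ?W = "{v. (flow (- (T + \<delta>)) v - v) \<bullet> f v < 0}"
    have "open ?W" by (intro open_Collect_less continuous_intros cont_f)
    moreover have "K \<subseteq> ?W"
    proof clarify
      fix t
      have "flow (- (T + \<delta>)) (x t) = flow (- \<delta>) (flow (- T) (x t))"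
        by (simp add: algebra_simps flip: flow_add)
      then show "(flow (- (T + \<delta>)) (x t) - x t) \<bullet> f (x t) < 0"
        using short(2) short(3)[of "x t" \<delta>] \<delta> by (simp add: flow_mT_K)
    qed
    ultimately show ?thesis using near_K_in_open[of ?W] that by (metis (no_types, lifting) mem_Collect_eq)
  qed
  define E where "E = exp (L * (T + \<delta>))"
  have E: "1 \<le> E" using L_pos T_pos \<delta>(1) by (simp add: E_def)
  define b where "b = min \<eta> (min \<eta>2 (\<tau> / 2))"
  have b: "0 < b" "b \<le> \<eta>" "b \<le> \<eta>2" "b \<le> \<tau> / 2" using \<eta>(1) \<eta>2(1) \<tau>(1) by (auto simp: b_def)
  \<comment> \<open>The flow enlarges initial distances by at most \<open>E\<close> over times up to
    \<open>T + \<delta>\<close>, and the normals have length at most \<open>M\<close>.\<close>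
  define \<nu> where "\<nu> = min d (b / (M * E))"
  have ME: "0 < M * E" using M(1) E by simp
  have \<nu>: "0 < \<nu>" "\<nu> \<le> d" using nv(1) b(1) ME by (auto simp: \<nu>_def)
  have "\<nu> \<le> b / (M * E)" by (simp add: \<nu>_def)
  then have "\<nu> * (M * E) \<le> b" using pos_le_divide_eq[OF ME] by blast
  then have \<nu>ME: "\<nu> * M * E \<le> b" by (simp only: mult.assoc)
  have "\<nu> * M * 1 \<le> \<nu> * M * E" using E \<nu> M(1) by (intro mult_left_mono) auto
  then have \<nu>M: "\<nu> * M \<le> b" using \<nu>ME by simp
  define y where "y t = x t + \<nu> *\<^sub>R nv t" for t
  have yT: "y (t + T) = y t" for t by (simp add: y_def x_T nv(3))
  have yD: "y t \<in> D" for t unfolding y_def by (rule leave[OF \<nu>])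
  have y_near: "infdist (y t) K \<le> b" for t using leave_near[of \<nu> t] \<nu> \<nu>M by (simp add: y_def)
  have conty: "continuous_on S (\<lambda>s. y (a s))" if "continuous_on S a" for S :: "(real \<times> real) set" and a
    unfolding y_def by (intro continuous_intros contx contnv that)
  have f_on: "continuous_on S (\<lambda>s. f (a s))" if "continuous_on S a" for S :: "'b::topological_space set" and a
    by (rule continuous_on_compose2[OF cont_f[of UNIV] that]) simp
  show ?thesis
  proof (cases "\<forall>t. \<forall>s\<in>{T..T+\<delta>}. flow (- s) (y t) \<noteq> y t")
    case True
    define \<Gamma> where "\<Gamma> z = x (snd z) + (fst z * \<nu>) *\<^sub>R nv (snd z)" for z
    have cont\<Gamma>: "continuous_on ({0..1} \<times> UNIV) \<Gamma>" unfolding \<Gamma>_def by (intro continuous_intros contx contnv)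
    have per\<Gamma>: "\<Gamma> (s, t + T) = \<Gamma> (s, t)" for s t by (simp add: \<Gamma>_def x_T nv(3))
    define G where "G = \<Gamma> ` ({0..1} \<times> UNIV)"
    have end1: "\<Gamma> (1, t) = y t" for t by (simp add: \<Gamma>_def y_def)
    have hom: "loops_homotopic T G x y" unfolding loops_homotopic_def
      by (rule exI[of _ \<Gamma>]) (use cont\<Gamma> per\<Gamma> end1 in \<open>auto simp: G_def \<Gamma>_def\<close>)
    have sl: "0 \<le> s * \<nu>" "s * \<nu> \<le> \<nu>" if "s \<in> {0..1}" for s
      using that \<nu> by (auto simp: mult_left_le_one_le)
    show ?thesis
    proof (rule that[of G y])
      show "compact G" unfolding G_def by (rule periodic_image_compact[OF T_pos cont\<Gamma> per\<Gamma>])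
      show "G \<subseteq> D \<union> K"
      proof -
        have "\<Gamma> (s, t) \<in> D \<union> K" if "s \<in> {0..1}" for s t
        proof (cases "s = 0")
          case False
          then have "0 < s * \<nu>" using that \<nu> by simp
          then show ?thesis using leave[of "s * \<nu>" t] sl[OF that] \<nu> by (simp add: \<Gamma>_def)
        qed (simp add: \<Gamma>_def)
        then show ?thesis unfolding G_def by blast
      qed
      show "infdist v K \<le> \<eta>" if v: "v \<in> G" for v
      proof -
        obtain s t where st: "s \<in> {0..1}" "v = \<Gamma> (s, t)" using v unfolding G_def by blast
        have "infdist v K \<le> s * \<nu> * M" using leave_near[of "s * \<nu>" t] sl[OF st(1)] by (simp add: st(2) \<Gamma>_def)
        also have "\<dots> \<le> \<nu> * M" using sl[OF st(1)] M(1) by (intro mult_right_mono) auto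
        finally show ?thesis using \<nu>M b by linarith
      qed
      show "continuous_on UNIV y" unfolding y_def by (intro continuous_intros cont_x nv(2))
      show "range y \<subseteq> G" using end1 unfolding G_def by (force intro!: image_eqI[where x="(1, _)"])
      show "flow (- T) (y t) \<noteq> y t" for t using True \<delta>(1) by simp
      \<comment> \<open>Homotopy in the flow time: by the case assumption the displacement does not
        vanish for times between \<open>T\<close> and \<open>T + \<delta>\<close>.\<close>
      have "loop_winding T (\<lambda>t. to_complex (flow (- (T + 0 * \<delta>)) (y t) - y t) / to_complex (f (y t))) 0
        \<longleftrightarrow> loop_winding T (\<lambda>t. to_complex (flow (- (T + 1 * \<delta>)) (y t) - y t) / to_complex (f (y t))) 0"
      proof (rule loop_winding_homotopy[where K="\<lambda>z. to_complex (flow (- (T + fst z * \<delta>)) (y (snd z)) - y (snd z)) / to_complex (f (y (snd z)))", simplified fst_conv snd_conv])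
        have nz: "to_complex (f (y t)) \<noteq> 0" for t using \<eta>(3) y_near[of t] b by simp
        then show "continuous_on ({0..1} \<times> UNIV) (\<lambda>z. to_complex (flow (- (T + fst z * \<delta>)) (y (snd z)) - y (snd z)) / to_complex (f (y (snd z))))"
          by (intro continuous_intros conty f_on) auto
        fix s t :: real assume s: "s \<in> {0..1}"
        have "s * \<delta> \<le> \<delta>" using s \<delta> by (simp add: mult_left_le_one_le)
        then have "T + s * \<delta> \<in> {T..T+\<delta>}" using s \<delta> by simp
        then have "flow (- (T + s * \<delta>)) (y t) \<noteq> y t" using True by blast
        then show "to_complex (flow (- (T + s * \<delta>)) (y t) - y t) / to_complex (f (y t)) \<noteq> 0" using nz[of t] by simp
      qed (simp add: yT)
      moreover have "loop_winding T (\<lambda>t. to_complex (flow (- (T + \<delta>)) (y t) - y t) / to_complex (f (y t))) 0"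
      proof (rule loop_winding_Re_neg)
        have nz: "f (y t) \<noteq> 0" for t using \<eta>(3) y_near[of t] b by simp
        then show "continuous_on UNIV (\<lambda>t. to_complex (flow (- (T + \<delta>)) (y t) - y t) / to_complex (f (y t)))"
          unfolding y_def by (intro continuous_intros f_on cont_x nv(2)) (auto simp: y_def)
        show "Re (to_complex (flow (- (T + \<delta>)) (y t) - y t) / to_complex (f (y t))) < 0" for t
          unfolding Re_divide_to_complex using \<eta>2(2)[of "y t"] y_near[of t] b nz[of t] by (simp add: divide_neg_pos)
      qed (simp add: yT)
      ultimately show "loop_winding T (\<lambda>t. to_complex (flow (- T) (y t) - y t) / to_complex (f (y t))) 0" by simp
    qed (use yT loops_homotopic_winding[OF hom] in auto)
  next
    case False
    then obtain t0 S where S: "S \<in> {T..T+\<delta>}" "flow (- S) (y t0) = y t0" by blast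
    define v where "v = y t0"
    have vD: "v \<in> D" and v_near: "infdist v K \<le> b" unfolding v_def by (rule yD, rule y_near)
    have fSv: "flow (- S) v = v" using S(2) by (simp add: v_def)
    have fSv': "flow S v = v"
    proof -
      have "flow S (flow (- S) v) = v" by (simp flip: flow_add)
      then show ?thesis using fSv by simp
    qed
    \<comment> \<open>This is where isolation is used: a closed orbit with period exactly
      \<open>T\<close> this close would be the cycle itself.\<close>
    have "S \<noteq> T"
    proof
      assume "S = T"
      then have "v \<in> K" using iso[of v] v_near b fSv by simp
      then show False using vD D(3) by blast
    qed
    then have ST: "T < S" "S - T \<le> \<delta>" "0 < S" using S(1) T_pos by auto
    \<comment> \<open>The closed orbit of period \<open>S\<close>, rescaled in time to period
      \<open>T\<close> and aligned with the cycle at \<open>t0\<close>.\<close>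
    define c where "c t = flow (S / T * (t - t0)) v" for t
    have cT: "c (t + T) = c t" for t
    proof -
      have "S / T * (t + T - t0) = S / T * (t - t0) + S" using T_pos by (simp add: field_simps)
      then show ?thesis using fSv' by (simp add: c_def flow_add)
    qed
    have contc: "continuous_on A (\<lambda>s. c (a s))" if "continuous_on A a" for A :: "'b::topological_space set" and a
      unfolding c_def using T_pos by (intro continuous_intros that) auto
    have cD: "c t \<in> D" for t unfolding c_def by (rule flow_side[OF D(1,3) vD])
    have c_S: "flow (- S) (c t) = c t" for t
    proof -
      have "flow (- S) (c t) = flow (S / T * (t - t0)) (flow (- S) v)" unfolding c_def by (simp add: add.commute flip: flow_add)
      then show ?thesis using fSv by (simp add: c_def)
    qed
    \<comment> \<open>Two errors of at most \<open>\<tau> / 2\<close>: the initial distance at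
      \<open>t0\<close> carried along by the flow, and the time lag \<open>r - (t - t0)\<close>,
      which the rescaling keeps at most \<delta>.\<close>
    have c_close0: "norm (c t - x t) \<le> \<tau>" if t: "t \<in> {t0..t0+T}" for t
    proof -
      define r where "r = S / T * (t - t0)"
      have q: "0 \<le> (t - t0) / T" "(t - t0) / T \<le> 1" using t T_pos by (auto simp: field_simps)
      have "r = S * ((t - t0) / T)" by (simp add: r_def)
      moreover have "0 \<le> S * ((t - t0) / T)" by (rule mult_nonneg_nonneg) (use q ST(3) in auto)
      moreover have "S * ((t - t0) / T) \<le> S * 1" by (rule mult_left_mono) (use q ST(3) in auto)
      ultimately have r: "0 \<le> r" "r \<le> S" by linarith+
      have e: "r - (t - t0) = (S - T) * ((t - t0) / T)" using T_pos by (simp add: r_def field_simps)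
      have "0 \<le> r - (t - t0)" unfolding e by (rule mult_nonneg_nonneg) (use q ST(1) in auto)
      moreover have "r - (t - t0) \<le> S - T" unfolding e by (rule mult_left_le) (use q ST(1) in auto)
      ultimately have rt: "\<bar>r - (t - t0)\<bar> \<le> \<delta>" using ST(2) by linarith
      have "norm (flow r v - flow r (x t0)) \<le> norm (v - x t0) * exp (L * \<bar>r\<bar>)" by (rule flow_dist)
      also have "\<dots> \<le> (\<nu> * M) * E"
      proof (rule mult_mono)
        show "norm (v - x t0) \<le> \<nu> * M" using \<nu> nvM[of t0] by (simp add: v_def y_def mult_left_mono)
        show "exp (L * \<bar>r\<bar>) \<le> E" using r S(1) L_pos by (simp add: E_def)
      qed (use \<nu> M in auto)
      also have "\<dots> \<le> \<tau> / 2" using \<nu>ME b by linarith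
      finally have 1: "norm (flow r v - flow r (x t0)) \<le> \<tau> / 2" .
      have "norm (flow r (x t0) - flow (t - t0) (x t0)) \<le> M * \<bar>r - (t - t0)\<bar>" by (rule flow_speed[OF M(2)])
      also have "\<dots> \<le> M * \<delta>" using rt M(1) by (intro mult_left_mono) auto
      finally have 2: "norm (flow r (x t0) - x t) \<le> \<tau> / 2" using \<delta>M x_flow[of t t0] by simp
      have "norm (c t - x t) \<le> norm (flow r v - flow r (x t0)) + norm (flow r (x t0) - x t)"
        unfolding c_def r_def[symmetric] by norm
      then show ?thesis using 1 2 by linarith
    qed
    have c_close: "norm (c t - x t) \<le> \<tau>" for t
    proof -
      obtain j :: int where j: "t - t0 + of_int j * T \<in> {0..<T}" using shift_into_period[OF T_pos] by blast
      have "norm (c (t + of_int j * T) - x (t + of_int j * T)) \<le> \<tau>" by (rule c_close0) (use j in auto)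
      then show ?thesis using periodic_shift_int[of c T t j, OF cT] periodic_shift_int[of x T t j, OF x_T] by simp
    qed
    have c_near: "infdist (c t) K \<le> \<tau>" for t using infdist_K_le[of "c t" t] c_close[of t] by linarith
    \<comment> \<open>The direct homotopy from the cycle to the closed orbit could cross the cycle; both ends are first pushed
      away from it along the normal.\<close>
    define \<Gamma>1 where "\<Gamma>1 z = x (snd z) + (fst z * \<mu>) *\<^sub>R nv (snd z)" for z
    define \<Gamma>2 where "\<Gamma>2 q = z (snd q) + fst q *\<^sub>R (c (snd q) - x (snd q))" for q
    define \<Gamma>3 where "\<Gamma>3 z = c (snd z) + ((1 - fst z) * \<mu>) *\<^sub>R nv (snd z)" for z
    have cont: "continuous_on ({0..1} \<times> UNIV) \<Gamma>1" "continuous_on ({0..1} \<times> UNIV) \<Gamma>2" "continuous_on ({0..1} \<times> UNIV) \<Gamma>3"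
      unfolding \<Gamma>1_def \<Gamma>2_def \<Gamma>3_def z_def by (intro continuous_intros contx contnv contc)+
    have per: "\<Gamma>1 (s, t + T) = \<Gamma>1 (s, t)" "\<Gamma>2 (s, t + T) = \<Gamma>2 (s, t)" "\<Gamma>3 (s, t + T) = \<Gamma>3 (s, t)" for s t
      by (simp_all add: \<Gamma>1_def \<Gamma>2_def \<Gamma>3_def x_T nv(3) cT zT)
    define G where "G = \<Gamma>1 ` ({0..1} \<times> UNIV) \<union> \<Gamma>2 ` ({0..1} \<times> UNIV) \<union> \<Gamma>3 ` ({0..1} \<times> UNIV)"
    have h1: "loops_homotopic T G x z" unfolding loops_homotopic_def
      by (rule exI[of _ \<Gamma>1]) (use cont per in \<open>auto simp: G_def \<Gamma>1_def z_def\<close>)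
    have h2: "loops_homotopic T G z (\<lambda>t. c t + \<mu> *\<^sub>R nv t)" unfolding loops_homotopic_def
      by (rule exI[of _ \<Gamma>2]) (use cont per in \<open>auto simp: G_def \<Gamma>2_def z_def\<close>)
    have h3: "loops_homotopic T G (\<lambda>t. c t + \<mu> *\<^sub>R nv t) c" unfolding loops_homotopic_def
      by (rule exI[of _ \<Gamma>3]) (use cont per in \<open>auto simp: G_def \<Gamma>3_def\<close>)
    have sm: "0 \<le> s * \<mu>" "s * \<mu> \<le> \<mu>" if "0 \<le> s" "s \<le> 1" for s
      using that \<mu> by (auto simp: mult_left_le_one_le)
    have G1: "\<Gamma>1 (s, t) \<in> D \<union> K \<and> infdist (\<Gamma>1 (s, t)) K \<le> \<eta>" if s: "s \<in> {0..1}" for s t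
    proof
      show "\<Gamma>1 (s, t) \<in> D \<union> K"
      proof (cases "s = 0")
        case False
        then have "0 < s * \<mu>" using s \<mu> by simp
        moreover have "s * \<mu> \<le> d" by (rule order_trans[OF sm(2) \<mu>(2)]) (use s in auto)
        ultimately show ?thesis using leave[of "s * \<mu>" t] by (simp add: \<Gamma>1_def)
      qed (simp add: \<Gamma>1_def)
      have "infdist (\<Gamma>1 (s, t)) K \<le> s * \<mu> * M" using leave_near[of "s * \<mu>" t] sm[of s] s by (simp add: \<Gamma>1_def)
      also have "\<dots> \<le> \<mu> * M" using sm[of s] s M(1) by (intro mult_right_mono) auto
      finally show "infdist (\<Gamma>1 (s, t)) K \<le> \<eta>" using \<mu>M \<eta> by linarith
    qed
    have G2: "\<Gamma>2 (s, t) \<in> D \<union> K \<and> infdist (\<Gamma>2 (s, t)) K \<le> \<eta>" if s: "s \<in> {0..1}" for s t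
    proof
      have dz: "norm (\<Gamma>2 (r, t) - z t) \<le> \<tau>" if "r \<in> {0..1}" for r
      proof -
        have "norm (\<Gamma>2 (r, t) - z t) = r * norm (c t - x t)" using that by (simp add: \<Gamma>2_def)
        also have "\<dots> \<le> 1 * \<tau>" using that c_close[of t] by (intro mult_mono) auto
        finally show ?thesis by simp
      qed
      \<comment> \<open>The segment starts at \<open>z t\<close> and has length at most \<tau>, less
        than the distance \<rho> of \<open>z\<close> from the cycle, so it cannot cross.\<close>
      have "\<Gamma>2 (s, t) \<in> D"
      proof (rule stays_in_side[OF D(1), of "{0..1}" "\<lambda>s. \<Gamma>2 (s, t)" 0 s])
        show "continuous_on {0..1} (\<lambda>s. \<Gamma>2 (s, t))" unfolding \<Gamma>2_def by (auto intro!: continuous_intros)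
        show "\<Gamma>2 (r, t) \<notin> K" if r: "r \<in> {0..1}" for r
        proof
          assume "\<Gamma>2 (r, t) \<in> K"
          then have "\<rho> \<le> dist (z t) (\<Gamma>2 (r, t))" by (intro \<rho>(2)) auto
          then show False using dz[OF r] \<tau>(4) by (simp add: dist_norm norm_minus_commute)
        qed
        show "\<Gamma>2 (0, t) \<in> D" using leave[OF \<mu>, of t] by (simp add: \<Gamma>2_def z_def)
      qed (use s in auto)
      then show "\<Gamma>2 (s, t) \<in> D \<union> K" by simp
      have "infdist (\<Gamma>2 (s, t)) K \<le> norm (\<Gamma>2 (s, t) - x t)" by (rule infdist_K_le)
      also have "\<dots> \<le> norm (\<Gamma>2 (s, t) - z t) + norm (\<mu> *\<^sub>R nv t)"
        using norm_triangle_ineq[of "\<Gamma>2 (s, t) - z t" "\<mu> *\<^sub>R nv t"] by (simp add: z_def)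
      also have "\<dots> \<le> \<tau> + \<mu> * M" using dz[OF s] nvM[of t] \<mu> by (intro add_mono) (auto simp: mult_left_mono)
      finally show "infdist (\<Gamma>2 (s, t)) K \<le> \<eta>" using \<tau>(3) \<mu>M by linarith
    qed
    have G3: "\<Gamma>3 (s, t) \<in> D \<union> K \<and> infdist (\<Gamma>3 (s, t)) K \<le> \<eta>" if s: "s \<in> {0..1}" for s t
    proof
      have s': "0 \<le> (1 - s) * \<mu>" "(1 - s) * \<mu> \<le> \<mu>" using sm[of "1 - s"] s by auto
      have "\<Gamma>3 (s, t) \<in> D" unfolding \<Gamma>3_def fst_conv snd_conv
      proof (rule push)
        show "(1 - s) * \<mu> \<le> d" using s'(2) \<mu>(2) by (rule order_trans)
        show "norm (c t - x t) \<le> d" using c_close[of t] \<tau>(2) by (rule order_trans)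
      qed (rule cD, rule s'(1))
      then show "\<Gamma>3 (s, t) \<in> D \<union> K" by simp
      have "infdist (\<Gamma>3 (s, t)) K \<le> norm (\<Gamma>3 (s, t) - x t)" by (rule infdist_K_le)
      also have "\<dots> \<le> norm (c t - x t) + norm (((1 - s) * \<mu>) *\<^sub>R nv t)"
        using norm_triangle_ineq[of "c t - x t" "((1 - s) * \<mu>) *\<^sub>R nv t"] by (simp add: \<Gamma>3_def algebra_simps)
      also have "norm (((1 - s) * \<mu>) *\<^sub>R nv t) \<le> \<mu> * M"
        using s' nvM[of t] \<mu> M(1) s by (simp only: norm_scaleR) (intro mult_mono; simp)
      finally show "infdist (\<Gamma>3 (s, t)) K \<le> \<eta>" using \<tau>(3) \<mu>M c_close[of t] by linarith
    qed
    have GG: "v \<in> D \<union> K \<and> infdist v K \<le> \<eta>" if v: "v \<in> G" for v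
    proof -
      obtain s t where "s \<in> {0..1}" "v = \<Gamma>1 (s, t) \<or> v = \<Gamma>2 (s, t) \<or> v = \<Gamma>3 (s, t)"
        using v unfolding G_def by blast
      then show ?thesis using G1[of s t] G2[of s t] G3[of s t] by metis
    qed
    have "\<tau> \<le> \<eta>" using \<tau> \<eta> by auto
    have nz: "f (c t) \<noteq> 0" for t using \<eta>(3)[of "c t"] c_near[of t] \<open>\<tau> \<le> \<eta>\<close> by simp
    \<comment> \<open>Since \<open>c t\<close> returns after time \<open>S\<close>, going back by
      \<open>T\<close> is going forward by the short time \<open>S - T\<close>.\<close>
    have c_flow: "flow (- T) (c t) = flow (S - T) (c t)" for t
    proof -
      have "flow (S - T) (c t) = flow (S - T) (flow (- S) (c t))" by (simp add: c_S)
      then show ?thesis by (simp flip: flow_add)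
    qed
      have pos: "0 < (flow (- T) (c t) - c t) \<bullet> f (c t)" for t
        unfolding c_flow using short(3)[of "c t" "S - T"] c_near[of t] \<tau>(5) ST \<delta> by simp
      show ?thesis
      proof (rule that[of G c])
        show "compact G" unfolding G_def
          by (intro compact_Un periodic_image_compact[OF T_pos] cont per)
        show "range c \<subseteq> G"
        proof clarify
          fix t
          have "c t = \<Gamma>3 (1, t)" by (simp add: \<Gamma>3_def)
          then show "c t \<in> G" unfolding G_def by auto
        qed
        show "flow (- T) (c t) \<noteq> c t" for t using pos[of t] by auto
        show "loop_winding T (\<lambda>t. to_complex (flow (- T) (c t) - c t) / to_complex (f (c t))) 0"
        proof (rule loop_winding_Re_pos)
          show "continuous_on UNIV (\<lambda>t. to_complex (flow (- T) (c t) - c t) / to_complex (f (c t)))"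
            using nz by (intro continuous_intros f_on contc) auto
          show "0 < Re (to_complex (flow (- T) (c t) - c t) / to_complex (f (c t)))" for t
            unfolding Re_divide_to_complex using pos[of t] nz[of t] by simp
        qed (simp add: cT)
        show "\<forall>h n. continuous_on G h \<longrightarrow> (\<forall>v\<in>G. h v \<noteq> 0) \<longrightarrow>
          loop_winding T (\<lambda>t. h (x t)) n = loop_winding T (\<lambda>t. h (c t)) n"
        proof (intro allI impI)
          fix h :: "real^2 \<Rightarrow> complex" and n
          assume a: "continuous_on G h" "\<forall>v\<in>G. h v \<noteq> 0"
          then have nz: "\<And>v. v \<in> G \<Longrightarrow> h v \<noteq> 0" by blast
          show "loop_winding T (\<lambda>t. h (x t)) n = loop_winding T (\<lambda>t. h (c t)) n"
            using loops_homotopic_winding[OF h1 a(1) nz] loops_homotopic_winding[OF h2 a(1) nz]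
              loops_homotopic_winding[OF h3 a(1) nz] by simp
        qed
      qed (use GG cT contc[of UNIV "\<lambda>t. t"] in auto)
  qed
qed

section \<open>Zeros of the perturbed displacement\<close>

abbreviation "perturbed \<epsilon> \<equiv> (\<lambda>t v. f v + \<epsilon> *\<^sub>R g t v \<epsilon>)"

lemma backward_flow_estimate:
  assumes "approx_solution \<epsilon> \<kappa> X" "0 \<le> \<epsilon>" "\<epsilon> \<le> 1" "\<kappa> \<le> 1" "t \<in> {0..T}"
  shows "norm (X t - flow (t - T) (X T)) \<le> \<epsilon> * C0"
proof -
  have "norm (X t - flow (t - T) (X T)) \<le> norm (X T - flow (T - T) (X T)) * exp (L * T) + \<epsilon> * C0"
    by (rule approx_solution_dist[OF assms(1) flow_shift_deriv assms(2-4)]) (use assms(5) T_pos in auto)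
  then show ?thesis by simp
qed

text \<open>The unperturbed displacement vanishes on the cycle but not on \<open>c\<close>, so two
  different comparisons are made: on the cycle with the first-order term, of size \<epsilon>, and on
  \<open>c\<close> with the unperturbed displacement, whose minimum \<open>m2\<close> does not
  depend on \<epsilon>. The unequal windings \<open>n\<close> and 0 along loops linked in
  \<open>G\<close> force a zero in \<open>G\<close>.\<close>

lemma zero_of_displacement:
  assumes side: "D = U \<or> D = Out" and \<eta>: "0 < \<eta>" "\<eta> \<le> 1" "\<And>v. infdist v K \<le> \<eta> \<Longrightarrow> f v \<noteq> 0"
    and iso: "\<And>v. infdist v K \<le> \<eta> \<Longrightarrow> flow (- T) v = v \<Longrightarrow> v \<in> K"
  obtains \<epsilon>0 where "0 < \<epsilon>0" "\<epsilon>0 \<le> 1"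
    "\<And>\<epsilon>. 0 < \<epsilon> \<Longrightarrow> \<epsilon> \<le> \<epsilon>0 \<Longrightarrow> \<exists>X. approx_solution \<epsilon> 0 X \<and> X 0 = X T \<and> X T \<in> D \<union> K \<and> infdist (X T) K \<le> \<eta>"
proof -
  obtain G c where G: "compact G" "G \<subseteq> D \<union> K" "\<And>v. v \<in> G \<Longrightarrow> infdist v K \<le> \<eta>"
    and c: "continuous_on UNIV c" "\<And>t. c (t + T) = c t" "range c \<subseteq> G" "\<And>t. flow (- T) (c t) \<noteq> c t"
    and c_wind: "loop_winding T (\<lambda>t. to_complex (flow (- T) (c t) - c t) / to_complex (f (c t))) 0"
    and hom: "\<forall>h n. continuous_on G h \<longrightarrow> (\<forall>v\<in>G. h v \<noteq> 0) \<longrightarrow>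
       loop_winding T (\<lambda>t. h (x t)) n = loop_winding T (\<lambda>t. h (c t)) n"
    by (rule reference_loop[OF side \<eta> iso], assumption, assumption, assumption) (rule that)
  obtain n where n: "n \<noteq> 0" "loop_winding T (\<lambda>t. to_complex (- Phi f f' g T T (x t)) / to_complex (f (x t))) n"
    using Phi_winding by metis
  have f_on: "continuous_on S (\<lambda>s. f (a s))" if "continuous_on S a" for S :: "'b::topological_space set" and a
    by (rule continuous_on_compose2[OF cont_f[of UNIV] that]) simp
  have "continuous_on K (\<lambda>v. norm (- Phi f f' g T T v))"
    by (intro continuous_on_norm continuous_on_subset[OF continuous_Phi_T]) (auto simp: K_closure)
  then obtain v1 where v1: "v1 \<in> K" "\<And>v. v \<in> K \<Longrightarrow> norm (- Phi f f' g T T v1) \<le> norm (- Phi f f' g T T v)"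
    using continuous_attains_inf[OF compact_K K_ne] by metis
  define m1 where "m1 = norm (- Phi f f' g T T v1)"
  have m1: "0 < m1" using Phi_nz[OF v1(1), of T] T_pos by (simp add: m1_def)
  \<comment> \<open>Puts the expansion error \<open>\<epsilon> * (\<kappa> * C1)\<close> below
    \<open>\<epsilon> * m1\<close>, the least size of the first-order term on the cycle.\<close>
  define \<kappa> where "\<kappa> = min 1 (m1 / 2 / C1)"
  have \<kappa>: "0 < \<kappa>" "\<kappa> \<le> 1" using m1 C1_pos by (auto simp: \<kappa>_def)
  have "\<kappa> * C1 \<le> m1 / 2 / C1 * C1" using C1_pos by (intro mult_right_mono) (auto simp: \<kappa>_def)
  then have \<kappa>C1: "\<kappa> * C1 \<le> m1 / 2" using C1_pos by simp
  obtain \<epsilon>1 where \<epsilon>1: "0 < \<epsilon>1" "\<epsilon>1 \<le> 1"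
    "\<forall>\<epsilon> x u y s t. 0 < \<epsilon> \<longrightarrow> \<epsilon> \<le> \<epsilon>1 \<longrightarrow> approx_solution \<epsilon> \<kappa> x \<longrightarrow> ode_solution (\<lambda>_. f) {0..T} u \<longrightarrow>
      (\<forall>t\<in>{0..T}. norm (u t) + 1 \<le> R) \<longrightarrow> linear_solution u y \<longrightarrow> s \<in> {0..T} \<longrightarrow> x s = u s \<longrightarrow> y s = 0 \<longrightarrow>
      t \<in> {0..T} \<longrightarrow> norm (x t - u t - \<epsilon> *\<^sub>R y t) \<le> \<epsilon> * (\<kappa> * C1)"
    by (rule first_order_expansion[OF \<kappa>])
  have "compact ((\<lambda>q. c (snd q)) ` ({0..1::real} \<times> UNIV))"
    by (rule periodic_image_compact[OF T_pos]) (auto simp: c(2) intro!: continuous_on_compose2[OF c(1)] continuous_intros)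
  moreover have "(\<lambda>q. c (snd q)) ` ({0..1::real} \<times> UNIV) = range c" by force
  ultimately have cc: "compact (range c)" by simp
  have "continuous_on (range c) (\<lambda>v. norm (flow (- T) v - v))" by (intro continuous_intros)
  then obtain v2 where v2: "v2 \<in> range c" "\<And>v. v \<in> range c \<Longrightarrow> norm (flow (- T) v2 - v2) \<le> norm (flow (- T) v - v)"
    using continuous_attains_inf[OF cc] by blast
  define m2 where "m2 = norm (flow (- T) v2 - v2)"
  have m2: "0 < m2" using v2(1) c(4) by (auto simp: m2_def)
  \<comment> \<open>On \<open>c\<close> the perturbation changes the displacement by at most
    \<open>\<epsilon> * C0\<close>, which has to stay below \<open>m2\<close>.\<close>
  define \<epsilon>0 where "\<epsilon>0 = min \<epsilon>1 (m2 / (2 * C0))"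
  have e0: "0 < \<epsilon>0" "\<epsilon>0 \<le> 1" using \<epsilon>1 m2 C0_pos by (auto simp: \<epsilon>0_def)
  show ?thesis
  proof (rule that[OF e0])
    fix \<epsilon> assume \<epsilon>: "0 < \<epsilon>" "\<epsilon> \<le> \<epsilon>0"
    have \<epsilon>': "\<epsilon> \<le> \<epsilon>1" "\<epsilon> \<le> 1" using \<epsilon> e0 by (auto simp: \<epsilon>0_def)
    have "\<epsilon> \<le> m2 / (2 * C0)" using \<epsilon> by (simp add: \<epsilon>0_def)
    then have \<epsilon>C0: "\<epsilon> * C0 < m2" using C0_pos m2 by (simp add: field_simps)
    \<comment> \<open>The threshold for \<epsilon> does not depend on \<open>\<kappa>'\<close>, so
      for fixed \<epsilon> the accuracy \<open>\<kappa>'\<close> may tend to 0 afterwards.\<close>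
    have zero: "\<exists>X. approx_solution \<epsilon> \<kappa>' X \<and> X 0 = X T \<and> X T \<in> G" if \<kappa>': "0 < \<kappa>'" "\<kappa>' \<le> \<kappa>" for \<kappa>'
    proof (rule ccontr)
      assume none: "\<not> ?thesis"
      obtain X where X: "\<And>v. approx_solution \<epsilon> \<kappa>' (X v)" "\<And>v. X v T = v" "continuous_on UNIV (\<lambda>v. X v 0)"
        using approx_solution_map[OF \<epsilon>(1) \<epsilon>'(2) \<kappa>'(1)] by metis
      have X\<kappa>: "approx_solution \<epsilon> \<kappa> (X v)" for v by (rule approx_solution_mono[OF X(1)]) (use \<epsilon> \<kappa>' in auto)
      define M where "M v = X v 0 - v" for v
      have M_nz: "M v \<noteq> 0" if "v \<in> G" for v
      proof
        assume "M v = 0"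
        then have "approx_solution \<epsilon> \<kappa>' (X v) \<and> X v 0 = X v T \<and> X v T \<in> G"
          using X(1)[of v] X(2)[of v] that by (simp add: M_def)
        then show False using none by blast
      qed
      have contM: "continuous_on S M" for S
        unfolding M_def by (intro continuous_intros continuous_on_subset[OF X(3)]) auto
      have M_on: "continuous_on S (\<lambda>s. M (a s))" if "continuous_on S a" for S :: "'b::topological_space set" and a
        by (rule continuous_on_compose2[OF contM[of UNIV] that]) simp
      define h where "h v = to_complex (M v) / to_complex (f v)" for v
      have f_nzG: "f v \<noteq> 0" if "v \<in> G" for v using \<eta>(3) G(3) that by blast
      have conth: "continuous_on G h" unfolding h_def
        by (intro continuous_intros contM cont_f) (simp add: f_nzG)
      have h_nz: "h v \<noteq> 0" if "v \<in> G" for v using M_nz f_nzG that by (simp add: h_def)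
      have fc: "f (c t) \<noteq> 0" for t using f_nzG c(3) by blast
      have div_close: "norm (to_complex a / to_complex d - to_complex b / to_complex d) < norm (to_complex b / to_complex d)"
        if "norm (a - b) < norm b" "d \<noteq> 0" for a b d
        using that by (simp add: norm_divide divide_strict_right_mono flip: diff_divide_distrib to_complex_linear_simps)
      have wc: "loop_winding T (\<lambda>t. h (c t)) 0"
      proof (rule loop_winding_close[OF c_wind])
        show "continuous_on UNIV (\<lambda>t. h (c t))" unfolding h_def
          using fc by (intro continuous_intros M_on f_on c(1)) auto
        show "continuous_on UNIV (\<lambda>t. to_complex (flow (- T) (c t) - c t) / to_complex (f (c t)))"
          using fc by (intro continuous_intros f_on c(1)) auto
        fix t
        have "norm (X (c t) 0 - flow (0 - T) (X (c t) T)) \<le> \<epsilon> * C0"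
          by (rule backward_flow_estimate[OF X\<kappa>]) (use \<epsilon> \<epsilon>' \<kappa> T_pos in auto)
        then have "norm (M (c t) - (flow (- T) (c t) - c t)) \<le> \<epsilon> * C0" by (simp add: M_def X(2))
        also have "\<dots> < m2" by (rule \<epsilon>C0)
        also have "\<dots> \<le> norm (flow (- T) (c t) - c t)" unfolding m2_def by (rule v2(2)) simp
        finally show "norm (h (c t) - to_complex (flow (- T) (c t) - c t) / to_complex (f (c t)))
           < norm (to_complex (flow (- T) (c t) - c t) / to_complex (f (c t)))"
          unfolding h_def by (intro div_close fc)
      qed (simp_all add: c(2))
      define F where "F v = \<epsilon> *\<^sub>R - Phi f f' g T T v" for v
      have contF: "continuous_on UNIV (\<lambda>t. to_complex (F (x t)) / to_complex (f (x t)))"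
        unfolding F_def using f_nz
        by (intro continuous_intros f_on cont_x continuous_on_compose2[OF continuous_Phi_T]) (auto simp: K_closure)
      have "loop_winding T (\<lambda>t. of_real \<epsilon> * (to_complex (- Phi f f' g T T (x t)) / to_complex (f (x t)))) (0 + n)"
        by (intro loop_winding_mult loop_winding_const n) (use \<epsilon> in auto)
      moreover have "of_real \<epsilon> * (to_complex (- Phi f f' g T T (x t)) / to_complex (f (x t))) = to_complex (F (x t)) / to_complex (f (x t))" for t
        unfolding F_def to_complex_linear_simps(4) by (simp add: scaleR_conv_of_real)
      ultimately have nF: "loop_winding T (\<lambda>t. to_complex (F (x t)) / to_complex (f (x t))) n" by (simp only: add_0)
      have "loop_winding T (\<lambda>t. h (x t)) n"
      proof (rule loop_winding_close[OF nF _ _ contF])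
        show "continuous_on UNIV (\<lambda>t. h (x t))" unfolding h_def
          using f_nz by (intro continuous_intros M_on f_on cont_x) auto
        fix t
        let ?v = "x t"
        have vK: "?v \<in> K" by simp
        have flR: "norm (flow s ?v) + 1 \<le> R" for s using K_R[OF flow_K[OF vK], of s] by simp
        have flR': "norm (flow s ?v) \<le> R" for s using flR[of s] by simp
        have TT: "T \<in> {0..T}" using T_pos by simp
        define y where "y s = eta f f' g T s T ?v" for s
        have y: "linear_solution (\<lambda>s. flow s ?v) y" "y T = 0"
          using eta_linear_solution[of ?v T, OF flR' TT] by (simp_all add: y_def[abs_def])
        have "norm (X ?v 0 - flow 0 ?v - \<epsilon> *\<^sub>R y 0) \<le> \<epsilon> * (\<kappa> * C1)"
          by (rule \<epsilon>1(3)[rule_format, OF \<epsilon>(1) \<epsilon>'(1) X\<kappa> flow_ode_solution[OF flR'] flR y(1) TT _ y(2)])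
            (use T_pos X(2) flow_T_K[OF vK] in auto)
        moreover have "F ?v = \<epsilon> *\<^sub>R y 0" using y(2) by (simp add: F_def Phi_def y_def)
        ultimately have "norm (M ?v - F ?v) \<le> \<epsilon> * (\<kappa> * C1)" by (simp add: M_def)
        also have "\<dots> < \<epsilon> * m1" using \<kappa>C1 m1 \<epsilon> by (intro mult_strict_left_mono) auto
        also have "\<dots> \<le> norm (F ?v)"
          using v1(2)[OF vK] \<epsilon> by (simp add: F_def m1_def)
        finally show "norm (h ?v - to_complex (F ?v) / to_complex (f ?v)) < norm (to_complex (F ?v) / to_complex (f ?v))"
          unfolding h_def by (intro div_close f_nz)
      qed (simp_all add: x_T)
      then have "loop_winding T (\<lambda>t. h (c t)) n" using hom conth h_nz by blast
      then show False using wc loop_winding_unique n(1) by blast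
    qed
    have "\<exists>X. approx_solution \<epsilon> 0 X \<and> X 0 = X T \<and> X T \<in> G"
    proof (rule exact_solution_from_approx[OF \<epsilon>(1) \<epsilon>'(2) G(1)])
      fix \<kappa>' :: real assume k': "0 < \<kappa>'" "\<kappa>' \<le> 1"
      have "\<exists>X. approx_solution \<epsilon> (min \<kappa> \<kappa>') X \<and> X 0 = X T \<and> X T \<in> G" by (rule zero) (use k' \<kappa> in auto)
      then obtain X where X: "approx_solution \<epsilon> (min \<kappa> \<kappa>') X" "X 0 = X T" "X T \<in> G" by blast
      have "approx_solution \<epsilon> \<kappa>' X" by (rule approx_solution_mono[OF X(1)]) (use \<epsilon> in auto)
      then show "\<exists>X. approx_solution \<epsilon> \<kappa>' X \<and> X 0 = X T \<and> X T \<in> G" using X by blast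
    qed
    then show "\<exists>X. approx_solution \<epsilon> 0 X \<and> X 0 = X T \<and> X T \<in> D \<union> K \<and> infdist (X T) K \<le> \<eta>" using G by blast
  qed
qed

lemma approx_near_K:
  assumes X: "approx_solution \<epsilon> 0 X" and \<epsilon>: "0 \<le> \<epsilon>" "\<epsilon> \<le> 1" and t: "t \<in> {0..T}" and near: "infdist (X T) K \<le> b"
  shows "infdist (X t) K \<le> b * exp (L * T) + \<epsilon> * C0"
proof -
  obtain s where s: "norm (X T - x s) \<le> b" using near_K[OF near] by metis
  have "flow (t - T) (x s) = x (s + (t - T))" using x_flow[of "s + (t - T)" s] by simp
  then have "infdist (X t) K \<le> norm (X t - flow (t - T) (x s))" using infdist_K_le[of "X t" "s + (t - T)"] by simp
  also have "\<dots> \<le> norm (X t - flow (t - T) (X T)) + norm (flow (t - T) (X T) - flow (t - T) (x s))" by norm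
  also have "\<dots> \<le> \<epsilon> * C0 + b * exp (L * T)"
  proof (rule add_mono)
    show "norm (X t - flow (t - T) (X T)) \<le> \<epsilon> * C0" by (rule backward_flow_estimate[OF X \<epsilon> _ t]) simp
    have "norm (flow (t - T) (X T) - flow (t - T) (x s)) \<le> norm (X T - x s) * exp (L * \<bar>t - T\<bar>)" by (rule flow_dist)
    also have "\<dots> \<le> b * exp (L * T)" using s t L_pos order_trans[OF norm_ge_zero s] by (intro mult_mono) auto
    finally show "norm (flow (t - T) (X T) - flow (t - T) (x s)) \<le> b * exp (L * T)" .
  qed
  finally show ?thesis by simp
qed

text \<open>Between the distances \<open>b\<close> and \<eta> from the cycle the unperturbed
  displacement is bounded away from 0, while at the end value of a periodic solution it is at most
  \<open>\<epsilon> * C0\<close>; so this value lies within \<open>b\<close>. As \<eta> is fixed,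
  any choice of one such solution for each \<epsilon> converges.\<close>

lemma convergence_to_cycle:
  assumes iso: "\<And>v. infdist v K \<le> \<eta> \<Longrightarrow> flow (- T) v = v \<Longrightarrow> v \<in> K" and e: "0 < e"
  obtains \<epsilon>0 where "0 < \<epsilon>0"
    "\<And>\<epsilon> X t. 0 < \<epsilon> \<Longrightarrow> \<epsilon> \<le> \<epsilon>0 \<Longrightarrow> \<epsilon> \<le> 1 \<Longrightarrow> approx_solution \<epsilon> 0 X \<Longrightarrow> X 0 = X T \<Longrightarrow> infdist (X T) K \<le> \<eta> \<Longrightarrow> t \<in> {0..T} \<Longrightarrow>
      infdist (X t) K < e"
proof -
  define E where "E = exp (L * T)"
  have E: "0 < E" by (simp add: E_def)
  \<comment> \<open>\<open>b * E\<close> and \<open>\<epsilon> * C0\<close> each take a quarter of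
    \<open>e\<close>.\<close>
  define b where "b = e / (4 * E)"
  have b: "0 < b" "b * E = e / 4" using e E by (auto simp: b_def)
  define N where "N = {v. infdist v K \<le> \<eta>} \<inter> {v. b \<le> infdist v K}"
  have "closed {v. b \<le> infdist v K}" by (intro closed_Collect_le continuous_intros)
  then have cN: "compact N" unfolding N_def by (intro compact_Int_closed compact_near_K)
  have "\<exists>m>0. \<forall>v\<in>N. m \<le> norm (flow (- T) v - v)"
  proof (cases "N = {}")
    case True then show ?thesis by (intro exI[of _ 1]) simp
  next
    case False
    have "continuous_on N (\<lambda>v. norm (flow (- T) v - v))" by (intro continuous_intros)
    then obtain v where v: "v \<in> N" "\<And>u. u \<in> N \<Longrightarrow> norm (flow (- T) v - v) \<le> norm (flow (- T) u - u)"
      using continuous_attains_inf[OF cN False] by blast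
    have "flow (- T) v \<noteq> v" using iso[of v] v(1) b(1) by (auto simp: N_def)
    then show ?thesis using v(2) by (intro exI[of _ "norm (flow (- T) v - v)"]) auto
  qed
  then obtain m where m: "0 < m" "\<And>v. v \<in> N \<Longrightarrow> m \<le> norm (flow (- T) v - v)" by blast
  define \<epsilon>0 where "\<epsilon>0 = min (m / (2 * C0)) (e / (4 * C0))"
  have "0 < \<epsilon>0" using m e C0_pos by (simp add: \<epsilon>0_def)
  then show ?thesis
  proof (rule that)
    fix \<epsilon> X t assume \<epsilon>: "0 < \<epsilon>" "\<epsilon> \<le> \<epsilon>0" "\<epsilon> \<le> 1" and X: "approx_solution \<epsilon> 0 X" "X 0 = X T" "infdist (X T) K \<le> \<eta>" and t: "t \<in> {0..T}"
    have "\<epsilon> \<le> m / (2 * C0)" "\<epsilon> \<le> e / (4 * C0)" using \<epsilon> by (auto simp: \<epsilon>0_def)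
    then have eC: "\<epsilon> * C0 < m" "\<epsilon> * C0 \<le> e / 4" using C0_pos m(1) by (auto simp: field_simps)
    have "norm (X 0 - flow (0 - T) (X T)) \<le> \<epsilon> * C0"
      by (rule backward_flow_estimate[OF X(1)]) (use \<epsilon> T_pos in auto)
    then have "norm (flow (- T) (X T) - X T) < m" using eC by (simp add: X(2) norm_minus_commute)
    then have "X T \<notin> N" using m(2) by force
    then have "infdist (X T) K \<le> b" using X(3) by (auto simp: N_def)
    then have "infdist (X t) K \<le> b * E + \<epsilon> * C0" unfolding E_def using approx_near_K[OF X(1) _ _ t] \<epsilon> by simp
    then show "infdist (X t) K < e" using b eC e by simp
  qed
qed

theorem bifurcating_solutions:
  assumes g_per: "\<And>t v \<epsilon>. \<epsilon> \<in> {0..1} \<Longrightarrow> g (t + T) v \<epsilon> = g t v \<epsilon>"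
  shows "\<exists>\<epsilon>0 x1 x2. 0 < \<epsilon>0 \<and> \<epsilon>0 \<le> 1 \<and>
    (\<forall>\<epsilon>\<in>{0<..\<epsilon>0}. periodic_solution T (perturbed \<epsilon>) (x1 \<epsilon>) \<and> periodic_solution T (perturbed \<epsilon>) (x2 \<epsilon>) \<and>
      x1 \<epsilon> \<noteq> x2 \<epsilon> \<and> (\<forall>t\<in>{0..T}. x1 \<epsilon> t \<in> U \<and> x2 \<epsilon> t \<notin> U) \<and>
      (\<forall>X. periodic_solution T (perturbed \<epsilon>) X \<and> X \<noteq> x1 \<epsilon> \<and> X \<noteq> x2 \<epsilon> \<longrightarrow> (\<forall>t\<in>{0..T}. X t \<notin> K))) \<and>
    uniform_limit {0..T} (\<lambda>\<epsilon> t. infdist (x1 \<epsilon> t) K + infdist (x2 \<epsilon> t) K) (\<lambda>_. 0) (at_right 0)"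
proof -
  obtain \<eta>0 where \<eta>0: "0 < \<eta>0" "\<eta>0 \<le> 1" "\<And>v. infdist v K \<le> \<eta>0 \<Longrightarrow> f v \<noteq> 0"
    "\<And>v. infdist v K \<le> \<eta>0 \<Longrightarrow> flow (- T) v = v \<Longrightarrow> v \<in> K" using isolated_cycle by metis
  define E where "E = exp (L * T)"
  have E: "1 \<le> E" using L_pos T_pos by (simp add: E_def)
  \<comment> \<open>Over one period \<eta> grows to at most \<open>\<eta>0 / 2\<close> and the
    perturbation adds at most 1/2, so solutions stay within distance 1 of the cycle and in the
    ball.\<close>
  define \<eta> where "\<eta> = \<eta>0 / 2 / E"
  have \<eta>E: "0 < \<eta>" "\<eta> * E = \<eta>0 / 2" using \<eta>0(1) E by (auto simp: \<eta>_def)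
  have "\<eta> * 1 \<le> \<eta> * E" using \<eta>E(1) E by (intro mult_left_mono) auto
  then have \<eta>le: "\<eta> \<le> \<eta>0" using \<eta>E(2) \<eta>0(1) by simp
  have \<eta>: "0 < \<eta>" "\<eta> \<le> 1" "\<And>v. infdist v K \<le> \<eta> \<Longrightarrow> f v \<noteq> 0"
    "\<And>v. infdist v K \<le> \<eta> \<Longrightarrow> flow (- T) v = v \<Longrightarrow> v \<in> K" using \<eta>0 \<eta>E(1) \<eta>le by auto
  obtain \<epsilon>1 where \<epsilon>1: "0 < \<epsilon>1" "\<epsilon>1 \<le> 1"
    "\<And>\<epsilon>. 0 < \<epsilon> \<Longrightarrow> \<epsilon> \<le> \<epsilon>1 \<Longrightarrow> \<exists>X. approx_solution \<epsilon> 0 X \<and> X 0 = X T \<and> X T \<in> U \<union> K \<and> infdist (X T) K \<le> \<eta>"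
    using zero_of_displacement[OF _ \<eta>, of U] by metis
  obtain \<epsilon>2 where \<epsilon>2: "0 < \<epsilon>2" "\<epsilon>2 \<le> 1"
    "\<And>\<epsilon>. 0 < \<epsilon> \<Longrightarrow> \<epsilon> \<le> \<epsilon>2 \<Longrightarrow> \<exists>X. approx_solution \<epsilon> 0 X \<and> X 0 = X T \<and> X T \<in> Out \<union> K \<and> infdist (X T) K \<le> \<eta>"
    using zero_of_displacement[OF _ \<eta>, of Out] by metis
  obtain \<epsilon>3 where \<epsilon>3: "0 < \<epsilon>3" "\<epsilon>3 \<le> 1"
    "\<And>\<epsilon> X t. 0 < \<epsilon> \<Longrightarrow> \<epsilon> \<le> \<epsilon>3 \<Longrightarrow> ode_solution (perturbed \<epsilon>) {0..T} X \<Longrightarrow> X 0 = X T \<Longrightarrow> t \<in> {0..T} \<Longrightarrow> X t \<notin> K"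
  proof (rule no_touch[OF compact_K K_ne _ flow_K flow_T_K])
    show "norm \<zeta> + 1 \<le> R" if "\<zeta> \<in> K" for \<zeta> using K_R[OF that] by simp
  qed (use Phi_nz in auto)
  define \<epsilon>0 where "\<epsilon>0 = min (min \<epsilon>1 \<epsilon>2) (min \<epsilon>3 (1 / (2 * C0)))"
  have e0: "0 < \<epsilon>0" "\<epsilon>0 \<le> 1" using \<epsilon>1 \<epsilon>2 \<epsilon>3 C0_pos by (auto simp: \<epsilon>0_def)
  \<comment> \<open>Membership in \<open>approx_solution\<close> is recorded because the convergence
    estimate is stated for the truncated system.\<close>
  define good where "good D \<epsilon> Y \<longleftrightarrow> periodic_solution T (perturbed \<epsilon>) Y \<and> (\<forall>t\<in>{0..T}. Y t \<in> D) \<and>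
      approx_solution \<epsilon> 0 Y \<and> Y 0 = Y T \<and> infdist (Y T) K \<le> \<eta>" for D \<epsilon> Y
  have extend: "\<exists>Y. good D \<epsilon> Y"
    if \<epsilon>: "0 < \<epsilon>" "\<epsilon> \<le> \<epsilon>0" and X: "approx_solution \<epsilon> 0 X" "X 0 = X T" "X T \<in> D \<union> K" "infdist (X T) K \<le> \<eta>"
      and D: "frontier D = K" for D \<epsilon> X
  proof -
    have \<epsilon>': "\<epsilon> \<le> 1" "\<epsilon> \<le> \<epsilon>3" using \<epsilon> e0 by (auto simp: \<epsilon>0_def)
    have "\<epsilon> \<le> 1 / (2 * C0)" using \<epsilon> by (simp add: \<epsilon>0_def)
    then have eC: "\<epsilon> * C0 \<le> 1 / 2" using C0_pos by (simp add: field_simps)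
    have XR: "norm (X t) \<le> R" if t: "t \<in> {0..T}" for t
    proof -
      have "infdist (X t) K \<le> \<eta> * E + \<epsilon> * C0"
        unfolding E_def using \<epsilon> \<epsilon>' by (intro approx_near_K X t) auto
      then have "infdist (X t) K \<le> 1" using eC \<eta>E \<eta>0(2) by simp
      then show ?thesis using near_K_R[of "X t"] by simp
    qed
    have sol: "ode_solution (perturbed \<epsilon>) {0..T} X" by (rule exact_solution_in_ball[OF X(1) XR])
    \<comment> \<open>Excluding contact turns \<open>D \<union> K\<close> into \<open>D\<close> at
      time \<open>T\<close>, and connectedness of \<open>{0..T}\<close> then keeps the solution on
      that side.\<close>
    have off: "X t \<notin> K" if "t \<in> {0..T}" for t by (rule \<epsilon>3(3)[OF \<epsilon>(1) \<epsilon>'(2) sol X(2) that])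
    have XD: "X t \<in> D" if "t \<in> {0..T}" for t
    proof (rule stays_in_side[OF D, of "{0..T}" X T t])
      show "continuous_on {0..T} X"
        using sol unfolding ode_solution_def by (intro continuous_on_vector_derivative) auto
      show "X T \<in> D" using X(3) off[of T] T_pos by auto
    qed (use off that T_pos in auto)
    obtain Y where Y: "periodic_solution T (perturbed \<epsilon>) Y" "\<And>t. t \<in> {0..T} \<Longrightarrow> Y t = X t"
    proof (rule periodic_extension[OF T_pos sol X(2)])
      show "perturbed \<epsilon> (t + T) v = perturbed \<epsilon> t v" for t v using g_per[of \<epsilon>] \<epsilon> \<epsilon>' by simp
    qed blast
    have TT: "T \<in> {0..T}" "0 \<in> {0..T}" using T_pos by auto
    have Yode: "ode_solution (perturbed \<epsilon>) {0..T} Y"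
      using Y(1) unfolding periodic_solution_def ode_solution_def by (auto intro: has_vector_derivative_at_within)
    have "approx_solution \<epsilon> 0 Y"
      by (rule approx_of_exact_solution[OF Yode]) (use XR Y(2) \<epsilon> in auto)
    then have "good D \<epsilon> Y" using Y XD X TT by (simp add: good_def)
    then show ?thesis by blast
  qed
  have "\<exists>Y. good U \<epsilon> Y" if "\<epsilon> \<in> {0<..\<epsilon>0}" for \<epsilon>
  proof -
    have "0 < \<epsilon>" "\<epsilon> \<le> \<epsilon>1" using that by (auto simp: \<epsilon>0_def)
    then obtain X where "approx_solution \<epsilon> 0 X" "X 0 = X T" "X T \<in> U \<union> K" "infdist (X T) K \<le> \<eta>" using \<epsilon>1(3) by blast
    then show ?thesis using extend[OF _ _ _ _ _ _ frontier_U] that by simp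
  qed
  then obtain x1 where x1: "\<And>\<epsilon>. \<epsilon> \<in> {0<..\<epsilon>0} \<Longrightarrow> good U \<epsilon> (x1 \<epsilon>)" by metis
  have "\<exists>Y. good Out \<epsilon> Y" if "\<epsilon> \<in> {0<..\<epsilon>0}" for \<epsilon>
  proof -
    have "0 < \<epsilon>" "\<epsilon> \<le> \<epsilon>2" using that by (auto simp: \<epsilon>0_def)
    then obtain X where "approx_solution \<epsilon> 0 X" "X 0 = X T" "X T \<in> Out \<union> K" "infdist (X T) K \<le> \<eta>" using \<epsilon>2(3) by blast
    then show ?thesis using extend[OF _ _ _ _ _ _ frontier_Out] that by simp
  qed
  then obtain x2 where x2: "\<And>\<epsilon>. \<epsilon> \<in> {0<..\<epsilon>0} \<Longrightarrow> good Out \<epsilon> (x2 \<epsilon>)" by metis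
  have "uniform_limit {0..T} (\<lambda>\<epsilon> t. infdist (x1 \<epsilon> t) K + infdist (x2 \<epsilon> t) K) (\<lambda>_. 0) (at_right 0)"
    unfolding uniform_limit_iff
  proof (intro allI impI)
    fix e :: real assume e: "0 < e"
    then have e2: "0 < e / 2" by simp
    obtain \<epsilon>4 where \<epsilon>4: "0 < \<epsilon>4"
      "\<And>\<epsilon> X t. 0 < \<epsilon> \<Longrightarrow> \<epsilon> \<le> \<epsilon>4 \<Longrightarrow> \<epsilon> \<le> 1 \<Longrightarrow> approx_solution \<epsilon> 0 X \<Longrightarrow> X 0 = X T \<Longrightarrow> infdist (X T) K \<le> \<eta> \<Longrightarrow> t \<in> {0..T} \<Longrightarrow>
        infdist (X t) K < e / 2"
      using convergence_to_cycle[OF \<eta>(4) e2] by metis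
    show "\<forall>\<^sub>F \<epsilon> in at_right 0. \<forall>t\<in>{0..T}. dist (infdist (x1 \<epsilon> t) K + infdist (x2 \<epsilon> t) K) 0 < e"
      unfolding eventually_at_right_field
    proof (intro exI[of _ "min \<epsilon>0 \<epsilon>4"] conjI allI impI ballI)
      fix \<epsilon> t assume "0 < \<epsilon>" "\<epsilon> < min \<epsilon>0 \<epsilon>4" and t: "t \<in> {0..T}"
      then have \<epsilon>: "\<epsilon> \<in> {0<..\<epsilon>0}" "0 < \<epsilon>" "\<epsilon> \<le> \<epsilon>4" "\<epsilon> \<le> 1" using e0 by auto
      have "infdist (x1 \<epsilon> t) K < e / 2" "infdist (x2 \<epsilon> t) K < e / 2"
        using x1[OF \<epsilon>(1)] x2[OF \<epsilon>(1)] \<epsilon>4(2)[OF \<epsilon>(2-4) _ _ _ t] by (auto simp: good_def)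
      then show "dist (infdist (x1 \<epsilon> t) K + infdist (x2 \<epsilon> t) K) 0 < e"
        using infdist_nonneg[of "x1 \<epsilon> t" K] infdist_nonneg[of "x2 \<epsilon> t" K] by (simp add: dist_norm)
    qed (use e0 \<epsilon>4 in auto)
  qed
  moreover have "\<forall>\<epsilon>\<in>{0<..\<epsilon>0}. periodic_solution T (perturbed \<epsilon>) (x1 \<epsilon>) \<and> periodic_solution T (perturbed \<epsilon>) (x2 \<epsilon>) \<and>
      x1 \<epsilon> \<noteq> x2 \<epsilon> \<and> (\<forall>t\<in>{0..T}. x1 \<epsilon> t \<in> U \<and> x2 \<epsilon> t \<notin> U) \<and>
      (\<forall>X. periodic_solution T (perturbed \<epsilon>) X \<and> X \<noteq> x1 \<epsilon> \<and> X \<noteq> x2 \<epsilon> \<longrightarrow> (\<forall>t\<in>{0..T}. X t \<notin> K))"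
  proof
    fix \<epsilon> assume \<epsilon>: "\<epsilon> \<in> {0<..\<epsilon>0}"
    have g1: "periodic_solution T (perturbed \<epsilon>) (x1 \<epsilon>)" "\<And>t. t \<in> {0..T} \<Longrightarrow> x1 \<epsilon> t \<in> U"
      using x1[OF \<epsilon>] by (auto simp: good_def)
    have g2: "periodic_solution T (perturbed \<epsilon>) (x2 \<epsilon>)" "\<And>t. t \<in> {0..T} \<Longrightarrow> x2 \<epsilon> t \<notin> U"
      using x2[OF \<epsilon>] U_Out(1) unfolding good_def by blast+
    have ne: "x1 \<epsilon> \<noteq> x2 \<epsilon>" using g1(2)[of 0] g2(2)[of 0] T_pos by auto
    \<comment> \<open>No nearness is assumed: every \<open>T\<close>-periodic solution of the
      perturbed system avoids the cycle.\<close>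
    have off: "X t \<notin> K" if X: "periodic_solution T (perturbed \<epsilon>) X" and t: "t \<in> {0..T}" for X t
    proof (rule \<epsilon>3(3)[OF _ _ _ _ t])
      show "ode_solution (perturbed \<epsilon>) {0..T} X"
        using X unfolding periodic_solution_def ode_solution_def by (auto intro: has_vector_derivative_at_within)
      show "X 0 = X T" using X unfolding periodic_solution_def by (metis add_0)
    qed (use \<epsilon> in \<open>auto simp: \<epsilon>0_def\<close>)
    show "periodic_solution T (perturbed \<epsilon>) (x1 \<epsilon>) \<and> periodic_solution T (perturbed \<epsilon>) (x2 \<epsilon>) \<and>
      x1 \<epsilon> \<noteq> x2 \<epsilon> \<and> (\<forall>t\<in>{0..T}. x1 \<epsilon> t \<in> U \<and> x2 \<epsilon> t \<notin> U) \<and>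
      (\<forall>X. periodic_solution T (perturbed \<epsilon>) X \<and> X \<noteq> x1 \<epsilon> \<and> X \<noteq> x2 \<epsilon> \<longrightarrow> (\<forall>t\<in>{0..T}. X t \<notin> K))"
      by (intro conjI allI impI ballI g1 g2 ne; (assumption | elim conjE, rule off, assumption, assumption))
  qed
  ultimately show ?thesis using e0 by blast
qed

end

section \<open>Least period, choice of the ball, and conclusion\<close>

lemma frontier_inside_loop:
  assumes "jordan_loop (\<lambda>t. to_complex (x t)) p"
  shows "frontier (inside (range x)) = range x"
proof -
  interpret jordan_loop "\<lambda>t. to_complex (x t)" p by fact
  have "range x = of_complex ` range (\<lambda>t. to_complex (x t))" by (auto simp: image_image)
  then show ?thesis using U_facts(3) inside_of_complex[of "range (\<lambda>t. to_complex (x t))"] by simp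
qed

theorem mainTheorem6:
  fixes T :: real
    and f :: "real^2 \<Rightarrow> real^2"
    and f' :: "real^2 \<Rightarrow> (real^2) \<Rightarrow>\<^sub>L (real^2)"
    and g :: "real \<Rightarrow> real^2 \<Rightarrow> real \<Rightarrow> real^2"
    and xt :: "real \<Rightarrow> real^2"
    and U :: "(real^2) set"
  assumes "T > 0"
    and "\<And>x. (f has_derivative blinfun_apply (f' x)) (at x)"
    and "continuous_on UNIV f'"
    and "continuous_on (UNIV \<times> UNIV \<times> {0..1}) (\<lambda>(t, x, \<epsilon>). g t x \<epsilon>)"
    and "\<And>t x \<epsilon>. \<epsilon> \<in> {0..1} \<Longrightarrow> g (t + T) x \<epsilon> = g t x \<epsilon>"
    and "\<And>t0 \<xi>. t0 \<in> {0..T} \<Longrightarrow> \<exists>x. ode_solution (\<lambda>_. f) {0..T} x \<and> x t0 = \<xi>"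
    and "periodic_cycle T f xt"
    and "U = inside (range xt)"
    and "\<And>\<xi> s. \<xi> \<in> frontier U \<Longrightarrow> s \<in> {0..T} \<Longrightarrow> Phi f f' g T s \<xi> \<noteq> 0"
    and A1: "\<exists>V. open V \<and> frontier U \<subseteq> V \<and>
          (\<forall>y. periodic_cycle T f y \<and> range y \<subseteq> V \<longrightarrow> (\<exists>c. \<forall>t. y t = xt (t + c)))"
    and "brouwer_degree (\<lambda>\<xi>. - Phi f f' g T T \<xi>) U \<noteq> 1"
  shows "\<exists>\<epsilon>0 x1 x2. 0 < \<epsilon>0 \<and> \<epsilon>0 \<le> 1 \<and>
    (\<forall>\<epsilon>\<in>{0<..\<epsilon>0}.
      periodic_solution T (\<lambda>t x. f x + \<epsilon> *\<^sub>R g t x \<epsilon>) (x1 \<epsilon>) \<and>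
      periodic_solution T (\<lambda>t x. f x + \<epsilon> *\<^sub>R g t x \<epsilon>) (x2 \<epsilon>) \<and>
      x1 \<epsilon> \<noteq> x2 \<epsilon> \<and>
      (\<forall>t\<in>{0..T}. x1 \<epsilon> t \<in> U \<and> x2 \<epsilon> t \<notin> U) \<and>
      (\<forall>x. periodic_solution T (\<lambda>t x. f x + \<epsilon> *\<^sub>R g t x \<epsilon>) x \<and> x \<noteq> x1 \<epsilon> \<and> x \<noteq> x2 \<epsilon>
        \<longrightarrow> (\<forall>t\<in>{0..T}. x t \<notin> frontier U))) \<and>
    uniform_limit {0..T}
      (\<lambda>\<epsilon> t. infdist (x1 \<epsilon> t) (frontier U) + infdist (x2 \<epsilon> t) (frontier U))
      (\<lambda>_. 0) (at_right 0)"
proof -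
  have der: "(xt has_vector_derivative f (xt t)) (at t)" and per: "xt (t + T) = xt t" for t
    using assms(7) unfolding periodic_cycle_def periodic_solution_def ode_solution_def by auto
  obtain s1 s2 where s12: "xt s1 \<noteq> xt s2" using assms(7) unfolding periodic_cycle_def by blast
  have unique: "y t = z t"
    if y: "\<And>t. (y has_vector_derivative f (y t)) (at t)" and z: "\<And>t. (z has_vector_derivative f (z t)) (at t)"
      and s: "y s = z s" for y z and s t :: real
    by (rule C1_solution_unique[OF assms(2,3), where a="min s t" and b="max s t" and s=s])
      (use s in \<open>auto intro: has_vector_derivative_at_within y z\<close>)
  have shift: "((\<lambda>u. xt (u + s)) has_vector_derivative f (xt (t + s))) (at t)" for s t
  proof -
    have "((xt \<circ> (\<lambda>u. u + s)) has_vector_derivative 1 *\<^sub>R f (xt (t + s))) (at t)"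
      by (rule vector_diff_chain_at) (auto intro!: derivative_eq_intros der)
    then show ?thesis by (simp add: o_def)
  qed
  have hom: "xt (u + s) = xt (u + t)" if "xt s = xt t" for s t u
    by (rule unique[where s=0 and y="\<lambda>u. xt (u + s)" and z="\<lambda>u. xt (u + t)"]) (use shift that in auto)
  \<comment> \<open>A zero of \<open>f\<close> on the cycle would be a constant solution, with which
    the cycle would coincide by uniqueness.\<close>
  have f_nz: "f (xt t) \<noteq> 0" for t
  proof
    assume "f (xt t) = 0"
    then have const: "((\<lambda>_. xt t) has_vector_derivative f (xt t)) (at r)" for r by simp
    have "xt s = xt t" for s by (rule unique[where s=t and z="\<lambda>_. xt t", OF der const refl])
    then show False using s12 by metis
  qed
  have cont: "continuous_on UNIV xt" by (rule continuous_on_vector_derivative) (use der in simp)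
  \<comment> \<open>The error is at most half the displacement at the initial velocity, so small
    nonzero times move the point and cannot be periods.\<close>
  obtain d where d: "0 < d" "\<And>s. norm (s - 0) < d \<Longrightarrow> norm (xt s - xt 0 - (s - 0) *\<^sub>R f (xt 0)) \<le> norm (f (xt 0)) / 2 * norm (s - 0)"
  proof -
    have "0 < norm (f (xt 0)) / 2" using f_nz by simp
    moreover have "\<forall>e>0. \<exists>d>0. \<forall>s. norm (s - 0) < d \<longrightarrow> norm (xt s - xt 0 - (s - 0) *\<^sub>R f (xt 0)) \<le> e * norm (s - 0)"
      using der[of 0] unfolding has_vector_derivative_def has_derivative_at_alt by (elim conjE)
    ultimately show ?thesis using that by meson
  qed
  have loc: "xt s \<noteq> xt 0" if "0 < \<bar>s\<bar>" "\<bar>s\<bar> < d" for s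
    using d(2)[of s] that f_nz[of 0] by (auto simp: mult_less_cancel_left)
  obtain p k where p: "0 < p" "T = real k * p" "\<And>t. xt (t + p) = xt t" "inj_on xt {0..<p}"
    using minimal_period[OF assms(1) cont per hom d(1) loc] by metis
  have jl: "jordan_loop (\<lambda>t. to_complex (xt t)) p"
    by unfold_locales (use p in \<open>auto simp: inj_on_def to_complex_eq_iff intro!: continuous_intros cont\<close>)
  have fr: "frontier U = range xt" unfolding assms(8) by (rule frontier_inside_loop[OF jl])
  have "bounded (closure U)"
  proof -
    interpret jordan_loop "\<lambda>t. to_complex (xt t)" p by (rule jl)
    have im: "range xt = of_complex ` range (\<lambda>t. to_complex (xt t))" by (auto simp: image_image)
    show ?thesis unfolding assms(8) im inside_of_complex by (rule bounded_closure[OF U_facts(2)])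
  qed
  then obtain r where r: "\<And>v. v \<in> closure U \<Longrightarrow> norm v \<le> r" unfolding bounded_iff by blast
  \<comment> \<open>The absolute value ensures \<open>0 < R\<close>; the summand 2 is the margin
    asked for by \<open>R_ins\<close>.\<close>
  define R where "R = \<bar>r\<bar> + 2"
  interpret planar_cycle T R f f' g xt p k
  proof
    show "norm v + 2 \<le> R" if "v \<in> closure (inside (range xt))" for v
      using r[of v] that by (simp add: R_def assms(8))
    show "\<exists>V. open V \<and> range xt \<subseteq> V \<and>
          (\<forall>y. periodic_cycle T f y \<and> range y \<subseteq> V \<longrightarrow> (\<exists>c. \<forall>t. y t = xt (t + c)))"
      using A1 unfolding fr .
    show "Phi f f' g T s \<xi> \<noteq> 0" if "\<xi> \<in> range xt" "s \<in> {0..T}" for \<xi> s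
      using assms(9)[of \<xi> s] that fr by simp
    show "brouwer_degree (\<lambda>\<xi>. - Phi f f' g T T \<xi>) (inside (range xt)) \<noteq> 1"
      using assms(11) unfolding assms(8) .
    show "0 < R" by (simp add: R_def)
  qed (use assms(1-4) der p f_nz in auto)
  show ?thesis
    using bifurcating_solutions[OF assms(5)] unfolding fr unfolding assms(8) inside_K by blast
qed

end
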